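(* Let $\Lambda$ be a source-free, row-finite $k$-graph which is degree $B$ sink-free if $k\ge3$, and let $(\Gamma,d_\Gamma)$ be the LiMaR-split of $\Lambda$ in degree $B$ (at $w$). Let $\mathbb F$ be a field and let $\{p_v,s_e: v\in\Lambda^0,e\in\Lambda^1\}$ and $\{q_{v^i},t_{e^j}:v^i\in\Gamma^0,e^j\in\Gamma^1\}$ denote the universal Kumjian-Pask $\Lambda$- and $\Gamma$-families, respectively. Let $X=\{v^1:v\in\Lambda^0\}\subseteq\Gamma^0$ and let $P_X=\sum_{v\in X}q_v$. Then there exists a diagonal-preserving $\mathbb Z^k$-graded isomorphism $\psi:\mathrm{KP}_{\mathbb F}(\Lambda)\to P_X\,\mathrm{KP}_{\mathbb F}(\Gamma)\,P_X$, i.e. one such that $\psi(\mathcal D(\mathrm{KP}_{\mathbb F}(\Lambda)))=P_X\,\mathcal D(\mathrm{KP}_{\mathbb F}(\Gamma))$.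
   Context: Let $\mathbb N=\{0,1,2,\dots\}$, let $\mathbf e_1,\dots,\mathbf e_k$ be the standard basis of $\mathbb N^k$, and $|\mathbf n|=\sum_i n_i$. A $k$-graph ($k\ge 1$) is a countable small category $\Lambda$ with a functor $d:\Lambda\to\mathbb N^k$ such that whenever $d(\lambda)=\mathbf m+\mathbf n$ there are unique $\mu,\nu\in\Lambda$ with $\lambda=\mu\nu$, $d(\mu)=\mathbf m$, $d(\nu)=\mathbf n$. Write $\Lambda^{\mathbf n}=d^{-1}(\mathbf n)$, $\Lambda^0=d^{-1}(\mathbf 0)$ (vertices, identified with objects), $\Lambda^1=\{\lambda:|d(\lambda)|=1\}$ (edges); $r,s$ are range and source ($\lambda\mu$ is defined iff $s(\lambda)=r(\mu)$); $v\Lambda^{\mathbf n}=\{\lambda\in\Lambda^{\mathbf n}:r(\lambda)=v\}$. $\Lambda$ is row-finite if every $v\Lambda^{\mathbf e_i}$ is finite, and source-free if every $v\Lambda^{\mathbf e_i}$ is nonempty. $\Lambda$ is degree $\mathbf e_i$ sink-free if every vertex is the source of some edge of degree $\mathbf e_i$. The 1-skeleton $G$ of $\Lambda$ is the directed graph $(\Lambda^0,\Lambda^1,r,s)$ with edges coloured by $d$; $G^*$ is its category of finite paths $f_m\cdots f_1$ with $s(f_{i+1})=r(f_i)$; for paths $\lambda,\mu\in G^*$, $\lambda\sim\mu$ means they have the same composite in $\Lambda$ (so $\Lambda=G^*/\!\sim$). LiMaR-split. Fix $B\in\{\mathbf e_1,\dots,\mathbf e_k\}$ and put $A=\{\mathbf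 e_1,\dots,\mathbf e_k\}\setminus\{B\}$. Write $s_B^{-1}(v)=\{e\in\Lambda^1:d(e)=B,\ s(e)=v\}$. Fix $w\in\Lambda^0$ with $|s_B^{-1}(w)|\ge2$. Let $S_w\subseteq\Lambda^0$ be the smallest set such that $w\in S_w$, and such that if $x\in S_w$ and $e\in\Lambda^1$ with $d(e)\in A$, $s(e)=x$, $|s_B^{-1}(r(e))|\ge2$, then $r(e)\in S_w$. Define $n:\Lambda^0\to\mathbb N$ by $n(v)=|s_B^{-1}(v)|$ if $v\in S_w$ and $n(v)=1$ otherwise (so it is assumed that $s_B^{-1}(v)$ is finite for $v\in S_w$). For each $v$ with $s_B^{-1}(v)\ne\emptyset$ fix a partition $s_B^{-1}(v)=\mathcal E^v_1\sqcup\dots\sqcup\mathcal E^v_{n(v)}$ into nonempty sets. The directed graph $G_L=(\Gamma^0,\Gamma^1,r_\Gamma,s_\Gamma)$ has $\Gamma^0=\{v^i:v\in\Lambda^0,1\le i\le n(v)\}$, $\Gamma^1=\{e^i:e\in\Lambda^1,1\le i\le n(r(e))\}$, $r_\Gamma(e^i)=r(e)^i$, and $s_\Gamma(e^i)=s(e)^j$ where: (1) if $d(e)=B$, $j$ is the index with $e\in\mathcal E^{s(e)}_j$; (2) if $d(e)\in A$ and $s_B^{-1}(r(e))\neq\emptyset$, choose $f\in\mathcal E^{r(e)}_i$, let $ac$ be the path with $fe\sim ac$, $d(c)=B$, $d(a)=d(e)$, and $j$ is the index with $c\in\mathcal E_j^{s(c)}$ (this does not depend on the choice of $f$); (3) otherwise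 $j=1$. Let $par:G_L\to G$, $par(e^i)=e$, $par(v^i)=v$, extended to paths; $d_\Gamma(e^i)=d(e)$, extended additively to paths. For paths $\lambda,\mu\in G_L^*$ put $\lambda\sim_L\mu$ iff $par(\lambda)\sim par(\mu)$, $r_\Gamma(\lambda)=r_\Gamma(\mu)$ and $s_\Gamma(\lambda)=s_\Gamma(\mu)$. The LiMaR-split of $\Lambda$ in degree $B$ (at $w$) is $\Gamma=G_L^*/\!\sim_L$ with degree map $d_\Gamma$; under the hypotheses of the claim it is a row-finite, source-free $k$-graph. Kumjian-Pask algebras. For each $\lambda\in\Lambda$ with $d(\lambda)\ne\mathbf 0$ introduce a formal ghost path $\lambda^*$; $v^*=v$ for vertices. A Kumjian-Pask $\Lambda$-family in an $\mathbb F$-algebra consists of elements $P_v$ ($v\in\Lambda^0$), $T_\lambda,T_{\lambda^*}$ ($d(\lambda)\neq\mathbf 0$), with $T_v=T_{v^*}=P_v$, such that: the $P_v$ are mutually orthogonal idempotents; $T_\lambda T_\mu=T_{\lambda\mu}$ and $T_{\mu^*}T_{\lambda^*}=T_{(\lambda\mu)^*}$ if $s(\lambda)=r(\mu)$, $P_{r(\lambda)}T_\lambda=T_\lambda=T_\lambda P_{s(\lambda)}$, $P_{s(\lambda)}T_{\lambda^*}=T_{\lambda^*}=T_{\lambda^*}P_{r(\lambda)}$; $T_{\lambda^*}T_\mu=\delta_{\lambda,\mu}P_{s(\lambda)}$ if $d(\lambda)=d(\mu)$; $P_v=\sum_{\lambda\in v\Lambda^{\mathbf n}}T_\lambda T_{\lambda^*}$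 for all $v$ and all $\mathbf n\ne\mathbf 0$. $\mathrm{KP}_{\mathbb F}(\Lambda)$ is the $\mathbb F$-algebra generated by a universal such family; it is $\mathbb Z^k$-graded with $\mathbf n$-component $\mathrm{span}_{\mathbb F}\{s_\lambda s_{\mu^*}:d(\lambda)-d(\mu)=\mathbf n\}$. Its diagonal is $\mathcal D(\mathrm{KP}_{\mathbb F}(\Lambda))=\mathrm{span}_{\mathbb F}\{s_\lambda s_{\lambda^*}:\lambda\in\Lambda\}$; similarly for $\Gamma$. If $X$ is infinite, $P_X$ is understood as a formal (multiplier) idempotent: multiplication by it on any given element is a finite sum, so $P_X\mathrm{KP}_{\mathbb F}(\Gamma)P_X=\mathrm{span}_{\mathbb F}\{t_\gamma t_{\delta^*}:s_\Gamma(\gamma)=s_\Gamma(\delta),\ r_\Gamma(\gamma),r_\Gamma(\delta)\in X\}$ and $P_X\mathcal D(\mathrm{KP}_{\mathbb F}(\Gamma))=\mathrm{span}_{\mathbb F}\{t_\gamma t_{\gamma^*}:r_\Gamma(\gamma)\in X\}$. *)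

theory Defs
  imports
    "HOL-Analysis.Finite_Cartesian_Product"
    "HOL-Library.Countable_Set"
    "HOL-Library.Disjoint_Sets"
    "HOL-Library.Poly_Mapping"
    "HOL-Algebra.Module"
    "HOL-Algebra.QuotRing"
begin

section \<open>Higher-rank graphs\<close>

text \<open>
  Degrees live in \<^typ>\<open>nat ^ 'k\<close>, so the rank is the cardinality of the finite type \<open>'k\<close>, and the
  standard basis vector belonging to a colour \<open>i :: 'k\<close> is \<open>axis i 1\<close>.
  Objects of the category are identified with their identity morphisms, so source and range
  map morphisms to morphisms. \<open>Cmp \<Lambda> \<alpha> \<mu>\<close> is the composite \<open>\<alpha>\<mu>\<close>; it is meaningful only if
  \<open>Src \<Lambda> \<alpha> = Rng \<Lambda> \<mu>\<close>.
\<close>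

record ('m, 'k::finite) kgraph =
  Mor :: "'m set"
  Deg :: "'m \<Rightarrow> nat ^ 'k"
  Src :: "'m \<Rightarrow> 'm"
  Rng :: "'m \<Rightarrow> 'm"
  Cmp :: "'m \<Rightarrow> 'm \<Rightarrow> 'm"

abbreviation basis_deg :: "'k::finite \<Rightarrow> nat ^ 'k" where
  "basis_deg i \<equiv> axis i 1"

locale k_graph =
  fixes \<Lambda> :: "('m, 'k::finite) kgraph"
  assumes countable_Mor: "countable (Mor \<Lambda>)"
    and Src_closed: "\<alpha> \<in> Mor \<Lambda> \<Longrightarrow> Src \<Lambda> \<alpha> \<in> Mor \<Lambda>"
    and Rng_closed: "\<alpha> \<in> Mor \<Lambda> \<Longrightarrow> Rng \<Lambda> \<alpha> \<in> Mor \<Lambda>"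
    and Src_Src: "\<alpha> \<in> Mor \<Lambda> \<Longrightarrow> Src \<Lambda> (Src \<Lambda> \<alpha>) = Src \<Lambda> \<alpha>"
    and Rng_Src: "\<alpha> \<in> Mor \<Lambda> \<Longrightarrow> Rng \<Lambda> (Src \<Lambda> \<alpha>) = Src \<Lambda> \<alpha>"
    and Src_Rng: "\<alpha> \<in> Mor \<Lambda> \<Longrightarrow> Src \<Lambda> (Rng \<Lambda> \<alpha>) = Rng \<Lambda> \<alpha>"
    and Rng_Rng: "\<alpha> \<in> Mor \<Lambda> \<Longrightarrow> Rng \<Lambda> (Rng \<Lambda> \<alpha>) = Rng \<Lambda> \<alpha>"
    and Cmp_closed: "\<lbrakk>\<alpha> \<in> Mor \<Lambda>; \<mu> \<in> Mor \<Lambda>; Src \<Lambda> \<alpha> = Rng \<Lambda> \<mu>\<rbrakk> \<Longrightarrow> Cmp \<Lambda> \<alpha> \<mu> \<in> Mor \<Lambda>"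
    and Rng_Cmp: "\<lbrakk>\<alpha> \<in> Mor \<Lambda>; \<mu> \<in> Mor \<Lambda>; Src \<Lambda> \<alpha> = Rng \<Lambda> \<mu>\<rbrakk> \<Longrightarrow> Rng \<Lambda> (Cmp \<Lambda> \<alpha> \<mu>) = Rng \<Lambda> \<alpha>"
    and Src_Cmp: "\<lbrakk>\<alpha> \<in> Mor \<Lambda>; \<mu> \<in> Mor \<Lambda>; Src \<Lambda> \<alpha> = Rng \<Lambda> \<mu>\<rbrakk> \<Longrightarrow> Src \<Lambda> (Cmp \<Lambda> \<alpha> \<mu>) = Src \<Lambda> \<mu>"
    and Cmp_assoc: "\<lbrakk>\<alpha> \<in> Mor \<Lambda>; \<mu> \<in> Mor \<Lambda>; \<nu> \<in> Mor \<Lambda>; Src \<Lambda> \<alpha> = Rng \<Lambda> \<mu>; Src \<Lambda> \<mu> = Rng \<Lambda> \<nu>\<rbrakk>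
          \<Longrightarrow> Cmp \<Lambda> (Cmp \<Lambda> \<alpha> \<mu>) \<nu> = Cmp \<Lambda> \<alpha> (Cmp \<Lambda> \<mu> \<nu>)"
    and Cmp_Src: "\<alpha> \<in> Mor \<Lambda> \<Longrightarrow> Cmp \<Lambda> \<alpha> (Src \<Lambda> \<alpha>) = \<alpha>"
    and Cmp_Rng: "\<alpha> \<in> Mor \<Lambda> \<Longrightarrow> Cmp \<Lambda> (Rng \<Lambda> \<alpha>) \<alpha> = \<alpha>"
    and Deg_Src: "\<alpha> \<in> Mor \<Lambda> \<Longrightarrow> Deg \<Lambda> (Src \<Lambda> \<alpha>) = 0"
    and Deg_Cmp: "\<lbrakk>\<alpha> \<in> Mor \<Lambda>; \<mu> \<in> Mor \<Lambda>; Src \<Lambda> \<alpha> = Rng \<Lambda> \<mu>\<rbrakk>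
          \<Longrightarrow> Deg \<Lambda> (Cmp \<Lambda> \<alpha> \<mu>) = Deg \<Lambda> \<alpha> + Deg \<Lambda> \<mu>"
    and unique_factorisation: "\<lbrakk>\<alpha> \<in> Mor \<Lambda>; Deg \<Lambda> \<alpha> = m + n\<rbrakk> \<Longrightarrow>
          \<exists>!p. case p of (\<mu>, \<nu>) \<Rightarrow> \<mu> \<in> Mor \<Lambda> \<and> \<nu> \<in> Mor \<Lambda> \<and> Src \<Lambda> \<mu> = Rng \<Lambda> \<nu> \<and>
                 \<alpha> = Cmp \<Lambda> \<mu> \<nu> \<and> Deg \<Lambda> \<mu> = m \<and> Deg \<Lambda> \<nu> = n"

definition kg_verts :: "('m, 'k::finite) kgraph \<Rightarrow> 'm set" where
  "kg_verts \<Lambda> = {\<alpha> \<in> Mor \<Lambda>. Deg \<Lambda> \<alpha> = 0}"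

definition kg_edges :: "('m, 'k::finite) kgraph \<Rightarrow> 'm set" where
  "kg_edges \<Lambda> = {\<alpha> \<in> Mor \<Lambda>. (\<Sum>i\<in>UNIV. Deg \<Lambda> \<alpha> $ i) = 1}"

definition paths_into :: "('m, 'k::finite) kgraph \<Rightarrow> 'm \<Rightarrow> nat ^ 'k \<Rightarrow> 'm set" where
  "paths_into \<Lambda> v n = {\<alpha> \<in> Mor \<Lambda>. Deg \<Lambda> \<alpha> = n \<and> Rng \<Lambda> \<alpha> = v}"

definition row_finite :: "('m, 'k::finite) kgraph \<Rightarrow> bool" where
  "row_finite \<Lambda> \<longleftrightarrow> (\<forall>v\<in>kg_verts \<Lambda>. \<forall>i. finite (paths_into \<Lambda> v (basis_deg i)))"

definition source_free :: "('m, 'k::finite) kgraph \<Rightarrow> bool" where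
  "source_free \<Lambda> \<longleftrightarrow> (\<forall>v\<in>kg_verts \<Lambda>. \<forall>i. paths_into \<Lambda> v (basis_deg i) \<noteq> {})"

definition edges_out :: "('m, 'k::finite) kgraph \<Rightarrow> 'k \<Rightarrow> 'm \<Rightarrow> 'm set" where
  "edges_out \<Lambda> b v = {e \<in> kg_edges \<Lambda>. Deg \<Lambda> e = basis_deg b \<and> Src \<Lambda> e = v}"

definition sink_free :: "('m, 'k::finite) kgraph \<Rightarrow> 'k \<Rightarrow> bool" where
  "sink_free \<Lambda> b \<longleftrightarrow> (\<forall>v\<in>kg_verts \<Lambda>. edges_out \<Lambda> b v \<noteq> {})"


section \<open>The LiMaR-split\<close>

text \<open>
  Throughout, \<open>b\<close> is the colour with \<open>B = basis_deg b\<close>; the degrees in \<open>A\<close> are those of the edges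
  \<open>e\<close> with \<open>Deg \<Lambda> e \<noteq> basis_deg b\<close>.
\<close>

text \<open>Spelled out because \<^const>\<open>card\<close> is 0 on infinite sets.\<close>

definition at_least_two :: "'a set \<Rightarrow> bool" where
  "at_least_two S \<longleftrightarrow> infinite S \<or> 2 \<le> card S"

inductive_set split_verts :: "('m, 'k::finite) kgraph \<Rightarrow> 'k \<Rightarrow> 'm \<Rightarrow> 'm set"
  for \<Lambda> b w where
  base: "w \<in> split_verts \<Lambda> b w"
| step: "\<lbrakk>x \<in> split_verts \<Lambda> b w; e \<in> kg_edges \<Lambda>; Deg \<Lambda> e \<noteq> basis_deg b; Src \<Lambda> e = x;
          at_least_two (edges_out \<Lambda> b (Rng \<Lambda> e))\<rbrakk> \<Longrightarrow> Rng \<Lambda> e \<in> split_verts \<Lambda> b w"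

definition split_num :: "('m, 'k::finite) kgraph \<Rightarrow> 'k \<Rightarrow> 'm \<Rightarrow> 'm \<Rightarrow> nat" where
  "split_num \<Lambda> b w v = (if v \<in> split_verts \<Lambda> b w then card (edges_out \<Lambda> b v) else 1)"

text \<open>\<open>\<E> v i\<close> for \<open>1 \<le> i \<le> n(v)\<close> are the parts of the chosen partition of \<open>s\<^sub>B\<^sup>-\<^sup>1(v)\<close>.\<close>

definition limar_data ::
  "('m, 'k::finite) kgraph \<Rightarrow> 'k \<Rightarrow> 'm \<Rightarrow> ('m \<Rightarrow> nat \<Rightarrow> 'm set) \<Rightarrow> bool" where
  "limar_data \<Lambda> b w \<E> \<longleftrightarrow>
     w \<in> kg_verts \<Lambda> \<and>
     at_least_two (edges_out \<Lambda> b w) \<and>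
     (\<forall>v\<in>split_verts \<Lambda> b w. finite (edges_out \<Lambda> b v)) \<and>
     (\<forall>v\<in>kg_verts \<Lambda>. edges_out \<Lambda> b v \<noteq> {} \<longrightarrow>
        (\<Union>i\<in>{1..split_num \<Lambda> b w v}. \<E> v i) = edges_out \<Lambda> b v \<and>
        disjoint_family_on (\<E> v) {1..split_num \<Lambda> b w v} \<and>
        (\<forall>i\<in>{1..split_num \<Lambda> b w v}. \<E> v i \<noteq> {}))"

definition part_index ::
  "('m, 'k::finite) kgraph \<Rightarrow> 'k \<Rightarrow> 'm \<Rightarrow> ('m \<Rightarrow> nat \<Rightarrow> 'm set) \<Rightarrow> 'm \<Rightarrow> nat" where
  "part_index \<Lambda> b w \<E> c =
     (THE j. j \<in> {1..split_num \<Lambda> b w (Src \<Lambda> c)} \<and> c \<in> \<E> (Src \<Lambda> c) j)"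

text \<open>The edge \<open>c\<close> of degree \<open>B\<close> in the unique factorisation \<open>fe = ac\<close> with \<open>d(a) = d(e)\<close>.\<close>

definition commuted_edge :: "('m, 'k::finite) kgraph \<Rightarrow> 'k \<Rightarrow> 'm \<Rightarrow> 'm \<Rightarrow> 'm" where
  "commuted_edge \<Lambda> b f e =
     (THE c. c \<in> kg_edges \<Lambda> \<and> Deg \<Lambda> c = basis_deg b \<and>
        (\<exists>a\<in>kg_edges \<Lambda>. Deg \<Lambda> a = Deg \<Lambda> e \<and> Src \<Lambda> a = Rng \<Lambda> c \<and> Cmp \<Lambda> f e = Cmp \<Lambda> a c))"

text \<open>
  Vertices \<open>v\<^sup>i\<close> and edges \<open>e\<^sup>i\<close> of the split directed graph are pairs \<open>(v, i)\<close>, \<open>(e, i)\<close>.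
\<close>

record ('v, 'e) rs_digraph =
  dverts :: "'v set"
  dedges :: "'e set"
  drng :: "'e \<Rightarrow> 'v"
  dsrc :: "'e \<Rightarrow> 'v"

definition split_digraph ::
  "('m, 'k::finite) kgraph \<Rightarrow> 'k \<Rightarrow> 'm \<Rightarrow> ('m \<Rightarrow> nat \<Rightarrow> 'm set) \<Rightarrow>
     ('m \<times> nat, 'm \<times> nat) rs_digraph" where
  "split_digraph \<Lambda> b w \<E> = \<lparr>
     dverts = {(v, i). v \<in> kg_verts \<Lambda> \<and> i \<in> {1..split_num \<Lambda> b w v}},
     dedges = {(e, i). e \<in> kg_edges \<Lambda> \<and> i \<in> {1..split_num \<Lambda> b w (Rng \<Lambda> e)}},
     drng = (\<lambda>(e, i). (Rng \<Lambda> e, i)),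
     dsrc = (\<lambda>(e, i). (Src \<Lambda> e,
        if Deg \<Lambda> e = basis_deg b then part_index \<Lambda> b w \<E> e
        else if edges_out \<Lambda> b (Rng \<Lambda> e) \<noteq> {}
          then part_index \<Lambda> b w \<E> (commuted_edge \<Lambda> b (SOME f. f \<in> \<E> (Rng \<Lambda> e) i) e)
        else 1)) \<rparr>"

text \<open>
  \<open>is_path G x [f\<^sub>m, \<dots>, f\<^sub>1] y\<close>: the path \<open>f\<^sub>m \<cdots> f\<^sub>1\<close> has range \<open>x\<close> and source \<open>y\<close>. A path is stored
  as the triple \<open>(x, [f\<^sub>m, \<dots>, f\<^sub>1], y)\<close>, which for \<open>m = 0\<close> is the vertex \<open>x = y\<close>.
\<close>

primrec is_path :: "('v, 'e) rs_digraph \<Rightarrow> 'v \<Rightarrow> 'e list \<Rightarrow> 'v \<Rightarrow> bool" where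
  "is_path G x [] y \<longleftrightarrow> x \<in> dverts G \<and> x = y"
| "is_path G x (f # fs) y \<longleftrightarrow> f \<in> dedges G \<and> drng G f = x \<and> is_path G (dsrc G f) fs y"

type_synonym ('v, 'e) path = "'v \<times> 'e list \<times> 'v"

definition paths :: "('v, 'e) rs_digraph \<Rightarrow> ('v, 'e) path set" where
  "paths G = {(x, fs, y). is_path G x fs y}"

definition path_rng :: "('v, 'e) path \<Rightarrow> 'v" where
  "path_rng = (\<lambda>(x, fs, y). x)"

definition path_src :: "('v, 'e) path \<Rightarrow> 'v" where
  "path_src = (\<lambda>(x, fs, y). y)"

definition vertex_path :: "'v \<Rightarrow> ('v, 'e) path" where
  "vertex_path x = (x, [], x)"

definition path_concat :: "('v, 'e) path \<Rightarrow> ('v, 'e) path \<Rightarrow> ('v, 'e) path" where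
  "path_concat = (\<lambda>(x, fs, y) (x', fs', y'). (x, fs @ fs', y'))"

definition par :: "('m \<times> nat, 'm \<times> nat) path \<Rightarrow> ('m, 'm) path" where
  "par = (\<lambda>(x, fs, y). (fst x, map fst fs, fst y))"

text \<open>The composite in \<open>\<Lambda>\<close> of a path in the 1-skeleton of \<open>\<Lambda>\<close>.\<close>

definition composite :: "('m, 'k::finite) kgraph \<Rightarrow> ('m, 'm) path \<Rightarrow> 'm" where
  "composite \<Lambda> = (\<lambda>(x, fs, y). foldr (Cmp \<Lambda>) fs y)"

definition path_deg :: "('m, 'k::finite) kgraph \<Rightarrow> ('m \<times> nat, 'm \<times> nat) path \<Rightarrow> nat ^ 'k" where
  "path_deg \<Lambda> = (\<lambda>(x, fs, y). \<Sum>f\<leftarrow>fs. Deg \<Lambda> (fst f))"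

definition limar_equiv ::
  "('m, 'k::finite) kgraph \<Rightarrow> 'k \<Rightarrow> 'm \<Rightarrow> ('m \<Rightarrow> nat \<Rightarrow> 'm set) \<Rightarrow>
     ('m \<times> nat, 'm \<times> nat) path rel" where
  "limar_equiv \<Lambda> b w \<E> =
     {(p, q). p \<in> paths (split_digraph \<Lambda> b w \<E>) \<and> q \<in> paths (split_digraph \<Lambda> b w \<E>) \<and>
        composite \<Lambda> (par p) = composite \<Lambda> (par q) \<and>
        path_rng p = path_rng q \<and> path_src p = path_src q}"

text \<open>
  The structure maps below are induced by those on paths: the unions over representatives are
  unions of equal equivalence classes.
\<close>

definition limar_split ::
  "('m, 'k::finite) kgraph \<Rightarrow> 'k \<Rightarrow> 'm \<Rightarrow> ('m \<Rightarrow> nat \<Rightarrow> 'm set) \<Rightarrow>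
     (('m \<times> nat, 'm \<times> nat) path set, 'k) kgraph" where
  "limar_split \<Lambda> b w \<E> = (let R = limar_equiv \<Lambda> b w \<E> in \<lparr>
     Mor = paths (split_digraph \<Lambda> b w \<E>) // R,
     Deg = (\<lambda>C. the_elem (path_deg \<Lambda> ` C)),
     Src = (\<lambda>C. \<Union>p\<in>C. R `` {vertex_path (path_src p)}),
     Rng = (\<lambda>C. \<Union>p\<in>C. R `` {vertex_path (path_rng p)}),
     Cmp = (\<lambda>C D. \<Union>p\<in>C. \<Union>q\<in>D. R `` {path_concat p q}) \<rparr>)"

text \<open>The vertex \<open>v\<^sup>i\<close> as an element of the split.\<close>

definition limar_vertex ::
  "('m, 'k::finite) kgraph \<Rightarrow> 'k \<Rightarrow> 'm \<Rightarrow> ('m \<Rightarrow> nat \<Rightarrow> 'm set) \<Rightarrow> 'm \<Rightarrow> nat \<Rightarrow>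
     ('m \<times> nat, 'm \<times> nat) path set" where
  "limar_vertex \<Lambda> b w \<E> v i = limar_equiv \<Lambda> b w \<E> `` {vertex_path (v, i)}"


section \<open>Kumjian-Pask algebras\<close>

subsection \<open>Free algebras\<close>

text \<open>
  Words form a monoid (written additively, as \<^type>\<open>poly_mapping\<close> requires), so finitely supported
  functions on words form the unital free associative algebra with convolution product.
\<close>

datatype 'g word = Word (letters: "'g list")

instantiation word :: (type) monoid_add
begin

definition zero_word :: "'a word" where "0 = Word []"

definition plus_word :: "'a word \<Rightarrow> 'a word \<Rightarrow> 'a word" where
  "u + v = Word (letters u @ letters v)"

instance
  by standard (simp_all add: zero_word_def plus_word_def)

end

type_synonym ('g, 'f) free = "'g word \<Rightarrow>\<^sub>0 'f"

definition gen :: "'g \<Rightarrow> ('g, 'f::field) free" where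
  "gen g = Poly_Mapping.single (Word [g]) 1"

definition free_carrier :: "'g set \<Rightarrow> ('g, 'f::field) free set" where
  "free_carrier G = {x. \<forall>u \<in> Poly_Mapping.keys x. set (letters u) \<subseteq> G}"

definition free_ring :: "'g set \<Rightarrow> ('g, 'f::field) free ring" where
  "free_ring G = \<lparr>carrier = free_carrier G, mult = (*), one = 1, zero = 0, add = (+)\<rparr>"

lemma free_carrier_closed:
  fixes x y :: "('g, 'f::field) free"
  assumes "x \<in> free_carrier G" "y \<in> free_carrier G"
  shows "x + y \<in> free_carrier G" "x * y \<in> free_carrier G" "- x \<in> free_carrier G"
    "x - y \<in> free_carrier G"
proof -
  have plus: "x + y \<in> free_carrier G" if "x \<in> free_carrier G" "y \<in> free_carrier G" for x y :: "('g, 'f) free"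
    using that keys_add[of x y] by (auto simp: free_carrier_def)
  have neg: "- x \<in> free_carrier G" if "x \<in> free_carrier G" for x :: "('g, 'f) free"
    using that by (auto simp: free_carrier_def in_keys_iff)
  show "x * y \<in> free_carrier G"
    using assms keys_mult[of x y] by (fastforce simp: free_carrier_def plus_word_def)
  show "x - y \<in> free_carrier G"
    using plus[OF assms(1) neg[OF assms(2)]] by simp
  show "x + y \<in> free_carrier G" "- x \<in> free_carrier G"
    using assms by (auto intro: plus neg)
qed

lemma zero_one_free_carrier: "0 \<in> free_carrier G" "1 \<in> free_carrier G"
  by (auto simp: free_carrier_def zero_word_def)

lemma ring_free_ring: "ring (free_ring G :: ('g, 'f::field) free ring)"
proof (rule ringI)
  show "abelian_group (free_ring G :: ('g, 'f) free ring)"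
  proof (rule abelian_groupI)
    fix x :: "('g, 'f) free" assume x: "x \<in> carrier (free_ring G)"
    show "\<exists>y\<in>carrier (free_ring G). y \<oplus>\<^bsub>free_ring G\<^esub> x = \<zero>\<^bsub>free_ring G\<^esub>"
      by (rule bexI[of _ "- x"]) (use x in \<open>auto simp: free_ring_def free_carrier_closed\<close>)
  qed (auto simp: free_ring_def free_carrier_closed zero_one_free_carrier algebra_simps)
  show "Group.monoid (free_ring G :: ('g, 'f) free ring)"
    by (rule monoidI)
      (auto simp: free_ring_def free_carrier_closed zero_one_free_carrier algebra_simps)
qed (auto simp: free_ring_def algebra_simps)

lemma minus_free_ring:
  fixes x y :: "('g, 'f::field) free"
  assumes "x \<in> free_carrier G" "y \<in> free_carrier G"
  shows "x \<ominus>\<^bsub>free_ring G\<^esub> y = x - y"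
proof -
  interpret ring "free_ring G :: ('g, 'f) free ring" by (rule ring_free_ring)
  have "\<ominus>\<^bsub>free_ring G\<^esub> y = - y"
    by (rule minus_equality) (use assms in \<open>auto simp: free_ring_def free_carrier_closed\<close>)
  then show ?thesis
    by (simp add: a_minus_def) (simp add: free_ring_def)
qed

lemma finsum_free_ring:
  fixes f :: "'i \<Rightarrow> ('g, 'f::field) free"
  assumes "f \<in> A \<rightarrow> free_carrier G"
  shows "sum f A \<in> free_carrier G" "finsum (free_ring G) f A = sum f A"
proof -
  interpret ring "free_ring G :: ('g, 'f) free ring" by (rule ring_free_ring)
  have "sum f A \<in> free_carrier G \<and> finsum (free_ring G) f A = sum f A"
    using assms
  proof (induction A rule: infinite_finite_induct)
    case (insert a A)
    then have "finsum (free_ring G) f (insert a A) = f a \<oplus>\<^bsub>free_ring G\<^esub> finsum (free_ring G) f A"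
      by (intro finsum_insert) (auto simp: free_ring_def)
    with insert show ?case
      by (auto simp: free_carrier_closed) (simp add: free_ring_def)
  qed (auto simp: zero_one_free_carrier, auto simp: free_ring_def)
  then show "sum f A \<in> free_carrier G" "finsum (free_ring G) f A = sum f A" by auto
qed

subsection \<open>Kumjian-Pask families\<close>

text \<open>
  \<open>T \<alpha>\<close> and \<open>Ts \<alpha>\<close> stand for \<open>T\<^sub>\<alpha>\<close> and the element indexed by the ghost path of \<open>\<alpha>\<close>; for a vertex
  \<open>v\<close> both are \<open>P\<^sub>v\<close>.
\<close>

definition kp_family ::
  "('m, 'k::finite) kgraph \<Rightarrow> ('a, 'z) ring_scheme \<Rightarrow> ('m \<Rightarrow> 'a) \<Rightarrow> ('m \<Rightarrow> 'a) \<Rightarrow> bool" where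
  "kp_family \<Lambda> R T Ts \<longleftrightarrow>
     (\<forall>\<alpha>\<in>Mor \<Lambda>. T \<alpha> \<in> carrier R \<and> Ts \<alpha> \<in> carrier R) \<and>
     (\<forall>v\<in>kg_verts \<Lambda>. Ts v = T v) \<and>
     (\<forall>u\<in>kg_verts \<Lambda>. \<forall>v\<in>kg_verts \<Lambda>. T u \<otimes>\<^bsub>R\<^esub> T v = (if u = v then T u else \<zero>\<^bsub>R\<^esub>)) \<and>
     (\<forall>\<alpha>\<in>Mor \<Lambda>. \<forall>\<mu>\<in>Mor \<Lambda>. Src \<Lambda> \<alpha> = Rng \<Lambda> \<mu> \<longrightarrow>
        T \<alpha> \<otimes>\<^bsub>R\<^esub> T \<mu> = T (Cmp \<Lambda> \<alpha> \<mu>) \<and> Ts \<mu> \<otimes>\<^bsub>R\<^esub> Ts \<alpha> = Ts (Cmp \<Lambda> \<alpha> \<mu>)) \<and>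
     (\<forall>\<alpha>\<in>Mor \<Lambda>.
        T (Rng \<Lambda> \<alpha>) \<otimes>\<^bsub>R\<^esub> T \<alpha> = T \<alpha> \<and> T \<alpha> \<otimes>\<^bsub>R\<^esub> T (Src \<Lambda> \<alpha>) = T \<alpha> \<and>
        T (Src \<Lambda> \<alpha>) \<otimes>\<^bsub>R\<^esub> Ts \<alpha> = Ts \<alpha> \<and> Ts \<alpha> \<otimes>\<^bsub>R\<^esub> T (Rng \<Lambda> \<alpha>) = Ts \<alpha>) \<and>
     (\<forall>\<alpha>\<in>Mor \<Lambda>. \<forall>\<mu>\<in>Mor \<Lambda>. Deg \<Lambda> \<alpha> = Deg \<Lambda> \<mu> \<longrightarrow>
        Ts \<alpha> \<otimes>\<^bsub>R\<^esub> T \<mu> = (if \<alpha> = \<mu> then T (Src \<Lambda> \<alpha>) else \<zero>\<^bsub>R\<^esub>)) \<and>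
     (\<forall>v\<in>kg_verts \<Lambda>. \<forall>n. n \<noteq> 0 \<longrightarrow>
        T v = finsum R (\<lambda>\<alpha>. T \<alpha> \<otimes>\<^bsub>R\<^esub> Ts \<alpha>) (paths_into \<Lambda> v n))"

datatype 'm kp_gen = Path 'm | Ghost 'm

definition kp_gens :: "('m, 'k::finite) kgraph \<Rightarrow> 'm kp_gen set" where
  "kp_gens \<Lambda> = Path ` Mor \<Lambda> \<union> Ghost ` {\<alpha> \<in> Mor \<Lambda>. Deg \<Lambda> \<alpha> \<noteq> 0}"

definition fpath :: "'m \<Rightarrow> ('m kp_gen, 'f::field) free" where
  "fpath \<alpha> = gen (Path \<alpha>)"

definition fghost :: "('m, 'k::finite) kgraph \<Rightarrow> 'm \<Rightarrow> ('m kp_gen, 'f::field) free" where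
  "fghost \<Lambda> \<alpha> = (if Deg \<Lambda> \<alpha> = 0 then gen (Path \<alpha>) else gen (Ghost \<alpha>))"

definition kp_relators :: "('m, 'k::finite) kgraph \<Rightarrow> ('m kp_gen, 'f::field) free set" where
  "kp_relators \<Lambda> =
     {fpath u * fpath v - (if u = v then fpath u else 0) | u v.
        u \<in> kg_verts \<Lambda> \<and> v \<in> kg_verts \<Lambda>} \<union>
     {fpath \<alpha> * fpath \<mu> - fpath (Cmp \<Lambda> \<alpha> \<mu>) | \<alpha> \<mu>.
        \<alpha> \<in> Mor \<Lambda> \<and> \<mu> \<in> Mor \<Lambda> \<and> Src \<Lambda> \<alpha> = Rng \<Lambda> \<mu>} \<union>
     {fghost \<Lambda> \<mu> * fghost \<Lambda> \<alpha> - fghost \<Lambda> (Cmp \<Lambda> \<alpha> \<mu>) | \<alpha> \<mu>.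
        \<alpha> \<in> Mor \<Lambda> \<and> \<mu> \<in> Mor \<Lambda> \<and> Src \<Lambda> \<alpha> = Rng \<Lambda> \<mu>} \<union>
     {fpath (Rng \<Lambda> \<alpha>) * fpath \<alpha> - fpath \<alpha> | \<alpha>. \<alpha> \<in> Mor \<Lambda>} \<union>
     {fpath \<alpha> * fpath (Src \<Lambda> \<alpha>) - fpath \<alpha> | \<alpha>. \<alpha> \<in> Mor \<Lambda>} \<union>
     {fpath (Src \<Lambda> \<alpha>) * fghost \<Lambda> \<alpha> - fghost \<Lambda> \<alpha> | \<alpha>. \<alpha> \<in> Mor \<Lambda>} \<union>
     {fghost \<Lambda> \<alpha> * fpath (Rng \<Lambda> \<alpha>) - fghost \<Lambda> \<alpha> | \<alpha>. \<alpha> \<in> Mor \<Lambda>} \<union>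
     {fghost \<Lambda> \<alpha> * fpath \<mu> - (if \<alpha> = \<mu> then fpath (Src \<Lambda> \<alpha>) else 0) | \<alpha> \<mu>.
        \<alpha> \<in> Mor \<Lambda> \<and> \<mu> \<in> Mor \<Lambda> \<and> Deg \<Lambda> \<alpha> = Deg \<Lambda> \<mu>} \<union>
     {fpath v - (\<Sum>\<alpha>\<in>paths_into \<Lambda> v n. fpath \<alpha> * fghost \<Lambda> \<alpha>) | v n.
        v \<in> kg_verts \<Lambda> \<and> n \<noteq> 0}"

subsection \<open>The universal algebra\<close>

abbreviation kp_free :: "('m, 'k::finite) kgraph \<Rightarrow> ('m kp_gen, 'f::field) free ring" where
  "kp_free \<Lambda> \<equiv> free_ring (kp_gens \<Lambda>)"

definition kp_ideal :: "('m, 'k::finite) kgraph \<Rightarrow> ('m kp_gen, 'f::field) free set" where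
  "kp_ideal \<Lambda> = genideal (kp_free \<Lambda>) (kp_relators \<Lambda>)"

definition kp_class ::
  "('m, 'k::finite) kgraph \<Rightarrow> ('m kp_gen, 'f::field) free \<Rightarrow> ('m kp_gen, 'f) free set" where
  "kp_class \<Lambda> x = kp_ideal \<Lambda> +>\<^bsub>kp_free \<Lambda>\<^esub> x"

text \<open>
  The Kumjian-Pask algebra need not be unital: its elements are the classes of the free algebra
  elements without constant term (\<^term>\<open>0 :: 'g word\<close> is the empty word). All relators have no constant
  term, so the quotient of the free algebra is the unitization of this algebra; the field
  \<^const>\<open>one\<close> of the record is the unit of the unitization and is not in the carrier.
\<close>

definition KP :: "('m, 'k::finite) kgraph \<Rightarrow> ('f::field, ('m kp_gen, 'f) free set) module" where
  "KP \<Lambda> = (let Q = kp_free \<Lambda> Quot kp_ideal \<Lambda> in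
     \<lparr>carrier = kp_class \<Lambda> ` {x \<in> free_carrier (kp_gens \<Lambda>). Poly_Mapping.lookup x 0 = 0},
      mult = mult Q, one = one Q, zero = zero Q, add = add Q,
      smult = (\<lambda>c a. kp_class \<Lambda> (Poly_Mapping.single 0 c) \<otimes>\<^bsub>Q\<^esub> a)\<rparr>)"

definition kp_path :: "('m, 'k::finite) kgraph \<Rightarrow> 'm \<Rightarrow> ('m kp_gen, 'f::field) free set" where
  "kp_path \<Lambda> \<alpha> = kp_class \<Lambda> (fpath \<alpha>)"

definition kp_ghost :: "('m, 'k::finite) kgraph \<Rightarrow> 'm \<Rightarrow> ('m kp_gen, 'f::field) free set" where
  "kp_ghost \<Lambda> \<alpha> = kp_class \<Lambda> (fghost \<Lambda> \<alpha>)"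

lemma gen_free_carrier: "g \<in> G \<Longrightarrow> gen g \<in> free_carrier G"
  by (auto simp: gen_def free_carrier_def)

lemma fpath_carrier: "\<alpha> \<in> Mor \<Lambda> \<Longrightarrow> fpath \<alpha> \<in> free_carrier (kp_gens \<Lambda>)"
  and fghost_carrier: "\<alpha> \<in> Mor \<Lambda> \<Longrightarrow> fghost \<Lambda> \<alpha> \<in> free_carrier (kp_gens \<Lambda>)"
  by (auto simp: fpath_def fghost_def kp_gens_def intro!: gen_free_carrier)

lemma (in k_graph) kp_relators_carrier: "kp_relators \<Lambda> \<subseteq> carrier (kp_free \<Lambda>)"
  unfolding kp_relators_def
  by (auto simp: free_ring_def kg_verts_def paths_into_def zero_one_free_carrier
      intro!: free_carrier_closed fpath_carrier fghost_carrier finsum_free_ring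
        Src_closed Rng_closed Cmp_closed)

lemma (in k_graph) kp_family_quotient_iff:
  fixes J :: "('m kp_gen, 'f::field) free set"
  assumes "ideal J (kp_free \<Lambda>)"
  shows "kp_family \<Lambda> (kp_free \<Lambda> Quot J)
           (\<lambda>\<alpha>. J +>\<^bsub>kp_free \<Lambda>\<^esub> fpath \<alpha>) (\<lambda>\<alpha>. J +>\<^bsub>kp_free \<Lambda>\<^esub> fghost \<Lambda> \<alpha>)
         \<longleftrightarrow> kp_relators \<Lambda> \<subseteq> J"
proof -
  let ?R = "kp_free \<Lambda> :: ('m kp_gen, 'f) free ring"
  let ?C = "free_carrier (kp_gens \<Lambda>) :: ('m kp_gen, 'f) free set"
  define \<phi> where "\<phi> x = J +>\<^bsub>?R\<^esub> x" for x
  interpret J: ideal J ?R by fact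
  interpret h: ring_hom_ring ?R "?R Quot J" \<phi>
    unfolding \<phi>_def by (rule J.rcos_ring_hom_ring)
  have C: "carrier ?R = ?C" by (simp add: free_ring_def)
  have eq: "\<phi> x = \<phi> y \<longleftrightarrow> x - y \<in> J" if "x \<in> ?C" "y \<in> ?C" for x y
    using J.quotient_eq_iff_same_a_r_cos[OF assms, of x y] that
    by (simp add: \<phi>_def C minus_free_ring)
  have mult: "\<phi> x \<otimes>\<^bsub>?R Quot J\<^esub> \<phi> y = \<phi> (x * y)" if "x \<in> ?C" "y \<in> ?C" for x y
  proof -
    have "x \<otimes>\<^bsub>?R\<^esub> y = x * y" by (simp add: free_ring_def)
    then show ?thesis using h.hom_mult[of x y] that by (simp add: C)
  qed
  have zero: "\<zero>\<^bsub>?R Quot J\<^esub> = \<phi> 0"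
    using h.hom_zero by (simp add: free_ring_def)
  have fin: "finsum (?R Quot J) (\<lambda>i. \<phi> (f i)) A = \<phi> (sum f A)" if "f \<in> A \<rightarrow> ?C" for f and A :: "'m set"
  proof -
    have "finsum (?R Quot J) (\<lambda>i. \<phi> (f i)) A = \<phi> (finsum ?R f A)"
      using that
    proof (induction A rule: infinite_finite_induct)
      case (insert a A)
      then show ?case
        by (subst J.finsum_insert h.S.finsum_insert; (subst J.finsum_insert h.S.finsum_insert)?)
           (auto simp: C Pi_def intro!: h.hom_closed h.hom_add[symmetric] J.finsum_closed)
    qed auto
    then show ?thesis using that by (simp add: finsum_free_ring)
  qed
  have vM: "v \<in> Mor \<Lambda>" if "v \<in> kg_verts \<Lambda>" for v using that by (simp add: kg_verts_def)
  have pM: "\<alpha> \<in> Mor \<Lambda>" if "\<alpha> \<in> paths_into \<Lambda> v n" for \<alpha> v n using that by (simp add: paths_into_def)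
  note cl = fpath_carrier fghost_carrier free_carrier_closed zero_one_free_carrier
    Src_closed Rng_closed Cmp_closed vM
  have CK: "finsum (?R Quot J) (\<lambda>\<alpha>. \<phi> (fpath \<alpha>) \<otimes>\<^bsub>?R Quot J\<^esub> \<phi> (fghost \<Lambda> \<alpha>)) (paths_into \<Lambda> v n) =
      \<phi> (\<Sum>\<alpha>\<in>paths_into \<Lambda> v n. fpath \<alpha> * fghost \<Lambda> \<alpha>)"
    and CKC: "(\<Sum>\<alpha>\<in>paths_into \<Lambda> v n. fpath \<alpha> * fghost \<Lambda> \<alpha>) \<in> ?C" for v n
  proof -
    have F: "(\<lambda>\<alpha>. fpath \<alpha> * fghost \<Lambda> \<alpha>) \<in> paths_into \<Lambda> v n \<rightarrow> ?C"
      by (auto intro!: cl pM)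
    show "(\<Sum>\<alpha>\<in>paths_into \<Lambda> v n. fpath \<alpha> * fghost \<Lambda> \<alpha>) \<in> ?C"
      by (rule finsum_free_ring[OF F])
    have "finsum (?R Quot J) (\<lambda>\<alpha>. \<phi> (fpath \<alpha>) \<otimes>\<^bsub>?R Quot J\<^esub> \<phi> (fghost \<Lambda> \<alpha>)) (paths_into \<Lambda> v n)
      = finsum (?R Quot J) (\<lambda>\<alpha>. \<phi> (fpath \<alpha> * fghost \<Lambda> \<alpha>)) (paths_into \<Lambda> v n)"
      by (rule h.S.finsum_cong') (auto simp: C mult cl pM intro!: h.hom_closed)
    then show "finsum (?R Quot J) (\<lambda>\<alpha>. \<phi> (fpath \<alpha>) \<otimes>\<^bsub>?R Quot J\<^esub> \<phi> (fghost \<Lambda> \<alpha>)) (paths_into \<Lambda> v n) =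
      \<phi> (\<Sum>\<alpha>\<in>paths_into \<Lambda> v n. fpath \<alpha> * fghost \<Lambda> \<alpha>)"
      using fin[OF F] by simp
  qed
  have if_phi: "(if P then \<phi> x else \<phi> y) = \<phi> (if P then x else y)" for P x y by simp
  have if_C: "(if P then x else y) \<in> ?C" if "x \<in> ?C" "y \<in> ?C" for P x y using that by simp
  have car: "\<phi> x \<in> carrier (?R Quot J)" if "x \<in> ?C" for x using that by (simp add: C)
  have v0: "fghost \<Lambda> v = fpath v" if "v \<in> kg_verts \<Lambda>" for v
    using that by (simp add: fghost_def fpath_def kg_verts_def)
  have e: "\<phi> x \<otimes>\<^bsub>?R Quot J\<^esub> \<phi> y = \<phi> z \<longleftrightarrow> x * y - z \<in> J"
    if "x \<in> ?C" "y \<in> ?C" "z \<in> ?C" for x y z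
    using that by (simp only: mult eq free_carrier_closed)
  have c1: "\<phi> (fpath u) \<otimes>\<^bsub>?R Quot J\<^esub> \<phi> (fpath v) =
        (if u = v then \<phi> (fpath u) else \<zero>\<^bsub>?R Quot J\<^esub>) \<longleftrightarrow>
      fpath u * fpath v - (if u = v then fpath u else 0) \<in> J"
    if "u \<in> kg_verts \<Lambda>" "v \<in> kg_verts \<Lambda>" for u v
    unfolding zero if_phi by (rule e; simp add: cl that)
  have c2: "\<phi> (fpath \<alpha>) \<otimes>\<^bsub>?R Quot J\<^esub> \<phi> (fpath \<mu>) = \<phi> (fpath (Cmp \<Lambda> \<alpha> \<mu>)) \<longleftrightarrow>
        fpath \<alpha> * fpath \<mu> - fpath (Cmp \<Lambda> \<alpha> \<mu>) \<in> J"
    "\<phi> (fghost \<Lambda> \<mu>) \<otimes>\<^bsub>?R Quot J\<^esub> \<phi> (fghost \<Lambda> \<alpha>) = \<phi> (fghost \<Lambda> (Cmp \<Lambda> \<alpha> \<mu>)) \<longleftrightarrow>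
        fghost \<Lambda> \<mu> * fghost \<Lambda> \<alpha> - fghost \<Lambda> (Cmp \<Lambda> \<alpha> \<mu>) \<in> J"
    if "\<alpha> \<in> Mor \<Lambda>" "\<mu> \<in> Mor \<Lambda>" "Src \<Lambda> \<alpha> = Rng \<Lambda> \<mu>" for \<alpha> \<mu>
    by (rule e; simp add: cl that)+
  have c3: "\<phi> (fpath (Rng \<Lambda> \<alpha>)) \<otimes>\<^bsub>?R Quot J\<^esub> \<phi> (fpath \<alpha>) = \<phi> (fpath \<alpha>) \<longleftrightarrow>
        fpath (Rng \<Lambda> \<alpha>) * fpath \<alpha> - fpath \<alpha> \<in> J"
    "\<phi> (fpath \<alpha>) \<otimes>\<^bsub>?R Quot J\<^esub> \<phi> (fpath (Src \<Lambda> \<alpha>)) = \<phi> (fpath \<alpha>) \<longleftrightarrow>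
        fpath \<alpha> * fpath (Src \<Lambda> \<alpha>) - fpath \<alpha> \<in> J"
    "\<phi> (fpath (Src \<Lambda> \<alpha>)) \<otimes>\<^bsub>?R Quot J\<^esub> \<phi> (fghost \<Lambda> \<alpha>) = \<phi> (fghost \<Lambda> \<alpha>) \<longleftrightarrow>
        fpath (Src \<Lambda> \<alpha>) * fghost \<Lambda> \<alpha> - fghost \<Lambda> \<alpha> \<in> J"
    "\<phi> (fghost \<Lambda> \<alpha>) \<otimes>\<^bsub>?R Quot J\<^esub> \<phi> (fpath (Rng \<Lambda> \<alpha>)) = \<phi> (fghost \<Lambda> \<alpha>) \<longleftrightarrow>
        fghost \<Lambda> \<alpha> * fpath (Rng \<Lambda> \<alpha>) - fghost \<Lambda> \<alpha> \<in> J"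
    if "\<alpha> \<in> Mor \<Lambda>" for \<alpha>
    by (rule e; simp add: cl that)+
  have c4: "\<phi> (fghost \<Lambda> \<alpha>) \<otimes>\<^bsub>?R Quot J\<^esub> \<phi> (fpath \<mu>) =
        (if \<alpha> = \<mu> then \<phi> (fpath (Src \<Lambda> \<alpha>)) else \<zero>\<^bsub>?R Quot J\<^esub>) \<longleftrightarrow>
      fghost \<Lambda> \<alpha> * fpath \<mu> - (if \<alpha> = \<mu> then fpath (Src \<Lambda> \<alpha>) else 0) \<in> J"
    if "\<alpha> \<in> Mor \<Lambda>" "\<mu> \<in> Mor \<Lambda>" for \<alpha> \<mu>
    unfolding zero if_phi by (rule e; simp add: cl that)
  have c5: "\<phi> (fpath v) = \<phi> (\<Sum>\<alpha>\<in>paths_into \<Lambda> v n. fpath \<alpha> * fghost \<Lambda> \<alpha>) \<longleftrightarrow>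
      fpath v - (\<Sum>\<alpha>\<in>paths_into \<Lambda> v n. fpath \<alpha> * fghost \<Lambda> \<alpha>) \<in> J" if "v \<in> kg_verts \<Lambda>" for v n
    by (rule eq; simp add: cl CKC that)
  have c0: "\<forall>\<alpha>\<in>Mor \<Lambda>. \<phi> (fpath \<alpha>) \<in> carrier (?R Quot J) \<and> \<phi> (fghost \<Lambda> \<alpha>) \<in> carrier (?R Quot J)"
    and c0': "\<forall>v\<in>kg_verts \<Lambda>. \<phi> (fghost \<Lambda> v) = \<phi> (fpath v)"
    by (auto intro!: car cl simp: v0)
  have L: "kp_family \<Lambda> (?R Quot J) (\<lambda>\<alpha>. \<phi> (fpath \<alpha>)) (\<lambda>\<alpha>. \<phi> (fghost \<Lambda> \<alpha>)) \<longleftrightarrow>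
     (\<forall>u\<in>kg_verts \<Lambda>. \<forall>v\<in>kg_verts \<Lambda>. fpath u * fpath v - (if u = v then fpath u else 0) \<in> J) \<and>
     (\<forall>\<alpha>\<in>Mor \<Lambda>. \<forall>\<mu>\<in>Mor \<Lambda>. Src \<Lambda> \<alpha> = Rng \<Lambda> \<mu> \<longrightarrow>
        fpath \<alpha> * fpath \<mu> - fpath (Cmp \<Lambda> \<alpha> \<mu>) \<in> J \<and>
        fghost \<Lambda> \<mu> * fghost \<Lambda> \<alpha> - fghost \<Lambda> (Cmp \<Lambda> \<alpha> \<mu>) \<in> J) \<and>
     (\<forall>\<alpha>\<in>Mor \<Lambda>.
        fpath (Rng \<Lambda> \<alpha>) * fpath \<alpha> - fpath \<alpha> \<in> J \<and> fpath \<alpha> * fpath (Src \<Lambda> \<alpha>) - fpath \<alpha> \<in> J \<and>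
        fpath (Src \<Lambda> \<alpha>) * fghost \<Lambda> \<alpha> - fghost \<Lambda> \<alpha> \<in> J \<and>
        fghost \<Lambda> \<alpha> * fpath (Rng \<Lambda> \<alpha>) - fghost \<Lambda> \<alpha> \<in> J) \<and>
     (\<forall>\<alpha>\<in>Mor \<Lambda>. \<forall>\<mu>\<in>Mor \<Lambda>. Deg \<Lambda> \<alpha> = Deg \<Lambda> \<mu> \<longrightarrow>
        fghost \<Lambda> \<alpha> * fpath \<mu> - (if \<alpha> = \<mu> then fpath (Src \<Lambda> \<alpha>) else 0) \<in> J) \<and>
     (\<forall>v\<in>kg_verts \<Lambda>. \<forall>n. n \<noteq> 0 \<longrightarrow>
        fpath v - (\<Sum>\<alpha>\<in>paths_into \<Lambda> v n. fpath \<alpha> * fghost \<Lambda> \<alpha>) \<in> J)"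
    unfolding kp_family_def CK eqTrueI[OF c0] eqTrueI[OF c0'] simp_thms
    by (intro arg_cong2[where f="(\<and>)"] ball_cong refl; (simp only: c1 c2 c3 c4 c5 cong: imp_cong)?)
  have S1: "{f x | x. P x} \<subseteq> J \<longleftrightarrow> (\<forall>x. P x \<longrightarrow> f x \<in> J)"
    for f :: "'m \<Rightarrow> ('m kp_gen, 'f) free" and P by blast
  have S2: "{f x y | x y. P x y} \<subseteq> J \<longleftrightarrow> (\<forall>x y. P x y \<longrightarrow> f x y \<in> J)"
    for f :: "'m \<Rightarrow> 'y \<Rightarrow> ('m kp_gen, 'f) free" and P by blast
  show ?thesis
    unfolding L[unfolded \<phi>_def] kp_relators_def Un_subset_iff S1 S2 Ball_def by meson
qed

text \<open>
  Hence \<^const>\<open>kp_ideal\<close> is the least ideal modulo which the generators form a Kumjian-Pask family.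
\<close>

corollary (in k_graph) kp_family_kp_ideal:
  "kp_family \<Lambda> (kp_free \<Lambda> Quot kp_ideal \<Lambda>) (kp_path \<Lambda>) (kp_ghost \<Lambda> :: _ \<Rightarrow> ('m kp_gen, 'f::field) free set)"
proof -
  interpret R: ring "kp_free \<Lambda> :: ('m kp_gen, 'f) free ring" by (rule ring_free_ring)
  have "ideal (kp_ideal \<Lambda>) (kp_free \<Lambda> :: ('m kp_gen, 'f) free ring)"
    and "kp_relators \<Lambda> \<subseteq> (kp_ideal \<Lambda> :: ('m kp_gen, 'f) free set)"
    unfolding kp_ideal_def by (intro R.genideal_ideal R.genideal_self kp_relators_carrier)+
  then show ?thesis
    using kp_family_quotient_iff[of "kp_ideal \<Lambda>"]
    unfolding kp_path_def[abs_def] kp_ghost_def[abs_def] kp_class_def by blast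
qed

corollary (in k_graph) kp_ideal_least:
  fixes J :: "('m kp_gen, 'f::field) free set"
  assumes "ideal J (kp_free \<Lambda>)"
    and "kp_family \<Lambda> (kp_free \<Lambda> Quot J)
           (\<lambda>\<alpha>. J +>\<^bsub>kp_free \<Lambda>\<^esub> fpath \<alpha>) (\<lambda>\<alpha>. J +>\<^bsub>kp_free \<Lambda>\<^esub> fghost \<Lambda> \<alpha>)"
  shows "kp_ideal \<Lambda> \<subseteq> J"
  unfolding kp_ideal_def
  using ring.genideal_minimal[OF ring_free_ring assms(1)] assms kp_family_quotient_iff by blast

inductive_set alg_span :: "('f, 'a, 'z) module_scheme \<Rightarrow> 'a set \<Rightarrow> 'a set"
  for A S where
  zero: "\<zero>\<^bsub>A\<^esub> \<in> alg_span A S"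
| add_smult: "\<lbrakk>x \<in> S; y \<in> alg_span A S\<rbrakk> \<Longrightarrow> (c \<odot>\<^bsub>A\<^esub> x) \<oplus>\<^bsub>A\<^esub> y \<in> alg_span A S"

definition int_deg :: "nat ^ 'k::finite \<Rightarrow> int ^ 'k" where
  "int_deg n = (\<chi> i. int (n $ i))"

definition kp_component ::
  "('m, 'k::finite) kgraph \<Rightarrow> int ^ 'k \<Rightarrow> ('m kp_gen, 'f::field) free set set" where
  "kp_component \<Lambda> n = alg_span (KP \<Lambda>)
     {kp_path \<Lambda> \<alpha> \<otimes>\<^bsub>KP \<Lambda>\<^esub> kp_ghost \<Lambda> \<mu> | \<alpha> \<mu>.
        \<alpha> \<in> Mor \<Lambda> \<and> \<mu> \<in> Mor \<Lambda> \<and> int_deg (Deg \<Lambda> \<alpha>) - int_deg (Deg \<Lambda> \<mu>) = n}"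

definition kp_diagonal ::
  "('m, 'k::finite) kgraph \<Rightarrow> ('m kp_gen, 'f::field) free set set" where
  "kp_diagonal \<Lambda> = alg_span (KP \<Lambda>)
     {kp_path \<Lambda> \<alpha> \<otimes>\<^bsub>KP \<Lambda>\<^esub> kp_ghost \<Lambda> \<alpha> | \<alpha>. \<alpha> \<in> Mor \<Lambda>}"

subsection \<open>Corners\<close>

text \<open>
  Multiplication by \<open>P\<^sub>X = (\<Sum>v\<in>X. q\<^sub>v)\<close> where \<open>X\<close> may be infinite: on a given element \<open>a\<close> of a
  Kumjian-Pask algebra only finitely many terms are nonzero.
\<close>

definition PX_left :: "('m, 'k::finite) kgraph \<Rightarrow> 'm set \<Rightarrow>
    ('m kp_gen, 'f::field) free set \<Rightarrow> ('m kp_gen, 'f) free set" where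
  "PX_left \<Gamma> X a = finsum (KP \<Gamma>) (\<lambda>v. kp_path \<Gamma> v \<otimes>\<^bsub>KP \<Gamma>\<^esub> a)
     {v \<in> X. kp_path \<Gamma> v \<otimes>\<^bsub>KP \<Gamma>\<^esub> a \<noteq> \<zero>\<^bsub>KP \<Gamma>\<^esub>}"

definition PX_right :: "('m, 'k::finite) kgraph \<Rightarrow> 'm set \<Rightarrow>
    ('m kp_gen, 'f::field) free set \<Rightarrow> ('m kp_gen, 'f) free set" where
  "PX_right \<Gamma> X a = finsum (KP \<Gamma>) (\<lambda>v. a \<otimes>\<^bsub>KP \<Gamma>\<^esub> kp_path \<Gamma> v)
     {v \<in> X. a \<otimes>\<^bsub>KP \<Gamma>\<^esub> kp_path \<Gamma> v \<noteq> \<zero>\<^bsub>KP \<Gamma>\<^esub>}"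

definition corner_set :: "('m, 'k::finite) kgraph \<Rightarrow> 'm set \<Rightarrow>
    ('m kp_gen, 'f::field) free set set \<Rightarrow> ('m kp_gen, 'f) free set set" where
  "corner_set \<Gamma> X S = (\<lambda>a. PX_left \<Gamma> X (PX_right \<Gamma> X a)) ` S"

definition KP_corner :: "('m, 'k::finite) kgraph \<Rightarrow> 'm set \<Rightarrow>
    ('f::field, ('m kp_gen, 'f) free set) module" where
  "KP_corner \<Gamma> X = (KP \<Gamma>)\<lparr>carrier := corner_set \<Gamma> X (carrier (KP \<Gamma>))\<rparr>"

text \<open>Isomorphisms of algebras that need not be unital.\<close>

definition alg_iso ::
  "('f, 'a, 'y) module_scheme \<Rightarrow> ('f, 'b, 'z) module_scheme \<Rightarrow> ('a \<Rightarrow> 'b) set" where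
  "alg_iso A A' = {h \<in> iso A A'.
     h \<in> hom (add_monoid A) (add_monoid A') \<and>
     (\<forall>c. \<forall>x\<in>carrier A. h (c \<odot>\<^bsub>A\<^esub> x) = c \<odot>\<^bsub>A'\<^esub> h x)}"

end

theory Submission
  imports Defs
begin

text \<open>
  The split \<Gamma> lies over \<Lambda>. A path of \<Gamma> is a path \<alpha> of \<Lambda> together with the index \<open>i\<close> of a part at
  its range, and \<alpha> and \<open>i\<close> determine the index \<open>act \<alpha> i\<close> at the source. So \<Lambda> acts from the right on
  the sets of indices \<open>{1..n(v)}\<close>, and \<Gamma> is the category of elements of this action: over a vertex
  \<open>v\<close> with index \<open>i\<close> the paths of \<Gamma> into that vertex correspond to the paths of \<Lambda> into \<open>v\<close>.

  That the index at the source depends on the composite path \<alpha> only, and not on its factorisation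
  into edges, has the following reason. Push an edge \<open>f\<close> of degree \<open>B\<close> in the part with index \<open>i\<close>
  through \<alpha>, one commuting square at a time; the index reached is that of the last edge of degree
  \<open>B\<close> in \<open>f\<alpha>\<close> (\<open>transport_after_B_edge\<close>). If no edge of degree \<open>B\<close> leaves the range of \<alpha>, then the
  last edge of degree \<open>B\<close> in \<alpha> itself decides (\<open>transport_through_B\<close>). If \<alpha> has none either, then
  the hypothesis on sinks leaves a single colour for the edges of \<alpha>, and there is only one
  factorisation (\<open>transport_cong\<close>).

  An edge of degree \<open>B\<close> forgets the index at its range: the index at its source is that of its own
  part. Hence in the Kumjian-Pask algebra of \<Gamma> the copies of a vertex \<open>v\<close> are equivalent: the sums
  of \<open>t \<phi> i * ts \<phi> j\<close>, taken over the edges \<phi> of degree \<open>B\<close> into \<open>v\<close>, multiply like matrix units.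
  The algebra therefore resembles matrices over the algebra of \<Lambda>, with rows and columns labelled
  by indices, and the corner of the vertices with index 1 is a copy of the algebra of \<Lambda>.

  Both directions of this identification are explicit. The homomorphism \<open>psi\<close> sends the generator
  of \<alpha> to the lift of \<alpha> with index 1 at the range, followed by the matrix unit that moves the index
  at the source back to 1. In the opposite direction, interpret the lift of \<alpha> with index \<open>i\<close> as the
  matrix whose single nonzero entry is \<alpha> in row \<open>i\<close> and column \<open>act \<alpha> i\<close>. The relations of \<Gamma> hold
  for these matrices, so every matrix coefficient \<open>coef i j\<close> is a linear map between the algebras.
  The coefficient at row and column 1 is a left inverse of \<open>psi\<close> (\<open>coef_psi\<close>), and \<open>psi\<close> applied to
  it is compression by the vertices with index 1 (\<open>corner_formula\<close>). So \<open>psi\<close> is an isomorphism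
  onto the corner. The coefficient map sends the elements that span a graded component or the
  diagonal for \<Gamma> to zero or to the corresponding elements for \<Lambda>, and every such element for \<Lambda> is
  obtained up to the relations; this identifies components and diagonals.

  Calculations take place in free algebras, modulo the congruence generated by the relations.
\<close>

section \<open>Linear maps between free algebras\<close>

definition scal :: "'f::field \<Rightarrow> ('g, 'f) free \<Rightarrow> ('g, 'f) free" where
  "scal c x = Poly_Mapping.single 0 c * x"

lemma lookup_scal [simp]: "Poly_Mapping.lookup (scal c x) u = c * Poly_Mapping.lookup x u"
  unfolding scal_def mult_map_scale_conv_mult[symmetric] by (simp add: map.rep_eq when_def)

lemma scal_central: "Poly_Mapping.single 0 c * x = x * (Poly_Mapping.single 0 c :: ('g, 'f::field) free)"
proof (rule poly_mapping_eqI)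
  fix u
  have "Poly_Mapping.lookup (x * Poly_Mapping.single 0 c) u =
      (\<Sum>l. Poly_Mapping.lookup x l * (\<Sum>q. (c when 0 = q) when u = l + q))"
    by (simp add: lookup_mult lookup_single)
  also have "\<dots> = (\<Sum>l. (Poly_Mapping.lookup x l * c) when u = l)"
  proof (rule Sum_any.cong)
    fix l
    have "(\<Sum>q. (c when 0 = q) when u = l + q) = (\<Sum>q :: 'g word. (c when u = l) when q = 0)"
      by (rule Sum_any.cong) (auto simp: when_def)
    then show "Poly_Mapping.lookup x l * (\<Sum>q. (c when 0 = q) when u = l + q) =
        (Poly_Mapping.lookup x l * c when u = l)"
      by (simp add: mult_when)
  qed
  also have "\<dots> = c * Poly_Mapping.lookup x u"
    by (simp add: mult.commute)
  finally show "Poly_Mapping.lookup (Poly_Mapping.single 0 c * x) u =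
      Poly_Mapping.lookup (x * Poly_Mapping.single 0 c) u"
    using lookup_scal[of c x u] by (simp add: scal_def)
qed

lemma scal_mult_left: "scal c x * y = scal c (x * y)"
  and scal_mult_right: "x * scal c y = scal c (x * y)"
  unfolding scal_def by (metis mult.assoc scal_central)+

interpretation free: vector_space "scal :: 'f::field \<Rightarrow> ('g, 'f) free \<Rightarrow> _"
  by standard (auto intro!: poly_mapping_eqI simp: lookup_add algebra_simps)

text \<open>
  Here \<open>R\<close> stands for the graph of a linear map modulo a congruence, in either direction.
\<close>

lemma span_related:
  assumes "R 0 0" and "\<And>c s y z z'. R s y \<Longrightarrow> R z z' \<Longrightarrow> R (scal c s + z) (scal c y + z')"
    and "\<And>s. s \<in> S \<Longrightarrow> \<exists>y\<in>free.span S'. R s y" and "x \<in> free.span S"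
  shows "\<exists>y\<in>free.span S'. R x y"
  using assms(4)
proof (induction rule: free.span_induct_alt)
  case base
  show ?case using assms(1) free.span_zero by blast
next
  case (step c s z)
  then obtain y z' where "y \<in> free.span S'" "R s y" "z' \<in> free.span S'" "R z z'"
    using assms(3) by blast
  then show ?case
    using assms(2) by (intro bexI[of _ "scal c y + z'"]) (auto intro: free.span_add free.span_scale)
qed

lemma free_decompose:
  fixes x :: "('g, 'f::field) free"
  shows "x = (\<Sum>u\<in>Poly_Mapping.keys x. scal (Poly_Mapping.lookup x u) (Poly_Mapping.single u 1))"
  by (rule poly_mapping_eqI)
    (auto simp: lookup_sum lookup_single when_def sum.delta[OF finite_keys] in_keys_iff if_distrib cong: if_cong)

text \<open>
  In the last case only words in the support of \<open>x\<close> occur, which makes the rule usable for elements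
  over a restricted alphabet.
\<close>

lemma free_induct [case_names zero add word]:
  fixes x :: "('g, 'f::field) free"
  assumes "P 0" and "\<And>x y. P x \<Longrightarrow> P y \<Longrightarrow> P (x + y)"
    and "\<And>c u. u \<in> Poly_Mapping.keys x \<Longrightarrow> P (scal c (Poly_Mapping.single u 1))"
  shows "P x"
proof -
  have "P (\<Sum>u\<in>K. scal (Poly_Mapping.lookup x u) (Poly_Mapping.single u 1))"
    if "finite K" "K \<subseteq> Poly_Mapping.keys x" for K
    using that by (induction K) (auto intro: assms)
  from this[OF finite_keys order_refl] show ?thesis
    using free_decompose[of x] by simp
qed

abbreviation wmono :: "'g list \<Rightarrow> ('g, 'f::field) free" where
  "wmono w \<equiv> Poly_Mapping.single (Word w) 1"

lemma wmono_append: "wmono (v @ w) = wmono v * wmono w"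
  by (simp add: mult_single plus_word_def)

lemma wmono_Nil: "wmono [] = 1"
  by (simp flip: zero_word_def)

lemma wmono_Cons: "wmono (g # w) = gen g * wmono w"
  by (simp add: gen_def mult_single plus_word_def)

definition lin_ext :: "('g list \<Rightarrow> ('h, 'f::field) free) \<Rightarrow> ('g, 'f) free \<Rightarrow> ('h, 'f) free" where
  "lin_ext \<phi> x = (\<Sum>u\<in>Poly_Mapping.keys x. scal (Poly_Mapping.lookup x u) (\<phi> (letters u)))"

lemma lin_ext_superset:
  assumes "finite K" "Poly_Mapping.keys x \<subseteq> K"
  shows "lin_ext \<phi> x = (\<Sum>u\<in>K. scal (Poly_Mapping.lookup x u) (\<phi> (letters u)))"
  unfolding lin_ext_def by (rule sum.mono_neutral_left) (use assms in \<open>auto simp: in_keys_iff\<close>)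

lemma lin_ext_add: "lin_ext \<phi> (x + y) = lin_ext \<phi> x + lin_ext \<phi> y"
proof -
  let ?K = "Poly_Mapping.keys x \<union> Poly_Mapping.keys y"
  have "lin_ext \<phi> z = (\<Sum>u\<in>?K. scal (Poly_Mapping.lookup z u) (\<phi> (letters u)))"
    if "Poly_Mapping.keys z \<subseteq> ?K" for z
    using that by (intro lin_ext_superset) auto
  then show ?thesis
    using keys_add[of x y] by (simp add: lookup_add free.scale_left_distrib sum.distrib)
qed

lemma lin_ext_scal: "lin_ext \<phi> (scal c x) = scal c (lin_ext \<phi> x)"
proof -
  have "lin_ext \<phi> (scal c x) = (\<Sum>u\<in>Poly_Mapping.keys x. scal (Poly_Mapping.lookup (scal c x) u) (\<phi> (letters u)))"
    by (rule lin_ext_superset) (auto simp: in_keys_iff)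
  then show ?thesis
    by (simp add: lin_ext_def free.scale_sum_right)
qed

lemma lin_ext_wmono [simp]: "lin_ext \<phi> (wmono w) = \<phi> w"
  by (simp add: lin_ext_def)

lemma lin_ext_zero [simp]: "lin_ext \<phi> 0 = 0"
  by (simp add: lin_ext_def)

lemma lin_ext_one: "lin_ext \<phi> 1 = \<phi> []"
  using lin_ext_wmono[of \<phi> "[]"] by (simp add: wmono_Nil)

lemma lin_ext_diff: "lin_ext \<phi> (x - y) = lin_ext \<phi> x - lin_ext \<phi> y"
  using lin_ext_add[of \<phi> "x - y" y] by (simp add: algebra_simps)

lemma lin_ext_sum: "lin_ext \<phi> (sum f A) = (\<Sum>a\<in>A. lin_ext \<phi> (f a))"
  by (induction A rule: infinite_finite_induct) (auto simp: lin_ext_add)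

lemma free_mono_induct [case_names zero add mono]:
  fixes x :: "('g, 'f::field) free"
  assumes "P 0" and "\<And>x y. P x \<Longrightarrow> P y \<Longrightarrow> P (x + y)"
    and "\<And>c w. Word w \<in> Poly_Mapping.keys x \<Longrightarrow> P (scal c (wmono w))"
  shows "P x"
proof (induction x rule: free_induct)
  case (word c u)
  then show ?case using assms(3)[of "letters u" c] by simp
qed (use assms in auto)

text \<open>
  Recursions along the first or the last letter of a word carry over to all elements by linearity.
  Matrix coefficients are computed with these two rules.
\<close>

lemma lin_ext_gen_mult:
  assumes "\<And>w. \<phi> (g # w) = a * \<phi>' w"
  shows "lin_ext \<phi> (gen g * x) = a * lin_ext \<phi>' x"
proof (induction x rule: free_mono_induct)
  case (mono c w)
  then show ?case
    by (simp add: scal_mult_right lin_ext_scal assms flip: wmono_Cons)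
qed (simp_all add: distrib_left lin_ext_add)

lemma lin_ext_mult_gen:
  fixes x :: "('a, 'b::field) free"
  assumes "\<And>w. \<phi> (w @ [g]) = \<phi>' w * a"
  shows "lin_ext \<phi> (x * gen g) = lin_ext \<phi>' x * a"
proof (induction x rule: free_mono_induct)
  case (mono c w)
  have "wmono w * gen g = (wmono (w @ [g]) :: ('a, 'b) free)"
    unfolding wmono_append gen_def ..
  then show ?case
    by (simp add: scal_mult_left lin_ext_scal assms)
qed (simp_all add: distrib_right lin_ext_add)

lemma lin_ext_mult:
  assumes "\<And>v w. \<phi> (v @ w) = \<phi> v * \<phi> w"
  shows "lin_ext \<phi> (x * y) = lin_ext \<phi> x * lin_ext \<phi> y"
proof (induction x rule: free_mono_induct)
  case (mono c v)
  have "lin_ext \<phi> (wmono v * y) = \<phi> v * lin_ext \<phi> y"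
  proof (induction y rule: free_mono_induct)
    case (mono d w)
    then show ?case
      by (simp add: scal_mult_right lin_ext_scal assms flip: wmono_append)
  qed (simp_all add: distrib_left lin_ext_add)
  then show ?case by (simp add: scal_mult_left lin_ext_scal)
qed (simp_all add: distrib_right lin_ext_add)

definition alg_hom :: "('g \<Rightarrow> ('h, 'f::field) free) \<Rightarrow> ('g, 'f) free \<Rightarrow> ('h, 'f) free" where
  "alg_hom h = lin_ext (\<lambda>w. prod_list (map h w))"

lemma alg_hom_mult: "alg_hom h (x * y) = alg_hom h x * alg_hom h y"
  unfolding alg_hom_def by (rule lin_ext_mult) simp

lemma alg_hom_gen [simp]: "alg_hom h (gen g) = h g"
  by (simp add: alg_hom_def gen_def)

lemma alg_hom_one [simp]: "alg_hom h 1 = 1"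
  by (simp add: alg_hom_def lin_ext_one)

lemmas alg_hom_linear_simps = lin_ext_add[of "\<lambda>w. prod_list (map h w)" for h, folded alg_hom_def]
  lin_ext_diff[of "\<lambda>w. prod_list (map h w)" for h, folded alg_hom_def]
  lin_ext_zero[of "\<lambda>w. prod_list (map h w)" for h, folded alg_hom_def]
  lin_ext_sum[of "\<lambda>w. prod_list (map h w)" for h, folded alg_hom_def]
  lin_ext_scal[of "\<lambda>w. prod_list (map h w)" for h, folded alg_hom_def]

lemma free_carrier_scal: "x \<in> free_carrier G \<Longrightarrow> scal c x \<in> free_carrier G"
  by (auto simp: free_carrier_def in_keys_iff)

lemma free_carrier_sum: "(\<And>a. a \<in> A \<Longrightarrow> f a \<in> free_carrier G) \<Longrightarrow> sum f A \<in> free_carrier G"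
  by (rule finsum_free_ring(1)) auto

lemma wmono_free_carrier [simp]: "(wmono w :: ('g, 'f::field) free) \<in> free_carrier G \<longleftrightarrow> set w \<subseteq> G"
  by (simp add: free_carrier_def)

lemma free_carrier_induct [consumes 1, case_names zero add mono]:
  fixes x :: "('g, 'f::field) free"
  assumes "x \<in> free_carrier G"
    and "P 0" and "\<And>x y. P x \<Longrightarrow> P y \<Longrightarrow> P (x + y)"
    and "\<And>c w. set w \<subseteq> G \<Longrightarrow> P (scal c (wmono w))"
  shows "P x"
  by (rule free_mono_induct[of P x]) (use assms in \<open>auto simp: free_carrier_def\<close>)

lemma lin_ext_free_carrier:
  assumes "x \<in> free_carrier G" "\<And>w. set w \<subseteq> G \<Longrightarrow> \<phi> w \<in> free_carrier H"
  shows "lin_ext \<phi> x \<in> free_carrier H"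
  using assms(1)
  by (induction x rule: free_carrier_induct)
    (auto simp: lin_ext_add lin_ext_scal assms zero_one_free_carrier
      intro: free_carrier_closed free_carrier_scal)

text \<open>
  The augmentation ideal. Its classes are the elements of the Kumjian-Pask algebra inside the
  unitization.
\<close>

definition aug_carrier :: "'g set \<Rightarrow> ('g, 'f::field) free set" where
  "aug_carrier G = {x \<in> free_carrier G. Poly_Mapping.lookup x 0 = 0}"

text \<open>
  The constant term is a character, because the empty word has no factorisation except into empty
  words.
\<close>

lemma lookup_mult_zero_word:
  fixes x y :: "('g, 'f::field) free"
  shows "Poly_Mapping.lookup (x * y) 0 = Poly_Mapping.lookup x 0 * Poly_Mapping.lookup y 0"
proof -
  have *: "Poly_Mapping.lookup (wmono w * y) 0 = Poly_Mapping.lookup (wmono w :: ('g, 'f) free) 0 * Poly_Mapping.lookup y 0"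
    for w y
  proof (induction y rule: free_mono_induct)
    case (mono c v)
    then show ?case
      by (cases w; cases v)
        (auto simp: scal_mult_right lookup_single zero_word_def simp flip: wmono_append)
  qed (auto simp: distrib_left lookup_add)
  show ?thesis
    by (induction x rule: free_mono_induct)
      (auto simp: distrib_right lookup_add scal_mult_left * )
qed

lemma aug_carrier_closed:
  "x \<in> aug_carrier G \<Longrightarrow> x \<in> free_carrier G"
  "0 \<in> aug_carrier G"
  "x \<in> aug_carrier G \<Longrightarrow> y \<in> aug_carrier G \<Longrightarrow> x + y \<in> aug_carrier G"
  "x \<in> aug_carrier G \<Longrightarrow> y \<in> aug_carrier G \<Longrightarrow> x - y \<in> aug_carrier G"
  "x \<in> aug_carrier G \<Longrightarrow> scal c x \<in> aug_carrier G"
  "x \<in> aug_carrier G \<Longrightarrow> y \<in> free_carrier G \<Longrightarrow> x * y \<in> aug_carrier G"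
  "y \<in> free_carrier G \<Longrightarrow> x \<in> aug_carrier G \<Longrightarrow> y * x \<in> aug_carrier G"
  by (auto simp: aug_carrier_def zero_one_free_carrier free_carrier_closed free_carrier_scal
      lookup_add lookup_minus lookup_mult_zero_word)

lemma aug_carrier_sum: "(\<And>a. a \<in> A \<Longrightarrow> f a \<in> aug_carrier G) \<Longrightarrow> sum f A \<in> aug_carrier G"
  by (induction A rule: infinite_finite_induct) (auto intro: aug_carrier_closed)

lemma gen_aug_carrier: "g \<in> G \<Longrightarrow> gen g \<in> aug_carrier G"
  by (auto simp: aug_carrier_def gen_free_carrier) (simp add: gen_def lookup_single zero_word_def)

lemma aug_carrier_induct [consumes 1, case_names zero add mono]:
  fixes x :: "('g, 'f::field) free"
  assumes x: "x \<in> aug_carrier G"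
    and step: "P 0" "\<And>x y. P x \<Longrightarrow> P y \<Longrightarrow> P (x + y)"
    "\<And>c w. set w \<subseteq> G \<Longrightarrow> w \<noteq> [] \<Longrightarrow> P (scal c (wmono w))"
  shows "P x"
proof (rule free_mono_induct[of P x])
  fix c w
  assume "Word w \<in> Poly_Mapping.keys x"
  moreover from this have "set (letters (Word w)) \<subseteq> G"
    using x unfolding aug_carrier_def free_carrier_def by blast
  ultimately have "set w \<subseteq> G" "w \<noteq> []"
    using x by (auto simp: aug_carrier_def zero_word_def in_keys_iff)
  then show "P (scal c (wmono w))" by (rule step)
qed (use step in auto)

section \<open>Factorisations in a k-graph\<close>

text \<open>
  The first or the last factor of a morphism, when that factor has the given degree; unique
  factorisation leaves no choice. If there is no such factorisation, then the value is arbitrary.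
\<close>

definition prefix_of :: "('m, 'k::finite) kgraph \<Rightarrow> nat ^ 'k \<Rightarrow> 'm \<Rightarrow> 'm" where
  "prefix_of \<Lambda> m \<alpha> = (SOME \<mu>. \<mu> \<in> Mor \<Lambda> \<and> Deg \<Lambda> \<mu> = m \<and>
     (\<exists>\<nu>\<in>Mor \<Lambda>. Src \<Lambda> \<mu> = Rng \<Lambda> \<nu> \<and> \<alpha> = Cmp \<Lambda> \<mu> \<nu>))"

definition suffix_of :: "('m, 'k::finite) kgraph \<Rightarrow> nat ^ 'k \<Rightarrow> 'm \<Rightarrow> 'm" where
  "suffix_of \<Lambda> n \<alpha> = (SOME \<nu>. \<nu> \<in> Mor \<Lambda> \<and> Deg \<Lambda> \<nu> = n \<and>
     (\<exists>\<mu>\<in>Mor \<Lambda>. Src \<Lambda> \<mu> = Rng \<Lambda> \<nu> \<and> \<alpha> = Cmp \<Lambda> \<mu> \<nu>))"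

context k_graph
begin

abbreviation "src \<equiv> Src \<Lambda>"
abbreviation "rng \<equiv> Rng \<Lambda>"
abbreviation "deg \<equiv> Deg \<Lambda>"
abbreviation "cmp \<equiv> Cmp \<Lambda>"
abbreviation "mor \<equiv> Mor \<Lambda>"
abbreviation "verts \<equiv> kg_verts \<Lambda>"

lemma factorisation_unique:
  assumes "\<mu> \<in> mor" "\<nu> \<in> mor" "\<mu>' \<in> mor" "\<nu>' \<in> mor"
    and "src \<mu> = rng \<nu>" "src \<mu>' = rng \<nu>'" "cmp \<mu> \<nu> = cmp \<mu>' \<nu>'"
    and "deg \<mu> = deg \<mu>' \<or> deg \<nu> = deg \<nu>'"
  shows "\<mu> = \<mu>' \<and> \<nu> = \<nu>'"
proof -
  have d: "deg (cmp \<mu> \<nu>) = deg \<mu> + deg \<nu>" "deg (cmp \<mu>' \<nu>') = deg \<mu>' + deg \<nu>'"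
    by (rule Deg_Cmp; fact assms)+
  then have e: "deg \<mu> = deg \<mu>'" "deg \<nu> = deg \<nu>'"
    using assms(7,8) by auto
  have "cmp \<mu> \<nu> \<in> mor" using assms by (simp add: Cmp_closed)
  note the1_equality[OF unique_factorisation[OF this d(1)]]
  from this[of "(\<mu>, \<nu>)"] this[of "(\<mu>', \<nu>')"]
  have "(\<mu>, \<nu>) = (\<mu>', \<nu>')"
    using assms(1-7) e by simp
  then show ?thesis by simp
qed

lemma factorise:
  assumes "\<alpha> \<in> mor" "deg \<alpha> = m + n"
  obtains \<mu> \<nu> where "\<mu> \<in> mor" "\<nu> \<in> mor" "src \<mu> = rng \<nu>" "\<alpha> = cmp \<mu> \<nu>"
    "deg \<mu> = m" "deg \<nu> = n"
  using unique_factorisation[OF assms] by blast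

lemma prefix_of_Cmp:
  assumes "\<mu> \<in> mor" "\<nu> \<in> mor" "src \<mu> = rng \<nu>"
  shows "prefix_of \<Lambda> (deg \<mu>) (cmp \<mu> \<nu>) = \<mu>"
  unfolding prefix_of_def
proof (rule some_equality)
  fix x assume "x \<in> mor \<and> deg x = deg \<mu> \<and>
     (\<exists>y\<in>mor. src x = rng y \<and> cmp \<mu> \<nu> = cmp x y)"
  then show "x = \<mu>"
    using factorisation_unique[OF assms(1,2) _ _ assms(3), of x] factorisation_unique[OF assms(1,2) _ _ assms(3), of _ _]
    by metis
qed (use assms in auto)

lemma suffix_of_Cmp:
  assumes "\<mu> \<in> mor" "\<nu> \<in> mor" "src \<mu> = rng \<nu>"
  shows "suffix_of \<Lambda> (deg \<nu>) (cmp \<mu> \<nu>) = \<nu>"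
  unfolding suffix_of_def
proof (rule some_equality)
  fix x assume "x \<in> mor \<and> deg x = deg \<nu> \<and>
     (\<exists>y\<in>mor. src y = rng x \<and> cmp \<mu> \<nu> = cmp y x)"
  then show "x = \<nu>"
    using factorisation_unique[OF assms(1,2) _ _ assms(3), of _ x] factorisation_unique[OF assms(1,2) _ _ assms(3), of _ _]
    by metis
qed (use assms in auto)

lemma Deg_Rng: "\<alpha> \<in> mor \<Longrightarrow> deg (rng \<alpha>) = 0"
  using Deg_Src[of "rng \<alpha>"] by (simp add: Rng_closed Src_Rng)

lemma Src_vert: "\<alpha> \<in> mor \<Longrightarrow> src \<alpha> \<in> verts"
  and Rng_vert: "\<alpha> \<in> mor \<Longrightarrow> rng \<alpha> \<in> verts"
  by (simp_all add: kg_verts_def Src_closed Rng_closed Deg_Src Deg_Rng)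

lemma vert_Mor: "v \<in> verts \<Longrightarrow> v \<in> mor"
  and vert_Deg: "v \<in> verts \<Longrightarrow> deg v = 0"
  by (simp_all add: kg_verts_def)

lemma Rng_of_vert: "v \<in> verts \<Longrightarrow> rng v = v"
  and Src_of_vert: "v \<in> verts \<Longrightarrow> src v = v"
proof -
  assume v: "v \<in> verts"
  then have "rng v = v \<and> v = src v"
    by (intro factorisation_unique)
      (auto simp: kg_verts_def Rng_closed Src_closed Src_Rng Rng_Src Cmp_Rng Cmp_Src Deg_Rng)
  then show "rng v = v" "src v = v" by auto
qed

text \<open>
  Unique factorisation, read as a bijection.
\<close>

lemma paths_into_bij:
  "bij_betw (\<lambda>(\<alpha>, \<beta>). cmp \<alpha> \<beta>) (SIGMA \<alpha>:paths_into \<Lambda> v m. paths_into \<Lambda> (src \<alpha>) n)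
     (paths_into \<Lambda> v (m + n))"
  unfolding bij_betw_def
proof
  show "inj_on (\<lambda>(\<alpha>, \<beta>). cmp \<alpha> \<beta>) (SIGMA \<alpha>:paths_into \<Lambda> v m. paths_into \<Lambda> (src \<alpha>) n)"
  proof (rule inj_onI, clarify)
    fix \<alpha> \<beta> \<alpha>' \<beta>'
    assume "\<alpha> \<in> paths_into \<Lambda> v m" "\<beta> \<in> paths_into \<Lambda> (src \<alpha>) n"
      "\<alpha>' \<in> paths_into \<Lambda> v m" "\<beta>' \<in> paths_into \<Lambda> (src \<alpha>') n" "cmp \<alpha> \<beta> = cmp \<alpha>' \<beta>'"
    then show "\<alpha> = \<alpha>' \<and> \<beta> = \<beta>'"
      by (intro factorisation_unique) (auto simp: paths_into_def)
  qed
  show "(\<lambda>(\<alpha>, \<beta>). cmp \<alpha> \<beta>) ` (SIGMA \<alpha>:paths_into \<Lambda> v m. paths_into \<Lambda> (src \<alpha>) n)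
      = paths_into \<Lambda> v (m + n)"
  proof (intro equalityI subsetI)
    fix \<gamma> assume "\<gamma> \<in> paths_into \<Lambda> v (m + n)"
    then have g: "\<gamma> \<in> mor" "deg \<gamma> = m + n" "rng \<gamma> = v" by (auto simp: paths_into_def)
    from g(1,2) obtain \<mu> \<nu> where "\<mu> \<in> mor" "\<nu> \<in> mor" "src \<mu> = rng \<nu>" "\<gamma> = cmp \<mu> \<nu>"
      "deg \<mu> = m" "deg \<nu> = n" by (rule factorise)
    then show "\<gamma> \<in> (\<lambda>(\<alpha>, \<beta>). cmp \<alpha> \<beta>) ` (SIGMA \<alpha>:paths_into \<Lambda> v m. paths_into \<Lambda> (src \<alpha>) n)"
      using g(3) by (intro image_eqI[of _ _ "(\<mu>, \<nu>)"]) (auto simp: paths_into_def Rng_Cmp)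
  qed (auto simp: paths_into_def Cmp_closed Rng_Cmp Deg_Cmp)
qed

lemma degree_induct [case_names zero step]:
  fixes n :: "nat ^ 'k"
  assumes "P 0" and step: "\<And>n i. P n \<Longrightarrow> P (basis_deg i + n)"
  shows "P n"
proof (induction "\<Sum>i\<in>UNIV. n $ i" arbitrary: n)
  case 0
  then have "n = 0" by (simp add: vec_eq_iff)
  with assms show ?case by simp
next
  case (Suc k)
  then obtain i where i: "n $ i \<noteq> 0" by (metis sum.neutral nat.distinct(1))
  define n' where "n' = n - basis_deg i"
  have n: "n = basis_deg i + n'"
    using i by (auto simp: n'_def vec_eq_iff axis_def)
  then have "Suc k = (\<Sum>j\<in>UNIV. basis_deg i $ j) + (\<Sum>j\<in>UNIV. n' $ j)"
    using Suc(2) by (simp add: sum.distrib)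
  moreover have "(\<Sum>j\<in>UNIV. basis_deg i $ j) = (1 :: nat)"
    by (simp add: axis_def)
  ultimately have "P n'" using Suc(1)[of n'] by simp
  then show ?case unfolding n by (rule step)
qed

lemma finite_paths_into:
  assumes "row_finite \<Lambda>" "v \<in> verts"
  shows "finite (paths_into \<Lambda> v n)"
  using assms(2)
proof (induction n arbitrary: v rule: degree_induct)
  case zero
  have "paths_into \<Lambda> v 0 \<subseteq> {v}"
    using Rng_of_vert by (auto simp: paths_into_def kg_verts_def)
  then show ?case by (rule finite_subset) simp
next
  case (step n i)
  have "finite (SIGMA \<alpha>:paths_into \<Lambda> v (basis_deg i). paths_into \<Lambda> (src \<alpha>) n)"
    using assms(1) step by (intro finite_SigmaI) (auto simp: row_finite_def paths_into_def Src_vert)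
  then show ?case
    using bij_betw_finite[OF paths_into_bij] by blast
qed

end

section \<open>Congruence modulo the Kumjian-Pask relations\<close>

type_synonym ('m, 'f) kp_poly = "('m kp_gen, 'f) free"

definition cut :: "'g set \<Rightarrow> ('g, 'f::field) free \<Rightarrow> ('g, 'f) free" where
  "cut G = lin_ext (\<lambda>w. if set w \<subseteq> G then wmono w else 0)"

lemma cut_mult: "cut G (x * y) = cut G x * cut G y"
  unfolding cut_def by (rule lin_ext_mult) (auto simp: wmono_append)

lemma cut_carrier: "cut G x \<in> free_carrier G"
  unfolding cut_def
  by (induction x rule: free_mono_induct)
    (auto simp: lin_ext_add lin_ext_scal zero_one_free_carrier
      intro!: free_carrier_closed free_carrier_scal)

lemma cut_id: "x \<in> free_carrier G \<Longrightarrow> cut G x = x"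
  unfolding cut_def
  by (induction x rule: free_carrier_induct) (auto simp: lin_ext_add lin_ext_scal)

text \<open>
  Removing the words with foreign letters first makes this a congruence of the algebra of all words,
  so that calculations need no conditions of membership in \<open>kp_carrier\<close>.
\<close>

definition kp_eq :: "('m, 'k::finite) kgraph \<Rightarrow> ('m, 'f::field) kp_poly \<Rightarrow> ('m, 'f) kp_poly \<Rightarrow> bool" where
  "kp_eq \<Lambda> x y \<longleftrightarrow> cut (kp_gens \<Lambda>) (x - y) \<in> kp_ideal \<Lambda>"

lemma kp_eq_eq_trans [trans]: "kp_eq \<Lambda> x y \<Longrightarrow> y = z \<Longrightarrow> kp_eq \<Lambda> x z"
  and eq_kp_eq_trans [trans]: "x = y \<Longrightarrow> kp_eq \<Lambda> y z \<Longrightarrow> kp_eq \<Lambda> x z"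
  by simp_all

abbreviation kp_carrier :: "('m, 'k::finite) kgraph \<Rightarrow> ('m, 'f::field) kp_poly set" where
  "kp_carrier \<Lambda> \<equiv> free_carrier (kp_gens \<Lambda>)"

abbreviation kp_aug :: "('m, 'k::finite) kgraph \<Rightarrow> ('m, 'f::field) kp_poly set" where
  "kp_aug \<Lambda> \<equiv> aug_carrier (kp_gens \<Lambda>)"

lemma uminus_free_ring:
  fixes x :: "('g, 'f::field) free"
  assumes "x \<in> free_carrier G"
  shows "\<ominus>\<^bsub>free_ring G\<^esub> x = - x"
proof -
  interpret ring "free_ring G :: ('g, 'f) free ring" by (rule ring_free_ring)
  show ?thesis
    by (rule minus_equality) (use assms in \<open>auto simp: free_ring_def free_carrier_closed\<close>)
qed

context k_graph
begin

abbreviation kp_sim (infix "\<sim>" 50) where "x \<sim> y \<equiv> kp_eq \<Lambda> x y"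

abbreviation ghost :: "'m \<Rightarrow> ('m, 'f::field) kp_poly" where "ghost \<equiv> fghost \<Lambda>"

abbreviation cls :: "('m, 'f::field) kp_poly \<Rightarrow> ('m, 'f) kp_poly set" where "cls \<equiv> kp_class \<Lambda>"

lemma kp_ideal_ideal: "ideal (kp_ideal \<Lambda>) (kp_free \<Lambda>)"
  unfolding kp_ideal_def by (intro ring.genideal_ideal ring_free_ring kp_relators_carrier)

lemma kp_relators_subset: "kp_relators \<Lambda> \<subseteq> kp_ideal \<Lambda>"
  unfolding kp_ideal_def by (intro ring.genideal_self ring_free_ring kp_relators_carrier)

lemma kp_ideal_closed:
  fixes x y a :: "('m, 'f::field) kp_poly"
  shows "x \<in> kp_ideal \<Lambda> \<Longrightarrow> x \<in> kp_carrier \<Lambda>"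
    "(0 :: ('m, 'f) kp_poly) \<in> kp_ideal \<Lambda>"
    "x \<in> kp_ideal \<Lambda> \<Longrightarrow> y \<in> kp_ideal \<Lambda> \<Longrightarrow> x + y \<in> kp_ideal \<Lambda>"
    "x \<in> kp_ideal \<Lambda> \<Longrightarrow> a \<in> kp_carrier \<Lambda> \<Longrightarrow> a * x \<in> kp_ideal \<Lambda>"
    "x \<in> kp_ideal \<Lambda> \<Longrightarrow> a \<in> kp_carrier \<Lambda> \<Longrightarrow> x * a \<in> kp_ideal \<Lambda>"
proof -
  interpret I: ideal "kp_ideal \<Lambda> :: ('m, 'f) kp_poly set" "kp_free \<Lambda>"
    by (rule kp_ideal_ideal)
  let ?R = "kp_free \<Lambda> :: ('m kp_gen, 'f) free ring"
  have C: "carrier ?R = kp_carrier \<Lambda>" "mult ?R = (*)" "add ?R = (+)" "zero ?R = 0"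
    by (simp_all add: free_ring_def)
  show "x \<in> kp_ideal \<Lambda> \<Longrightarrow> x \<in> kp_carrier \<Lambda>"
    using I.a_subset C(1) by blast
  show "(0 :: ('m, 'f) kp_poly) \<in> kp_ideal \<Lambda>"
    using additive_subgroup.zero_closed[OF I.additive_subgroup_axioms] C(4) by simp
  show "x \<in> kp_ideal \<Lambda> \<Longrightarrow> y \<in> kp_ideal \<Lambda> \<Longrightarrow> x + y \<in> kp_ideal \<Lambda>"
    using additive_subgroup.a_closed[OF I.additive_subgroup_axioms, of x y] C(3) by simp
  show "x \<in> kp_ideal \<Lambda> \<Longrightarrow> a \<in> kp_carrier \<Lambda> \<Longrightarrow> a * x \<in> kp_ideal \<Lambda>"
    using I.I_l_closed[of x a] C by simp
  show "x \<in> kp_ideal \<Lambda> \<Longrightarrow> a \<in> kp_carrier \<Lambda> \<Longrightarrow> x * a \<in> kp_ideal \<Lambda>"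
    using I.I_r_closed[of x a] C by simp
qed

text \<open>
  Minimality of the ideal as an induction rule: it serves to show that a linear map between free
  algebras descends to the Kumjian-Pask algebras.
\<close>

lemma kp_ideal_induct [consumes 1, case_names zero add left right relator]:
  fixes x :: "('m, 'f::field) kp_poly"
  assumes x: "x \<in> kp_ideal \<Lambda>"
    and "P 0" and "\<And>x y. P x \<Longrightarrow> P y \<Longrightarrow> P (x + y)"
    and "\<And>a x. a \<in> kp_carrier \<Lambda> \<Longrightarrow> P x \<Longrightarrow> P (a * x)"
    and "\<And>a x. a \<in> kp_carrier \<Lambda> \<Longrightarrow> P x \<Longrightarrow> P (x * a)"
    and "\<And>r. r \<in> kp_relators \<Lambda> \<Longrightarrow> P r"
  shows "P x"
proof -
  let ?R = "kp_free \<Lambda> :: ('m kp_gen, 'f) free ring"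
  let ?I = "{x \<in> kp_carrier \<Lambda>. P x}"
  interpret R: ring ?R by (rule ring_free_ring)
  have m: "P (- x)" if "P x" for x
  proof -
    have "(- 1 :: ('m, 'f) kp_poly) \<in> kp_carrier \<Lambda>"
      by (rule free_carrier_closed(3)[OF zero_one_free_carrier(2,2)])
    then show ?thesis using assms(4)[of "- 1" x] that by simp
  qed
  have "subgroup ?I (add_monoid ?R)"
  proof (rule R.add.subgroupI)
    show "\<ominus>\<^bsub>?R\<^esub> a \<in> ?I" if "a \<in> ?I" for a
      using uminus_free_ring[of a "kp_gens \<Lambda>"] that m free_carrier_closed(3)[of a "kp_gens \<Lambda>" a]
      by simp
  qed (use assms(2,3) in \<open>auto simp: free_ring_def free_carrier_closed intro: zero_one_free_carrier\<close>)
  then have "ideal ?I ?R"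
    by (intro idealI ring_free_ring) (use assms(4,5) in \<open>auto simp: free_ring_def free_carrier_closed\<close>)
  moreover have "kp_relators \<Lambda> \<subseteq> ?I"
    using kp_relators_carrier assms(6) by (auto simp: free_ring_def)
  ultimately have "kp_ideal \<Lambda> \<subseteq> ?I"
    unfolding kp_ideal_def by (rule R.genideal_minimal)
  with x show ?thesis by blast
qed

lemma relator_cases [consumes 1, case_names verts paths ghosts unit1 unit2 unit3 unit4 ghost_path vert_sum]:
  assumes "r \<in> kp_relators \<Lambda>"
  obtains u v where "r = fpath u * fpath v - (if u = v then fpath u else 0)" "u \<in> verts" "v \<in> verts"
  | \<alpha> \<mu> where "r = fpath \<alpha> * fpath \<mu> - fpath (cmp \<alpha> \<mu>)" "\<alpha> \<in> mor" "\<mu> \<in> mor" "src \<alpha> = rng \<mu>"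
  | \<alpha> \<mu> where "r = ghost \<mu> * ghost \<alpha> - ghost (cmp \<alpha> \<mu>)" "\<alpha> \<in> mor" "\<mu> \<in> mor" "src \<alpha> = rng \<mu>"
  | \<alpha> where "r = fpath (rng \<alpha>) * fpath \<alpha> - fpath \<alpha>" "\<alpha> \<in> mor"
  | \<alpha> where "r = fpath \<alpha> * fpath (src \<alpha>) - fpath \<alpha>" "\<alpha> \<in> mor"
  | \<alpha> where "r = fpath (src \<alpha>) * ghost \<alpha> - ghost \<alpha>" "\<alpha> \<in> mor"
  | \<alpha> where "r = ghost \<alpha> * fpath (rng \<alpha>) - ghost \<alpha>" "\<alpha> \<in> mor"
  | \<alpha> \<mu> where "r = ghost \<alpha> * fpath \<mu> - (if \<alpha> = \<mu> then fpath (src \<alpha>) else 0)" "\<alpha> \<in> mor" "\<mu> \<in> mor" "deg \<alpha> = deg \<mu>"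
  | v n where "r = fpath v - (\<Sum>\<alpha>\<in>paths_into \<Lambda> v n. fpath \<alpha> * ghost \<alpha>)" "v \<in> verts" "n \<noteq> 0"
  using assms unfolding kp_relators_def by blast

lemma kp_eq_refl [simp]: "x \<sim> x"
  by (simp add: kp_eq_def cut_def kp_ideal_closed)

lemma kp_eq_iff: "x \<in> kp_carrier \<Lambda> \<Longrightarrow> y \<in> kp_carrier \<Lambda> \<Longrightarrow> x \<sim> y \<longleftrightarrow> x - y \<in> kp_ideal \<Lambda>"
  by (simp add: kp_eq_def cut_id free_carrier_closed)

lemma kp_eq_diff_zero: "x - y \<sim> 0 \<longleftrightarrow> x \<sim> y"
  by (simp add: kp_eq_def)

lemma kp_eq_add:
  assumes "x \<sim> x'" "y \<sim> y'"
  shows "x + y \<sim> x' + y'"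
proof -
  have "cut (kp_gens \<Lambda>) (x + y - (x' + y')) = cut (kp_gens \<Lambda>) (x - x') + cut (kp_gens \<Lambda>) (y - y')"
    by (simp add: cut_def lin_ext_add lin_ext_diff)
  then show ?thesis using assms by (simp add: kp_eq_def kp_ideal_closed)
qed

lemma kp_eq_mult_left: "x \<sim> y \<Longrightarrow> a * x \<sim> a * y"
  and kp_eq_mult_right: "x \<sim> y \<Longrightarrow> x * a \<sim> y * a"
  by (simp_all add: kp_eq_def cut_mult kp_ideal_closed cut_carrier flip: right_diff_distrib left_diff_distrib)

lemma kp_eq_scal: "x \<sim> y \<Longrightarrow> scal c x \<sim> scal c y"
  unfolding scal_def by (rule kp_eq_mult_left)

lemma kp_eq_sym: "x \<sim> y \<Longrightarrow> y \<sim> x"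
  using kp_eq_scal[of "x" "y" "- 1"] kp_eq_add[of "scal (- 1) x" "scal (- 1) y" "x + y" "x + y"]
  by simp

lemma kp_eq_trans [trans]: "x \<sim> y \<Longrightarrow> y \<sim> z \<Longrightarrow> x \<sim> z"
  using kp_eq_add[of x y y z] kp_eq_add[of "x + y" "y + z" "- y" "- y"] by simp

lemma kp_eq_mult: "x \<sim> x' \<Longrightarrow> y \<sim> y' \<Longrightarrow> x * y \<sim> x' * y'"
  by (blast intro: kp_eq_trans kp_eq_mult_left kp_eq_mult_right)

lemma kp_eq_sum: "(\<And>a. a \<in> A \<Longrightarrow> f a \<sim> g a) \<Longrightarrow> sum f A \<sim> sum g A"
  by (induction A rule: infinite_finite_induct) (auto intro: kp_eq_add)

lemma kp_eq_relator: "x - y \<in> kp_relators \<Lambda> \<Longrightarrow> x \<sim> y"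
  using kp_relators_subset kp_relators_carrier
  by (auto simp: kp_eq_def cut_id free_ring_def subset_iff)

lemma kp_eq_vert_mult:
  "u \<in> verts \<Longrightarrow> v \<in> verts \<Longrightarrow> fpath u * fpath v \<sim> (if u = v then fpath u else 0)"
  by (rule kp_eq_relator) (unfold kp_relators_def, blast)

lemma kp_eq_path_mult:
  assumes "\<alpha> \<in> mor" "\<mu> \<in> mor" "src \<alpha> = rng \<mu>"
  shows "fpath \<alpha> * fpath \<mu> \<sim> fpath (cmp \<alpha> \<mu>)"
    and "ghost \<mu> * ghost \<alpha> \<sim> ghost (cmp \<alpha> \<mu>)"
  by (rule kp_eq_relator, unfold kp_relators_def, use assms in blast)+

lemma kp_eq_units:
  assumes "\<alpha> \<in> mor"
  shows "fpath (rng \<alpha>) * fpath \<alpha> \<sim> fpath \<alpha>"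
    and "fpath \<alpha> * fpath (src \<alpha>) \<sim> fpath \<alpha>"
    and "fpath (src \<alpha>) * ghost \<alpha> \<sim> ghost \<alpha>"
    and "ghost \<alpha> * fpath (rng \<alpha>) \<sim> ghost \<alpha>"
  by (rule kp_eq_relator, unfold kp_relators_def, use assms in blast)+

lemma kp_eq_ghost_path:
  assumes "\<alpha> \<in> mor" "\<mu> \<in> mor" "deg \<alpha> = deg \<mu>"
  shows "ghost \<alpha> * fpath \<mu> \<sim> (if \<alpha> = \<mu> then fpath (src \<alpha>) else 0)"
  by (rule kp_eq_relator, unfold kp_relators_def, use assms in blast)

lemma kp_eq_vert_sum:
  assumes "v \<in> verts" "n \<noteq> 0"
  shows "(\<Sum>\<alpha>\<in>paths_into \<Lambda> v n. fpath \<alpha> * ghost \<alpha>) \<sim> fpath v"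
  by (rule kp_eq_sym, rule kp_eq_relator, unfold kp_relators_def, use assms in blast)

lemma fghost_vert: "v \<in> verts \<Longrightarrow> ghost v = fpath v"
  by (simp add: fghost_def fpath_def kg_verts_def)

lemma fpath_aug: "\<alpha> \<in> mor \<Longrightarrow> fpath \<alpha> \<in> kp_aug \<Lambda>"
  and fghost_aug: "\<alpha> \<in> mor \<Longrightarrow> ghost \<alpha> \<in> kp_aug \<Lambda>"
  by (auto simp: fpath_def fghost_def kp_gens_def intro!: gen_aug_carrier)

lemma kp_eq_vert_sum_mult:
  assumes "finite V" "V \<subseteq> verts" "v \<in> verts"
  shows "(fpath v * (\<Sum>u\<in>V. fpath u)) \<sim> (if v \<in> V then fpath v else 0)"
    and "((\<Sum>u\<in>V. fpath u) * fpath v) \<sim> (if v \<in> V then fpath v else 0)"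
proof -
  have "(\<Sum>u\<in>V. fpath v * fpath u) \<sim> (\<Sum>u\<in>V. if v = u then fpath v else 0)"
    "(\<Sum>u\<in>V. fpath u * fpath v) \<sim> (\<Sum>u\<in>V. if u = v then fpath u else 0)"
    by (rule kp_eq_sum, rule kp_eq_vert_mult; use assms in blast)+
  then show "(fpath v * (\<Sum>u\<in>V. fpath u)) \<sim> (if v \<in> V then fpath v else 0)"
    "((\<Sum>u\<in>V. fpath u) * fpath v) \<sim> (if v \<in> V then fpath v else 0)"
    using assms by (simp_all add: sum_distrib_left sum_distrib_right)
qed

text \<open>
  The vertex at the range of its first letter fixes a word from the left, the vertex at the source of
  its last letter from the right, and adding further vertices to the sum adds only products that
  vanish.
\<close>

lemma local_units:
  fixes x :: "('m, 'f::field) kp_poly"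
  assumes "x \<in> kp_aug \<Lambda>"
  shows "\<exists>V. finite V \<and> V \<subseteq> verts \<and> (\<forall>V'. finite V' \<longrightarrow> V \<subseteq> V' \<longrightarrow> V' \<subseteq> verts \<longrightarrow>
     ((\<Sum>v\<in>V'. fpath v) * x) \<sim> x \<and> (x * (\<Sum>v\<in>V'. fpath v)) \<sim> x)"
  using assms
proof (induction x rule: aug_carrier_induct)
  case zero
  show ?case by (rule exI[of _ "{}"]) simp
next
  case (add x y)
  then obtain V W where
    V: "finite V" "V \<subseteq> verts" "\<And>V'. finite V' \<Longrightarrow> V \<subseteq> V' \<Longrightarrow> V' \<subseteq> verts \<Longrightarrow>
     ((\<Sum>v\<in>V'. fpath v) * x) \<sim> x \<and> (x * (\<Sum>v\<in>V'. fpath v)) \<sim> x"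
    and W: "finite W" "W \<subseteq> verts" "\<And>V'. finite V' \<Longrightarrow> W \<subseteq> V' \<Longrightarrow> V' \<subseteq> verts \<Longrightarrow>
     ((\<Sum>v\<in>V'. fpath v) * y) \<sim> y \<and> (y * (\<Sum>v\<in>V'. fpath v)) \<sim> y"
    by blast
  show ?case
    by (rule exI[of _ "V \<union> W"])
      (use V W in \<open>auto simp: distrib_left distrib_right intro!: kp_eq_add\<close>)
next
  case (mono c w)
  have gen_units: "\<exists>u\<in>verts. \<exists>v\<in>verts. (fpath u * gen g :: ('m, 'f) kp_poly) \<sim> gen g \<and>
      (gen g * fpath v :: ('m, 'f) kp_poly) \<sim> gen g"
    if "g \<in> kp_gens \<Lambda>" for g
  proof (cases g)
    case (Path \<alpha>)
    then have "\<alpha> \<in> mor" using that by (auto simp: kp_gens_def)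
    then show ?thesis
      using kp_eq_units(1,2)[of \<alpha>] Rng_vert[of \<alpha>] Src_vert[of \<alpha>] Path by (auto simp: fpath_def)
  next
    case (Ghost \<alpha>)
    then have "\<alpha> \<in> mor" "ghost \<alpha> = (gen g :: ('m, 'f) kp_poly)"
      using that by (auto simp: kp_gens_def fghost_def)
    then show ?thesis
      using kp_eq_units(3,4)[of \<alpha>] Rng_vert[of \<alpha>] Src_vert[of \<alpha>] by metis
  qed
  define x :: "('m, 'f) kp_poly" where "x = scal c (wmono w)"
  have xl: "x = gen (hd w) * scal c (wmono (tl w))" and xr: "x = scal c (wmono (butlast w)) * gen (last w)"
    using mono(2)
    by (simp_all add: x_def scal_mult_left scal_mult_right gen_def flip: wmono_append)
  obtain u v where uv: "u \<in> verts" "v \<in> verts"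
    and u: "fpath u * gen (hd w) \<sim> (gen (hd w) :: ('m, 'f) kp_poly)"
    and v: "gen (last w) * fpath v \<sim> (gen (last w) :: ('m, 'f) kp_poly)"
    using gen_units[of "hd w"] gen_units[of "last w"] mono
    by (metis subsetD hd_in_set last_in_set)
  have fix_x: "fpath u * x \<sim> x" "x * fpath v \<sim> x"
    unfolding atomize_conj
    using kp_eq_mult_right[OF u, of "scal c (wmono (tl w))", folded mult.assoc[symmetric] xl]
      kp_eq_mult_left[OF v, of "scal c (wmono (butlast w))"]
    by (metis mult.assoc xl xr)
  have "((\<Sum>z\<in>V'. fpath z) * x) \<sim> x \<and> (x * (\<Sum>z\<in>V'. fpath z)) \<sim> x"
    if V': "finite V'" "{u, v} \<subseteq> V'" "V' \<subseteq> verts" for V'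
  proof
    have s: "((\<Sum>z\<in>V'. fpath z) * fpath u) \<sim> (fpath u :: ('m, 'f) kp_poly)"
      "(fpath v * (\<Sum>z\<in>V'. fpath z)) \<sim> (fpath v :: ('m, 'f) kp_poly)"
      using kp_eq_vert_sum_mult(2)[of V' u] kp_eq_vert_sum_mult(1)[of V' v] V' uv by simp_all
    have "((\<Sum>z\<in>V'. fpath z) * x) \<sim> ((\<Sum>z\<in>V'. fpath z) * (fpath u * x))"
      by (rule kp_eq_mult_left, rule kp_eq_sym, rule fix_x)
    also have "\<dots> \<sim> fpath u * x"
      using kp_eq_mult_right[OF s(1), of x] by (simp add: mult.assoc)
    also note fix_x(1)
    finally show "((\<Sum>z\<in>V'. fpath z) * x) \<sim> x" .
    have "(x * (\<Sum>z\<in>V'. fpath z)) \<sim> ((x * fpath v) * (\<Sum>z\<in>V'. fpath z))"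
      by (rule kp_eq_mult_right, rule kp_eq_sym, rule fix_x)
    also have "\<dots> \<sim> x * fpath v"
      using kp_eq_mult_left[OF s(2), of x] by (simp add: mult.assoc)
    also note fix_x(2)
    finally show "(x * (\<Sum>z\<in>V'. fpath z)) \<sim> x" .
  qed
  then show ?case
    unfolding x_def[symmetric] using uv by (intro exI[of _ "{u, v}"]) auto
qed

section \<open>The Kumjian-Pask algebra as a quotient\<close>

lemma kp_class_eq_iff:
  fixes x y :: "('m, 'f::field) kp_poly"
  assumes "x \<in> kp_carrier \<Lambda>" "y \<in> kp_carrier \<Lambda>"
  shows "cls x = cls y \<longleftrightarrow> x \<sim> y"
proof -
  have "carrier (kp_free \<Lambda> :: ('m kp_gen, 'f) free ring) = kp_carrier \<Lambda>"
    by (simp add: free_ring_def)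
  then show ?thesis
    using ring.quotient_eq_iff_same_a_r_cos[OF ring_free_ring kp_ideal_ideal, of x y] assms
    by (simp add: kp_class_def kp_eq_iff minus_free_ring)
qed

lemma KP_carrier:
  "carrier (KP \<Lambda> :: ('f::field, ('m, 'f) kp_poly set) module) = cls ` kp_aug \<Lambda>"
  by (simp add: KP_def Let_def aug_carrier_def)

lemma KP_ops:
  fixes x y :: "('m, 'f::field) kp_poly"
  assumes "x \<in> kp_carrier \<Lambda>" "y \<in> kp_carrier \<Lambda>"
  shows "cls x \<oplus>\<^bsub>KP \<Lambda>\<^esub> cls y = cls (x + y)"
    and "cls x \<otimes>\<^bsub>KP \<Lambda>\<^esub> cls y = cls (x * y)"
    and "c \<odot>\<^bsub>KP \<Lambda>\<^esub> cls x = cls (scal c x)"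
    and "\<zero>\<^bsub>KP \<Lambda>\<^esub> = cls (0 :: ('m, 'f) kp_poly)"
proof -
  let ?R = "kp_free \<Lambda> :: ('m kp_gen, 'f) free ring"
  interpret h: ring_hom_ring ?R "?R Quot kp_ideal \<Lambda>" "cls"
    using ideal.rcos_ring_hom_ring[OF kp_ideal_ideal] unfolding kp_class_def[abs_def] .
  have C: "carrier ?R = kp_carrier \<Lambda>" by (simp add: free_ring_def)
  have free_ops: "u \<otimes>\<^bsub>?R\<^esub> v = u * v" "u \<oplus>\<^bsub>?R\<^esub> v = u + v" "\<zero>\<^bsub>?R\<^esub> = 0" for u v
    by (simp_all add: free_ring_def)
  have mult: "cls x \<otimes>\<^bsub>?R Quot kp_ideal \<Lambda>\<^esub> cls y = cls (x * y)"
    if "x \<in> kp_carrier \<Lambda>" "y \<in> kp_carrier \<Lambda>" for x y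
    using h.hom_mult[of x y] that by (simp add: C free_ops)
  show "cls x \<oplus>\<^bsub>KP \<Lambda>\<^esub> cls y = cls (x + y)"
    using h.hom_add[of x y] assms by (simp add: C KP_def Let_def free_ops)
  show "cls x \<otimes>\<^bsub>KP \<Lambda>\<^esub> cls y = cls (x * y)"
    using mult assms by (simp add: KP_def Let_def)
  have "Poly_Mapping.single 0 c \<in> kp_carrier \<Lambda>"
    by (simp add: free_carrier_def zero_word_def)
  then show "c \<odot>\<^bsub>KP \<Lambda>\<^esub> cls x = cls (scal c x)"
    using mult assms by (simp add: KP_def Let_def scal_def)
  show "\<zero>\<^bsub>KP \<Lambda>\<^esub> = cls (0 :: ('m, 'f) kp_poly)"
    using h.hom_zero by (simp add: KP_def Let_def free_ops)
qed

lemma KP_abelian_monoid: "abelian_monoid (KP \<Lambda> :: ('f::field, ('m, 'f) kp_poly set) module)"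
proof -
  have zero: "\<zero>\<^bsub>KP \<Lambda>\<^esub> = cls (0 :: ('m, 'f) kp_poly)"
    by (rule KP_ops(4)) (rule zero_one_free_carrier)+
  show ?thesis
    by (rule abelian_monoidI)
      (auto simp: KP_carrier zero KP_ops(1) aug_carrier_closed add_ac intro!: imageI)
qed

lemma KP_finsum:
  fixes f :: "'i \<Rightarrow> ('m, 'f::field) kp_poly"
  assumes "\<And>i. i \<in> A \<Longrightarrow> f i \<in> kp_aug \<Lambda>"
  shows "finsum (KP \<Lambda>) (\<lambda>i. cls (f i)) A = cls (sum f A)"
proof -
  interpret abelian_monoid "KP \<Lambda> :: ('f, ('m, 'f) kp_poly set) module" by (rule KP_abelian_monoid)
  show ?thesis
    using assms
  proof (induction A rule: infinite_finite_induct)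
    case (insert a A)
    then have "finsum (KP \<Lambda>) (\<lambda>i. cls (f i)) (insert a A) =
        cls (f a) \<oplus>\<^bsub>KP \<Lambda>\<^esub> finsum (KP \<Lambda>) (\<lambda>i. cls (f i)) A"
      by (intro finsum_insert) (auto simp: KP_carrier)
    with insert show ?case
      by (simp add: KP_ops aug_carrier_closed aug_carrier_sum)
  qed (simp_all add: KP_ops(4)[OF zero_one_free_carrier(1,1)])
qed

lemma alg_span_KP:
  fixes S :: "('m, 'f::field) kp_poly set"
  assumes "S \<subseteq> kp_carrier \<Lambda>"
  shows "alg_span (KP \<Lambda>) (cls ` S) = cls ` free.span S"
    and "free.span S \<subseteq> kp_carrier \<Lambda>"
proof -
  show sub: "free.span S \<subseteq> kp_carrier \<Lambda>"
    using assms
    by (intro free.span_minimal)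
      (auto simp: free.subspace_def zero_one_free_carrier free_carrier_closed free_carrier_scal)
  have "a \<in> cls ` free.span S" if "a \<in> alg_span (KP \<Lambda>) (cls ` S)" for a
    using that
  proof (induction rule: alg_span.induct)
    case zero
    show ?case
      using free.span_zero[of S] by (simp add: KP_ops(4)[OF zero_one_free_carrier(1,1)])
  next
    case (add_smult a y c)
    then obtain s z where sz: "a = cls s" "y = cls z" "s \<in> S" "z \<in> free.span S" by blast
    then have "c \<odot>\<^bsub>KP \<Lambda>\<^esub> a \<oplus>\<^bsub>KP \<Lambda>\<^esub> y = cls (scal c s + z)"
      using assms sub KP_ops(3)[of s s c] KP_ops(1)[of "scal c s" z]
      by (simp add: free_carrier_scal subset_iff)
    then show ?case
      using sz by (simp add: free.span_add free.span_scale free.span_base)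
  qed
  moreover have "cls z \<in> alg_span (KP \<Lambda>) (cls ` S)" if "z \<in> free.span S" for z
  proof -
    have "z \<in> kp_carrier \<Lambda> \<and> cls z \<in> alg_span (KP \<Lambda>) (cls ` S)"
      using that
    proof (induction rule: free.span_induct_alt)
      case base
      show ?case
        using alg_span.zero[of "KP \<Lambda>" "cls ` S"]
        by (simp add: KP_ops(4)[OF zero_one_free_carrier(1,1)] zero_one_free_carrier)
    next
      case (step c s z)
      then show ?case
        using alg_span.add_smult[of "cls s" "cls ` S" "cls z" "KP \<Lambda>" c] assms
        by (auto simp: KP_ops free_carrier_scal free_carrier_closed subset_iff)
    qed
    then show ?thesis by blast
  qed
  ultimately show "alg_span (KP \<Lambda>) (cls ` S) = cls ` free.span S" by blast
qed

lemma kp_component_class: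
  "kp_component \<Lambda> n = alg_span (KP \<Lambda>) (cls ` {fpath \<alpha> * ghost \<mu> :: ('m, 'f::field) kp_poly | \<alpha> \<mu>.
     \<alpha> \<in> mor \<and> \<mu> \<in> mor \<and> int_deg (deg \<alpha>) - int_deg (deg \<mu>) = n})"
proof -
  have "kp_path \<Lambda> \<alpha> \<otimes>\<^bsub>KP \<Lambda>\<^esub> kp_ghost \<Lambda> \<mu> = cls (fpath \<alpha> * ghost \<mu> :: ('m, 'f) kp_poly)"
    if "\<alpha> \<in> mor" "\<mu> \<in> mor" for \<alpha> \<mu>
    using that by (simp add: kp_path_def kp_ghost_def KP_ops(2) fpath_carrier fghost_carrier)
  then have "{kp_path \<Lambda> \<alpha> \<otimes>\<^bsub>KP \<Lambda>\<^esub> kp_ghost \<Lambda> \<mu> | \<alpha> \<mu>.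
        \<alpha> \<in> mor \<and> \<mu> \<in> mor \<and> int_deg (deg \<alpha>) - int_deg (deg \<mu>) = n} =
     cls ` {fpath \<alpha> * ghost \<mu> :: ('m, 'f::field) kp_poly | \<alpha> \<mu>.
     \<alpha> \<in> mor \<and> \<mu> \<in> mor \<and> int_deg (deg \<alpha>) - int_deg (deg \<mu>) = n}"
    unfolding image_Collect by (intro Collect_cong) metis
  then show ?thesis by (simp add: kp_component_def)
qed

lemma kp_diagonal_class:
  "kp_diagonal \<Lambda> = alg_span (KP \<Lambda>) (cls ` {fpath \<alpha> * ghost \<alpha> :: ('m, 'f::field) kp_poly | \<alpha>. \<alpha> \<in> mor})"
proof -
  have "kp_path \<Lambda> \<alpha> \<otimes>\<^bsub>KP \<Lambda>\<^esub> kp_ghost \<Lambda> \<alpha> = cls (fpath \<alpha> * ghost \<alpha> :: ('m, 'f) kp_poly)"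
    if "\<alpha> \<in> mor" for \<alpha>
    using that by (simp add: kp_path_def kp_ghost_def KP_ops(2) fpath_carrier fghost_carrier)
  then have "{kp_path \<Lambda> \<alpha> \<otimes>\<^bsub>KP \<Lambda>\<^esub> kp_ghost \<Lambda> \<alpha> | \<alpha>. \<alpha> \<in> mor} =
     cls ` {fpath \<alpha> * ghost \<alpha> :: ('m, 'f::field) kp_poly | \<alpha>. \<alpha> \<in> mor}"
    unfolding image_Collect by (intro Collect_cong) metis
  then show ?thesis by (simp add: kp_diagonal_def)
qed

section \<open>Local units, spans and corners\<close>

text \<open>
  The summation relation at the common source, multiplied by \<alpha> on the left and by the ghost of \<mu> on
  the right.
\<close>

lemma kp_eq_sum_paths_out:
  assumes "\<alpha> \<in> mor" "\<mu> \<in> mor" "src \<alpha> = src \<mu>" "n \<noteq> 0"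
  shows "(\<Sum>\<phi>\<in>paths_into \<Lambda> (src \<alpha>) n. fpath (cmp \<alpha> \<phi>) * ghost (cmp \<mu> \<phi>))
    \<sim> fpath \<alpha> * ghost \<mu>"
proof -
  have "(\<Sum>\<phi>\<in>paths_into \<Lambda> (src \<alpha>) n. fpath (cmp \<alpha> \<phi>) * ghost (cmp \<mu> \<phi>))
    \<sim> (\<Sum>\<phi>\<in>paths_into \<Lambda> (src \<alpha>) n. (fpath \<alpha> * fpath \<phi>) * (ghost \<phi> * ghost \<mu>))"
    by (rule kp_eq_sum, rule kp_eq_sym, rule kp_eq_mult; rule kp_eq_path_mult)
      (use assms in \<open>auto simp: paths_into_def\<close>)
  also have "\<dots> = fpath \<alpha> * (\<Sum>\<phi>\<in>paths_into \<Lambda> (src \<alpha>) n. fpath \<phi> * ghost \<phi>) * ghost \<mu>"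
    by (simp add: sum_distrib_left sum_distrib_right mult.assoc)
  also have "\<dots> \<sim> fpath \<alpha> * fpath (src \<alpha>) * ghost \<mu>"
    using assms by (intro kp_eq_mult_left kp_eq_mult_right kp_eq_vert_sum Src_vert)
  also have "\<dots> \<sim> fpath \<alpha> * ghost \<mu>"
    using assms by (intro kp_eq_mult_right kp_eq_units)
  finally show ?thesis .
qed

lemma kp_eq_path_ghost_zero:
  assumes "\<alpha> \<in> mor" "\<mu> \<in> mor" "src \<alpha> \<noteq> src \<mu>"
  shows "fpath \<alpha> * ghost \<mu> \<sim> 0"
proof -
  have "fpath \<alpha> * ghost \<mu> \<sim> (fpath \<alpha> * fpath (src \<alpha>)) * (fpath (src \<mu>) * ghost \<mu>)"
    using assms by (intro kp_eq_mult kp_eq_sym[OF kp_eq_units(2)] kp_eq_sym[OF kp_eq_units(3)])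
  also have "\<dots> = fpath \<alpha> * (fpath (src \<alpha>) * fpath (src \<mu>)) * ghost \<mu>"
    by (simp add: mult.assoc)
  also have "\<dots> \<sim> fpath \<alpha> * 0 * ghost \<mu>"
    using kp_eq_vert_mult[of "src \<alpha>" "src \<mu>"] assms
    by (intro kp_eq_mult_left kp_eq_mult_right) (simp add: Src_vert)
  finally show ?thesis by simp
qed

text \<open>
  On both sides the product is the given element if \<open>v\<close> is the range of \<alpha>, and zero otherwise.
\<close>

lemma kp_eq_vert_diagonal:
  assumes "v \<in> verts" "\<alpha> \<in> mor"
  shows "fpath v * (fpath \<alpha> * ghost \<alpha>) \<sim> fpath \<alpha> * ghost \<alpha> * fpath v"
proof -
  let ?x = "fpath \<alpha> * ghost \<alpha>"
  have "fpath v * ?x \<sim> fpath v * (fpath (rng \<alpha>) * fpath \<alpha>) * ghost \<alpha>"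
    using kp_eq_mult_left[OF kp_eq_mult_right[OF kp_eq_units(1)[OF assms(2)], of "ghost \<alpha>"],
        of "fpath v", THEN kp_eq_sym] by (simp add: mult.assoc)
  also have "\<dots> = (fpath v * fpath (rng \<alpha>)) * ?x"
    by (simp add: mult.assoc)
  also have "\<dots> \<sim> ((if v = rng \<alpha> then fpath v else 0) * ?x)"
    using assms by (intro kp_eq_mult_right kp_eq_vert_mult Rng_vert)
  also have "\<dots> \<sim> (if v = rng \<alpha> then ?x else 0)"
    using assms by (auto simp: mult.assoc intro: kp_eq_mult_right[OF kp_eq_units(1), unfolded mult.assoc])
  also have "\<dots> \<sim> (?x * (if rng \<alpha> = v then fpath (rng \<alpha>) else 0))"
    using assms by (auto simp: mult.assoc intro: kp_eq_mult_left[OF kp_eq_units(4)] kp_eq_sym)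
  also have "\<dots> \<sim> ?x * (fpath (rng \<alpha>) * fpath v)"
    using assms by (intro kp_eq_mult_left kp_eq_sym[OF kp_eq_vert_mult] Rng_vert)
  also have "\<dots> = fpath \<alpha> * (ghost \<alpha> * fpath (rng \<alpha>)) * fpath v"
    by (simp add: mult.assoc)
  also have "\<dots> \<sim> ?x * fpath v"
    using assms by (intro kp_eq_mult_right kp_eq_mult_left kp_eq_units)
  finally show ?thesis .
qed

lemma kp_eq_vert_sum_idem:
  assumes "finite V" "V \<subseteq> verts"
  shows "((\<Sum>u\<in>V. fpath u) * (\<Sum>u\<in>V. fpath u)) \<sim> (\<Sum>u\<in>V. fpath u)"
proof -
  have "(\<Sum>v\<in>V. fpath v * (\<Sum>u\<in>V. fpath u)) \<sim> (\<Sum>v\<in>V. if v \<in> V then fpath v else 0)"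
    by (rule kp_eq_sum, rule kp_eq_vert_sum_mult(1)) (use assms in auto)
  then show ?thesis by (simp add: sum_distrib_right)
qed

text \<open>
  A finite sum of vertices that is a unit for the class determines which terms of
  \<^const>\<open>PX_left\<close> and \<^const>\<open>PX_right\<close> can be nonzero.
\<close>

lemma PX_class:
  fixes x :: "('m, 'f::field) kp_poly"
  assumes x: "x \<in> kp_aug \<Lambda>" and X: "X \<subseteq> verts" and V: "finite V" "V \<subseteq> verts"
  shows "((\<Sum>v\<in>V. fpath v) * x) \<sim> x \<Longrightarrow>
      PX_left \<Lambda> X (cls x) = cls ((\<Sum>v\<in>V \<inter> X. fpath v) * x)"
    and "(x * (\<Sum>v\<in>V. fpath v)) \<sim> x \<Longrightarrow>
      PX_right \<Lambda> X (cls x) = cls (x * (\<Sum>v\<in>V \<inter> X. fpath v))"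
proof -
  have restrict: "finsum (KP \<Lambda>) g {v \<in> X. g v \<noteq> \<zero>\<^bsub>KP \<Lambda>\<^esub>} = cls (sum f (V \<inter> X))"
    if g: "\<And>v. v \<in> X \<Longrightarrow> g v = cls (f v)" and f: "\<And>v. v \<in> X \<Longrightarrow> f v \<in> kp_aug \<Lambda>" and out: "\<And>v. v \<in> X \<Longrightarrow> v \<notin> V \<Longrightarrow> f v \<sim> 0"
    for f :: "'m \<Rightarrow> ('m, 'f) kp_poly" and g
  proof -
    let ?S = "{v \<in> X. g v \<noteq> \<zero>\<^bsub>KP \<Lambda>\<^esub>}"
    have S: "v \<in> ?S \<longleftrightarrow> \<not> f v \<sim> 0" if "v \<in> X" for v
      using that g[OF that] f[OF that] kp_class_eq_iff[OF _ zero_one_free_carrier(1), of "f v"]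
      by (simp add: KP_ops(4)[OF zero_one_free_carrier(1,1)] aug_carrier_closed)
    have sub: "?S \<subseteq> V \<inter> X" using S out by blast
    have "sum f (V \<inter> X) = sum f (V \<inter> X - ?S) + sum f ?S"
      using V by (intro sum.subset_diff[OF sub]) auto
    moreover have "sum f (V \<inter> X - ?S) \<sim> (\<Sum>v\<in>V \<inter> X - ?S. 0)"
      by (rule kp_eq_sum) (use S in auto)
    ultimately have "sum f ?S \<sim> sum f (V \<inter> X)"
      using kp_eq_add[of "sum f (V \<inter> X - ?S)" 0 "sum f ?S" "sum f ?S"] kp_eq_sym by simp
    then have "cls (sum f ?S) = cls (sum f (V \<inter> X))"
      by (subst kp_class_eq_iff) (auto intro!: aug_carrier_closed(1) aug_carrier_sum f)
    moreover have "finsum (KP \<Lambda>) g ?S = finsum (KP \<Lambda>) (\<lambda>v. cls (f v)) ?S"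
      by (rule abelian_monoid.finsum_cong'[OF KP_abelian_monoid])
        (auto simp: KP_carrier g intro!: imageI f)
    ultimately show ?thesis using KP_finsum[of ?S f] f by simp
  qed
  have v: "(fpath v :: ('m, 'f) kp_poly) \<in> kp_carrier \<Lambda>" if "v \<in> X" for v
    using that X by (auto intro!: fpath_carrier vert_Mor)
  {
    assume unit: "((\<Sum>v\<in>V. fpath v) * x) \<sim> x"
    have "fpath v * x \<sim> 0" if "v \<in> X" "v \<notin> V" for v
    proof -
      have "fpath v * x \<sim> (fpath v * (\<Sum>v\<in>V. fpath v) * x)"
        unfolding mult.assoc by (rule kp_eq_mult_left, rule kp_eq_sym, rule unit)
      also have "\<dots> \<sim> ((if v \<in> V then fpath v else 0) * x)"
        using that V X by (intro kp_eq_mult_right kp_eq_vert_sum_mult) auto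
      finally show ?thesis using that by simp
    qed
    then show "PX_left \<Lambda> X (cls x) = cls ((\<Sum>v\<in>V \<inter> X. fpath v) * x)"
      using x v unfolding PX_left_def kp_path_def sum_distrib_right
      by (intro restrict) (auto simp: KP_ops aug_carrier_closed)
  }
  {
    assume unit: "(x * (\<Sum>v\<in>V. fpath v)) \<sim> x"
    have "x * fpath v \<sim> 0" if "v \<in> X" "v \<notin> V" for v
    proof -
      have "x * fpath v \<sim> (x * (\<Sum>v\<in>V. fpath v) * fpath v)"
        by (rule kp_eq_mult_right, rule kp_eq_sym, rule unit)
      also have "\<dots> \<sim> (x * (if v \<in> V then fpath v else 0))"
        unfolding mult.assoc using that V X by (intro kp_eq_mult_left kp_eq_vert_sum_mult) auto
      finally show ?thesis using that by simp
    qed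
    then show "PX_right \<Lambda> X (cls x) = cls (x * (\<Sum>v\<in>V \<inter> X. fpath v))"
      using x v unfolding PX_right_def kp_path_def sum_distrib_left
      by (intro restrict) (auto simp: KP_ops aug_carrier_closed)
  }
qed

end

section \<open>Discrete fibrations of k-graphs\<close>

text \<open>
  A right action of \<Lambda> on the sets \<open>fib v\<close>, and \<Gamma> presented as its category of elements: \<open>lift \<alpha> i\<close>
  is the morphism over \<alpha> with index \<open>i\<close> at the range, and \<open>act \<alpha> i\<close> is its index at the source.
\<close>

locale kgraph_fibration = k_graph \<Lambda>
  for \<Lambda> :: "('m, 'k::finite) kgraph" +
  fixes \<Gamma> :: "('n, 'k) kgraph"
    and fib :: "'m \<Rightarrow> 'i::countable set"
    and act :: "'m \<Rightarrow> 'i \<Rightarrow> 'i"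
    and lift :: "'m \<Rightarrow> 'i \<Rightarrow> 'n"
  assumes act_closed: "\<lbrakk>\<alpha> \<in> mor; i \<in> fib (rng \<alpha>)\<rbrakk> \<Longrightarrow> act \<alpha> i \<in> fib (src \<alpha>)"
    and act_vert: "\<lbrakk>v \<in> verts; i \<in> fib v\<rbrakk> \<Longrightarrow> act v i = i"
    and act_Cmp: "\<lbrakk>\<alpha> \<in> mor; \<mu> \<in> mor; src \<alpha> = rng \<mu>; i \<in> fib (rng \<alpha>)\<rbrakk>
      \<Longrightarrow> act (cmp \<alpha> \<mu>) i = act \<mu> (act \<alpha> i)"
    and Mor_total: "Mor \<Gamma> = {lift \<alpha> i | \<alpha> i. \<alpha> \<in> mor \<and> i \<in> fib (rng \<alpha>)}"
    and lift_inject: "\<lbrakk>\<alpha> \<in> mor; i \<in> fib (rng \<alpha>); \<mu> \<in> mor; j \<in> fib (rng \<mu>); lift \<alpha> i = lift \<mu> j\<rbrakk>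
      \<Longrightarrow> \<alpha> = \<mu> \<and> i = j"
    and Deg_lift: "\<lbrakk>\<alpha> \<in> mor; i \<in> fib (rng \<alpha>)\<rbrakk> \<Longrightarrow> Deg \<Gamma> (lift \<alpha> i) = deg \<alpha>"
    and Rng_lift: "\<lbrakk>\<alpha> \<in> mor; i \<in> fib (rng \<alpha>)\<rbrakk> \<Longrightarrow> Rng \<Gamma> (lift \<alpha> i) = lift (rng \<alpha>) i"
    and Src_lift: "\<lbrakk>\<alpha> \<in> mor; i \<in> fib (rng \<alpha>)\<rbrakk> \<Longrightarrow> Src \<Gamma> (lift \<alpha> i) = lift (src \<alpha>) (act \<alpha> i)"
    and Cmp_lift: "\<lbrakk>\<alpha> \<in> mor; \<mu> \<in> mor; src \<alpha> = rng \<mu>; i \<in> fib (rng \<alpha>)\<rbrakk>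
      \<Longrightarrow> Cmp \<Gamma> (lift \<alpha> i) (lift \<mu> (act \<alpha> i)) = lift (cmp \<alpha> \<mu>) i"
begin

abbreviation kp_approx (infix "\<approx>" 50) where "x \<approx> y \<equiv> kp_eq \<Gamma> x y"

lemma lift_eq_iff:
  "\<lbrakk>\<alpha> \<in> mor; i \<in> fib (rng \<alpha>); \<mu> \<in> mor; j \<in> fib (rng \<mu>)\<rbrakk> \<Longrightarrow> lift \<alpha> i = lift \<mu> j \<longleftrightarrow> \<alpha> = \<mu> \<and> i = j"
  using lift_inject by blast

lemma Mor_totalE:
  assumes "\<gamma> \<in> Mor \<Gamma>"
  obtains \<alpha> i where "\<gamma> = lift \<alpha> i" "\<alpha> \<in> mor" "i \<in> fib (rng \<alpha>)"
  using assms Mor_total by blast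

lemma lift_Mor: "\<alpha> \<in> mor \<Longrightarrow> i \<in> fib (rng \<alpha>) \<Longrightarrow> lift \<alpha> i \<in> Mor \<Gamma>"
  using Mor_total by blast

lemma fib_Rng_Src: "\<alpha> \<in> mor \<Longrightarrow> i \<in> fib (rng \<alpha>) \<Longrightarrow> act \<alpha> i \<in> fib (rng (src \<alpha>))"
  and fib_Rng_Rng: "\<alpha> \<in> mor \<Longrightarrow> i \<in> fib (rng \<alpha>) \<Longrightarrow> i \<in> fib (rng (rng \<alpha>))"
  by (simp_all add: Rng_Src Rng_Rng act_closed)

lemma composable_totalE:
  assumes "\<gamma> \<in> Mor \<Gamma>" "\<delta> \<in> Mor \<Gamma>" "Src \<Gamma> \<gamma> = Rng \<Gamma> \<delta>"
  obtains \<alpha> i \<mu> where "\<gamma> = lift \<alpha> i" "\<delta> = lift \<mu> (act \<alpha> i)" "\<alpha> \<in> mor" "\<mu> \<in> mor"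
    "i \<in> fib (rng \<alpha>)" "src \<alpha> = rng \<mu>"
proof -
  obtain \<alpha> i \<mu> j where *: "\<gamma> = lift \<alpha> i" "\<delta> = lift \<mu> j" "\<alpha> \<in> mor" "\<mu> \<in> mor"
    "i \<in> fib (rng \<alpha>)" "j \<in> fib (rng \<mu>)"
    using assms(1,2) by (elim Mor_totalE)
  then have "src \<alpha> = rng \<mu> \<and> act \<alpha> i = j"
    using assms(3) by (intro lift_inject) (simp_all add: Src_lift Rng_lift Src_closed Rng_closed fib_Rng_Src fib_Rng_Rng)
  with * that show ?thesis by blast
qed

text \<open>
  A factorisation of a lift lies over a factorisation of \<alpha> in \<Lambda>. Its first factor inherits the index
  of the lift, and composability then forces the index of the second factor.
\<close>

lemma kgraph_total: "k_graph \<Gamma>"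
proof
  have "Mor \<Gamma> = (\<lambda>(\<alpha>, i). lift \<alpha> i) ` (SIGMA \<alpha>:mor. fib (rng \<alpha>))"
    unfolding Mor_total by auto
  moreover have "countable (SIGMA \<alpha>:mor. fib (rng \<alpha>))"
    using countable_Mor by (intro countable_SIGMA) auto
  ultimately show "countable (Mor \<Gamma>)" by simp
  note simps = lift_Mor Src_lift Rng_lift Cmp_lift Deg_lift Src_closed Rng_closed fib_Rng_Src fib_Rng_Rng
    Src_Src Rng_Src Src_Rng Rng_Rng act_closed Src_vert Rng_vert act_vert Cmp_closed Rng_Cmp Src_Cmp
    Deg_Src Deg_Rng Deg_Cmp act_Cmp
  fix \<alpha> assume a: "\<alpha> \<in> Mor \<Gamma>"
  then obtain \<alpha>0 i where \<alpha>: "\<alpha> = lift \<alpha>0 i" "\<alpha>0 \<in> mor" "i \<in> fib (rng \<alpha>0)" by (rule Mor_totalE)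
  show "Src \<Gamma> \<alpha> \<in> Mor \<Gamma>" "Rng \<Gamma> \<alpha> \<in> Mor \<Gamma>" "Src \<Gamma> (Src \<Gamma> \<alpha>) = Src \<Gamma> \<alpha>" "Rng \<Gamma> (Src \<Gamma> \<alpha>) = Src \<Gamma> \<alpha>"
    "Src \<Gamma> (Rng \<Gamma> \<alpha>) = Rng \<Gamma> \<alpha>" "Rng \<Gamma> (Rng \<Gamma> \<alpha>) = Rng \<Gamma> \<alpha>" "Deg \<Gamma> (Src \<Gamma> \<alpha>) = 0"
    using \<alpha> by (simp_all add: simps)
  show "Cmp \<Gamma> \<alpha> (Src \<Gamma> \<alpha>) = \<alpha>"
    using \<alpha> Cmp_lift[of \<alpha>0 "src \<alpha>0" i] by (simp add: simps Cmp_Src)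
  show "Cmp \<Gamma> (Rng \<Gamma> \<alpha>) \<alpha> = \<alpha>"
    using \<alpha> Cmp_lift[of "rng \<alpha>0" \<alpha>0 i] by (simp add: simps Cmp_Rng)
  {
    fix \<mu> assume m: "\<mu> \<in> Mor \<Gamma>" "Src \<Gamma> \<alpha> = Rng \<Gamma> \<mu>"
    from a m obtain \<alpha>0 i \<mu>0 where \<alpha>: "\<alpha> = lift \<alpha>0 i" "\<mu> = lift \<mu>0 (act \<alpha>0 i)" "\<alpha>0 \<in> mor" "\<mu>0 \<in> mor"
      "i \<in> fib (rng \<alpha>0)" "src \<alpha>0 = rng \<mu>0" by (rule composable_totalE)
    then have j: "act \<alpha>0 i \<in> fib (rng \<mu>0)" using act_closed[of \<alpha>0 i] by simp
    show "Cmp \<Gamma> \<alpha> \<mu> \<in> Mor \<Gamma>" "Rng \<Gamma> (Cmp \<Gamma> \<alpha> \<mu>) = Rng \<Gamma> \<alpha>" "Src \<Gamma> (Cmp \<Gamma> \<alpha> \<mu>) = Src \<Gamma> \<mu>"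
      "Deg \<Gamma> (Cmp \<Gamma> \<alpha> \<mu>) = Deg \<Gamma> \<alpha> + Deg \<Gamma> \<mu>"
      using \<alpha> j by (simp_all add: simps)
    fix \<nu> assume n: "\<nu> \<in> Mor \<Gamma>" "Src \<Gamma> \<mu> = Rng \<Gamma> \<nu>"
    from m(1) n obtain \<mu>1 j \<nu>0 where \<nu>: "\<mu> = lift \<mu>1 j" "\<nu> = lift \<nu>0 (act \<mu>1 j)" "\<mu>1 \<in> mor" "\<nu>0 \<in> mor"
      "j \<in> fib (rng \<mu>1)" "src \<mu>1 = rng \<nu>0" by (rule composable_totalE)
    have "\<mu>1 = \<mu>0" "j = act \<alpha>0 i"
      using \<alpha> \<nu> j lift_inject[of \<mu>1 j \<mu>0 "act \<alpha>0 i"] by auto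
    with \<alpha> \<nu> j show "Cmp \<Gamma> (Cmp \<Gamma> \<alpha> \<mu>) \<nu> = Cmp \<Gamma> \<alpha> (Cmp \<Gamma> \<mu> \<nu>)"
      using Cmp_lift[of "cmp \<alpha>0 \<mu>0" \<nu>0 i] Cmp_lift[of \<alpha>0 "cmp \<mu>0 \<nu>0" i]
      by (simp add: simps Cmp_assoc)
  }
  fix m n assume "Deg \<Gamma> \<alpha> = m + n"
  then have "deg \<alpha>0 = m + n" using \<alpha> by (simp add: Deg_lift)
  with \<alpha>(2) obtain \<mu> \<nu> where f: "\<mu> \<in> mor" "\<nu> \<in> mor" "src \<mu> = rng \<nu>" "\<alpha>0 = cmp \<mu> \<nu>"
    "deg \<mu> = m" "deg \<nu> = n" by (rule factorise)
  have i: "i \<in> fib (rng \<mu>)" "act \<mu> i \<in> fib (rng \<nu>)"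
    using \<alpha>(3) f act_closed[of \<mu> i] by (simp_all add: Rng_Cmp)
  show "\<exists>!p. case p of (\<mu>, \<nu>) \<Rightarrow> \<mu> \<in> Mor \<Gamma> \<and> \<nu> \<in> Mor \<Gamma> \<and> Src \<Gamma> \<mu> = Rng \<Gamma> \<nu> \<and>
    \<alpha> = Cmp \<Gamma> \<mu> \<nu> \<and> Deg \<Gamma> \<mu> = m \<and> Deg \<Gamma> \<nu> = n"
  proof (rule ex1I[of _ "(lift \<mu> i, lift \<nu> (act \<mu> i))"], goal_cases)
    case 1
    show ?case using \<alpha> f i by (simp add: simps)
  next
    case (2 p)
    obtain \<gamma> \<delta> where p: "p = (\<gamma>, \<delta>)" by (cases p)
    with 2 have d: "\<gamma> \<in> Mor \<Gamma>" "\<delta> \<in> Mor \<Gamma>" "Src \<Gamma> \<gamma> = Rng \<Gamma> \<delta>" "\<alpha> = Cmp \<Gamma> \<gamma> \<delta>" "Deg \<Gamma> \<gamma> = m" by auto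
    from d(1-3) obtain \<mu>' j \<nu>' where g: "\<gamma> = lift \<mu>' j" "\<delta> = lift \<nu>' (act \<mu>' j)" "\<mu>' \<in> mor" "\<nu>' \<in> mor"
      "j \<in> fib (rng \<mu>')" "src \<mu>' = rng \<nu>'" by (rule composable_totalE)
    have "lift \<alpha>0 i = lift (cmp \<mu>' \<nu>') j" using d(4) g \<alpha>(1) by (simp add: Cmp_lift)
    then have e: "\<alpha>0 = cmp \<mu>' \<nu>' \<and> i = j"
      using g \<alpha> by (intro lift_inject) (simp_all add: Cmp_closed Rng_Cmp)
    have "\<mu>' = \<mu> \<and> \<nu>' = \<nu>"
      using g f e d(5) by (intro factorisation_unique) (simp_all add: Deg_lift)
    with g e p show ?case by simp
  qed
qed

end

sublocale kgraph_fibration \<subseteq> total: k_graph \<Gamma>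
  by (rule kgraph_total)

context kgraph_fibration
begin

lemma kg_verts_total: "kg_verts \<Gamma> = {lift v i | v i. v \<in> verts \<and> i \<in> fib v}"
proof (intro equalityI subsetI)
  fix x assume "x \<in> kg_verts \<Gamma>"
  then have "x \<in> Mor \<Gamma>" "Deg \<Gamma> x = 0" by (auto simp: kg_verts_def)
  then obtain v i where "x = lift v i" "v \<in> mor" "i \<in> fib (rng v)" "deg v = 0"
    by (metis Mor_totalE Deg_lift)
  then show "x \<in> {lift v i | v i. v \<in> verts \<and> i \<in> fib v}"
    using Rng_of_vert[of v] by (auto simp: kg_verts_def)
qed (auto simp: kg_verts_def Deg_lift lift_Mor Rng_of_vert)

lemma lift_vert: "v \<in> verts \<Longrightarrow> i \<in> fib v \<Longrightarrow> lift v i \<in> kg_verts \<Gamma>"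
  using kg_verts_total by blast

text \<open>
  The property that makes \<Gamma> a discrete fibration: a path of \<Lambda> has exactly one lift with a given index
  at its range.
\<close>

lemma paths_into_total:
  assumes "v \<in> verts" "i \<in> fib v"
  shows "paths_into \<Gamma> (lift v i) n = (\<lambda>\<alpha>. lift \<alpha> i) ` paths_into \<Lambda> v n"
proof (intro equalityI subsetI)
  fix \<gamma> assume "\<gamma> \<in> paths_into \<Gamma> (lift v i) n"
  then have g: "\<gamma> \<in> Mor \<Gamma>" "Deg \<Gamma> \<gamma> = n" "Rng \<Gamma> \<gamma> = lift v i" by (auto simp: paths_into_def)
  from g(1) obtain \<alpha> j where \<alpha>: "\<gamma> = lift \<alpha> j" "\<alpha> \<in> mor" "j \<in> fib (rng \<alpha>)" by (rule Mor_totalE)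
  then have "rng \<alpha> = v \<and> j = i"
    using g(3) assms by (intro lift_inject) (simp_all add: Rng_lift Rng_closed fib_Rng_Rng vert_Mor Rng_of_vert)
  with \<alpha> g(2) show "\<gamma> \<in> (\<lambda>\<alpha>. lift \<alpha> i) ` paths_into \<Lambda> v n"
    by (auto simp: paths_into_def Deg_lift)
qed (use assms in \<open>auto simp: paths_into_def lift_Mor Deg_lift Rng_lift\<close>)

abbreviation t :: "'m \<Rightarrow> 'i \<Rightarrow> ('n, 'f::field) kp_poly" where
  "t \<alpha> i \<equiv> fpath (lift \<alpha> i)"

abbreviation ts :: "'m \<Rightarrow> 'i \<Rightarrow> ('n, 'f::field) kp_poly" where
  "ts \<alpha> i \<equiv> fghost \<Gamma> (lift \<alpha> i)"

lemma t_mult: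
  assumes "\<alpha> \<in> mor" "\<mu> \<in> mor" "src \<alpha> = rng \<mu>" "i \<in> fib (rng \<alpha>)"
  shows "t \<alpha> i * t \<mu> (act \<alpha> i) \<approx> t (cmp \<alpha> \<mu>) i"
    and "ts \<mu> (act \<alpha> i) * ts \<alpha> i \<approx> ts (cmp \<alpha> \<mu>) i"
  using total.kp_eq_path_mult[of "lift \<alpha> i" "lift \<mu> (act \<alpha> i)"] act_closed[of \<alpha> i] assms
  by (simp_all add: lift_Mor Src_lift Rng_lift Cmp_lift)

lemma ts_t:
  assumes "\<alpha> \<in> mor" "\<mu> \<in> mor" "deg \<alpha> = deg \<mu>" "i \<in> fib (rng \<alpha>)" "j \<in> fib (rng \<mu>)"
  shows "ts \<alpha> i * t \<mu> j \<approx> (if \<alpha> = \<mu> \<and> i = j then t (src \<alpha>) (act \<alpha> i) else 0)"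
  using total.kp_eq_ghost_path[of "lift \<alpha> i" "lift \<mu> j"] assms
  by (cases "\<alpha> = \<mu> \<and> i = j") (auto simp: lift_Mor Src_lift Deg_lift lift_eq_iff)

lemma t_units:
  assumes "\<alpha> \<in> mor" "i \<in> fib (rng \<alpha>)"
  shows "t (rng \<alpha>) i * t \<alpha> i \<approx> t \<alpha> i"
    and "t \<alpha> i * t (src \<alpha>) (act \<alpha> i) \<approx> t \<alpha> i"
    and "t (src \<alpha>) (act \<alpha> i) * ts \<alpha> i \<approx> ts \<alpha> i"
    and "ts \<alpha> i * t (rng \<alpha>) i \<approx> ts \<alpha> i"
  using total.kp_eq_units[of "lift \<alpha> i"] assms by (simp_all add: lift_Mor Src_lift Rng_lift)

lemma t_vert_sum:
  assumes "v \<in> verts" "i \<in> fib v" "n \<noteq> 0"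
  shows "(\<Sum>\<alpha>\<in>paths_into \<Lambda> v n. t \<alpha> i * ts \<alpha> i) \<approx> t v i"
proof -
  have "inj_on (\<lambda>\<alpha>. lift \<alpha> i) (paths_into \<Lambda> v n)"
    using assms lift_inject by (auto simp: inj_on_def paths_into_def)
  then show ?thesis
    using total.kp_eq_vert_sum[of "lift v i" n] assms
    by (simp add: paths_into_total lift_vert sum.reindex)
qed

end

section \<open>Matrix units over a synchronised fibration\<close>

text \<open>
  Morphisms of degree \<open>B = basis_deg b\<close> forget the index at their range. The index \<open>pt\<close> is common to all
  fibres, and the vertices \<open>lift v pt\<close> cut out the corner.
\<close>

locale synchronised_fibration = kgraph_fibration \<Lambda> \<Gamma> fib act lift
  for \<Lambda> :: "('m, 'k::finite) kgraph" and \<Gamma> :: "('n, 'k) kgraph"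
    and fib :: "'m \<Rightarrow> 'i::countable set" and act lift +
  fixes b :: 'k and pt :: 'i
  assumes row_finite: "row_finite \<Lambda>"
    and synchronising: "\<lbrakk>\<alpha> \<in> mor; deg \<alpha> = basis_deg b; i \<in> fib (rng \<alpha>); j \<in> fib (rng \<alpha>)\<rbrakk>
      \<Longrightarrow> act \<alpha> i = act \<alpha> j"
    and pt_fib: "v \<in> verts \<Longrightarrow> pt \<in> fib v"
begin

abbreviation into_B :: "'m \<Rightarrow> 'm set" where
  "into_B v \<equiv> paths_into \<Lambda> v (basis_deg b)"

lemma basis_deg_nonzero: "(basis_deg b :: nat ^ 'k) \<noteq> 0"
  by (simp add: axis_eq_0_iff)

lemma finite_into_B: "\<alpha> \<in> mor \<Longrightarrow> finite (into_B (src \<alpha>))"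
  using finite_paths_into[OF row_finite] Src_vert by blast

lemma into_B_D: "\<phi> \<in> into_B v \<Longrightarrow> \<phi> \<in> mor" "\<phi> \<in> into_B v \<Longrightarrow> deg \<phi> = basis_deg b" "\<phi> \<in> into_B v \<Longrightarrow> rng \<phi> = v"
  by (simp_all add: paths_into_def)

text \<open>
  For vertices, \<open>munit i v v j\<close> is a matrix unit between the copies of \<open>v\<close> with indices \<open>i\<close> and \<open>j\<close>. In
  general it is, modulo the relations, the lift of \<alpha> with index \<open>i\<close>, times the matrix unit at the common source of \<alpha> and \<mu>
  that compares \<open>act \<alpha> i\<close> with \<open>act \<mu> j\<close>, times the ghost of the lift of \<mu> with index \<open>j\<close>. The
  factors in the sum are composable since \<phi> forgets its index.
\<close>

definition munit :: "'i \<Rightarrow> 'm \<Rightarrow> 'm \<Rightarrow> 'i \<Rightarrow> ('n, 'f::field) kp_poly" where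
  "munit i \<alpha> \<mu> j = (\<Sum>\<phi>\<in>into_B (src \<alpha>). t (cmp \<alpha> \<phi>) i * ts (cmp \<mu> \<phi>) j)"

lemma act_Cmp_sync:
  assumes "\<alpha> \<in> mor" "i \<in> fib (rng \<alpha>)" "\<phi> \<in> into_B (src \<alpha>)" "j \<in> fib (rng \<phi>)"
  shows "act (cmp \<alpha> \<phi>) i = act \<phi> j"
  using assms synchronising[of \<phi> "act \<alpha> i" j] act_closed[of \<alpha> i]
  by (auto simp: paths_into_def act_Cmp)

text \<open>
  The path \<gamma> starts with a path of degree \<open>B\<close>. The ghost of \<phi> cancels it if it is \<phi>, and annihilates it
  otherwise. After cancellation the remaining factors have matching indices because \<phi> forgets its index.
\<close>

lemma ts_mult_t_absorb:
  assumes \<alpha>: "\<alpha> \<in> mor" "i \<in> fib (rng \<alpha>)" and \<phi>: "\<phi> \<in> into_B (src \<alpha>)"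
    and \<gamma>: "\<gamma> \<in> mor" "rng \<gamma> = src \<alpha>" "deg \<gamma> = basis_deg b + n" and j: "j \<in> fib (rng \<gamma>)"
  shows "t (cmp \<alpha> \<phi>) i * (ts \<phi> j * t \<gamma> j)
      \<approx> (if \<phi> = prefix_of \<Lambda> (basis_deg b) \<gamma> then t (cmp \<alpha> \<gamma>) i else 0)"
    and "(ts \<gamma> j * t \<phi> j) * ts (cmp \<alpha> \<phi>) i
      \<approx> (if \<phi> = prefix_of \<Lambda> (basis_deg b) \<gamma> then ts (cmp \<alpha> \<gamma>) i else 0)"
proof -
  from \<gamma>(1,3) obtain \<psi> \<eta> where f: "\<psi> \<in> mor" "\<eta> \<in> mor" "src \<psi> = rng \<eta>" "\<gamma> = cmp \<psi> \<eta>"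
    "deg \<psi> = basis_deg b" by (rule factorise)
  then have pre: "prefix_of \<Lambda> (basis_deg b) \<gamma> = \<psi>" using prefix_of_Cmp[of \<psi> \<eta>] by simp
  have r: "rng \<psi> = src \<alpha>" using f \<gamma>(2) by (simp add: Rng_Cmp)
  note \<phi>' = into_B_D[OF \<phi>]
  have j': "j \<in> fib (rng \<psi>)" "j \<in> fib (rng \<phi>)" using j r \<gamma>(2) \<phi>' by auto
  have ij: "act (cmp \<alpha> \<phi>) i = act \<phi> j" using act_Cmp_sync[OF \<alpha> \<phi>] j' by simp
  have i: "i \<in> fib (rng (cmp \<alpha> \<phi>))" using \<alpha> \<phi>' by (simp add: Rng_Cmp)
  have C: "cmp \<alpha> \<phi> \<in> mor" "src (cmp \<alpha> \<phi>) = src \<phi>" using \<alpha> \<phi>' by (simp_all add: Cmp_closed Src_Cmp)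
  have a\<gamma>: "cmp (cmp \<alpha> \<phi>) \<eta> = cmp \<alpha> \<gamma>" if "\<phi> = \<psi>" using that f \<alpha> r by (simp add: Cmp_assoc)
  have actj: "act \<psi> j \<in> fib (rng \<eta>)" using act_closed[OF f(1) j'(1)] f by simp
  have "t (cmp \<alpha> \<phi>) i * (ts \<phi> j * t \<gamma> j) \<approx> t (cmp \<alpha> \<phi>) i * (ts \<phi> j * (t \<psi> j * t \<eta> (act \<psi> j)))"
    unfolding f(4) using f j' by (intro total.kp_eq_mult_left total.kp_eq_sym[OF t_mult(1)])
  also have "\<dots> = t (cmp \<alpha> \<phi>) i * (ts \<phi> j * t \<psi> j) * t \<eta> (act \<psi> j)"
    by (simp add: mult.assoc)
  also have "\<dots> \<approx> (t (cmp \<alpha> \<phi>) i * (if \<phi> = \<psi> \<and> j = j then t (src \<phi>) (act \<phi> j) else 0) * t \<eta> (act \<psi> j))"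
    using f \<phi>' j' by (intro total.kp_eq_mult_left total.kp_eq_mult_right ts_t) simp_all
  also have "\<dots> \<approx> (if \<phi> = \<psi> then t (cmp \<alpha> \<gamma>) i else 0)"
  proof (cases "\<phi> = \<psi>")
    case True
    have "t (cmp \<alpha> \<phi>) i * t (src \<phi>) (act \<phi> j) * t \<eta> (act \<psi> j) \<approx> t (cmp \<alpha> \<phi>) i * t \<eta> (act \<psi> j)"
      using t_units(2)[OF C(1) i] C ij by (intro total.kp_eq_mult_right) simp
    also have "\<dots> \<approx> t (cmp \<alpha> \<gamma>) i"
      using t_mult(1)[OF C(1) f(2) _ i] C ij True f a\<gamma> by simp
    finally show ?thesis using True by simp
  qed simp
  finally show "t (cmp \<alpha> \<phi>) i * (ts \<phi> j * t \<gamma> j)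
      \<approx> (if \<phi> = prefix_of \<Lambda> (basis_deg b) \<gamma> then t (cmp \<alpha> \<gamma>) i else 0)"
    unfolding pre .
  have "(ts \<gamma> j * t \<phi> j) * ts (cmp \<alpha> \<phi>) i \<approx> ((ts \<eta> (act \<psi> j) * ts \<psi> j) * t \<phi> j) * ts (cmp \<alpha> \<phi>) i"
    unfolding f(4) using f j' by (intro total.kp_eq_mult_right total.kp_eq_sym[OF t_mult(2)])
  also have "\<dots> = ts \<eta> (act \<psi> j) * (ts \<psi> j * t \<phi> j) * ts (cmp \<alpha> \<phi>) i"
    by (simp add: mult.assoc)
  also have "\<dots> \<approx> (ts \<eta> (act \<psi> j) * (if \<psi> = \<phi> \<and> j = j then t (src \<psi>) (act \<psi> j) else 0) * ts (cmp \<alpha> \<phi>) i)"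
    using f \<phi>' j' by (intro total.kp_eq_mult_left total.kp_eq_mult_right ts_t) simp_all
  also have "\<dots> \<approx> (if \<phi> = \<psi> then ts (cmp \<alpha> \<gamma>) i else 0)"
  proof (cases "\<phi> = \<psi>")
    case True
    have "ts \<eta> (act \<psi> j) * t (src \<psi>) (act \<psi> j) * ts (cmp \<alpha> \<phi>) i \<approx> ts \<eta> (act \<psi> j) * ts (cmp \<alpha> \<phi>) i"
      using t_units(3)[OF C(1) i] C ij True unfolding mult.assoc by (intro total.kp_eq_mult_left) simp
    also have "\<dots> \<approx> ts (cmp \<alpha> \<gamma>) i"
      using t_mult(2)[OF C(1) f(2) _ i] C ij True f a\<gamma> by simp
    finally show ?thesis using True by auto
  qed auto
  finally show "(ts \<gamma> j * t \<phi> j) * ts (cmp \<alpha> \<phi>) i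
      \<approx> (if \<phi> = prefix_of \<Lambda> (basis_deg b) \<gamma> then ts (cmp \<alpha> \<gamma>) i else 0)"
    unfolding pre .
qed

text \<open>
  Composition with a path: in the product of the two sums only those terms survive in which the first
  factor of \<open>cmp \<mu> \<xi>\<close> of degree \<open>B\<close> is the summation variable of the other sum.
\<close>

lemma munit_mult_path:
  assumes "\<alpha> \<in> mor" "\<mu> \<in> mor" "\<nu> \<in> mor" "src \<alpha> = rng \<mu>" "src \<mu> = src \<nu>"
    and "i \<in> fib (rng \<alpha>)" "j \<in> fib (rng \<mu>)"
  shows "munit i \<alpha> (rng \<mu>) j * munit j \<mu> \<nu> l \<approx> munit i (cmp \<alpha> \<mu>) \<nu> l"
    and "munit l \<nu> \<mu> j * munit j (rng \<mu>) \<alpha> i \<approx> munit l \<nu> (cmp \<alpha> \<mu>) i"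
proof -
  let ?p = "\<lambda>\<xi>. prefix_of \<Lambda> (basis_deg b) (cmp \<mu> \<xi>)"
  have \<gamma>: "cmp \<mu> \<xi> \<in> mor" "rng (cmp \<mu> \<xi>) = src \<alpha>" "deg (cmp \<mu> \<xi>) = basis_deg b + deg \<mu>"
    "cmp \<alpha> (cmp \<mu> \<xi>) = cmp (cmp \<alpha> \<mu>) \<xi>" "j \<in> fib (rng (cmp \<mu> \<xi>))"
    if "\<xi> \<in> into_B (src \<mu>)" for \<xi>
    using that assms by (auto simp: paths_into_def Cmp_closed Rng_Cmp Deg_Cmp add.commute Cmp_assoc)
  have pre: "?p \<xi> \<in> into_B (src \<alpha>) " if "\<xi> \<in> into_B (src \<mu>)" for \<xi>
  proof -
    note * = \<gamma>(1,2,3,5)[OF that]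
    from *(1,3) obtain \<psi> \<eta> where "\<psi> \<in> mor" "\<eta> \<in> mor" "src \<psi> = rng \<eta>"
      "cmp \<mu> \<xi> = cmp \<psi> \<eta>" "deg \<psi> = basis_deg b" by (rule factorise)
    then show ?thesis
      using prefix_of_Cmp[of \<psi> \<eta>] *(2) by (simp add: paths_into_def Rng_Cmp)
  qed
  have vert: "cmp (rng \<mu>) \<phi> = \<phi>" if "\<phi> \<in> into_B (src \<alpha>)" for \<phi>
    using that assms Cmp_Rng[of \<phi>] by (simp add: paths_into_def)
  have src: "src (rng \<mu>) = src \<alpha>" "src (cmp \<alpha> \<mu>) = src \<mu>"
    using assms by (simp_all add: Src_Rng Src_Cmp)
  have "munit i \<alpha> (rng \<mu>) j * munit j \<mu> \<nu> l =
      (\<Sum>\<xi>\<in>into_B (src \<mu>). \<Sum>\<phi>\<in>into_B (src \<alpha>). t (cmp \<alpha> \<phi>) i * (ts \<phi> j * t (cmp \<mu> \<xi>) j) * ts (cmp \<nu> \<xi>) l)"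
    unfolding munit_def by (simp add: sum_product vert mult.assoc cong: sum.cong) (rule sum.swap)
  also have "\<dots> \<approx> (\<Sum>\<xi>\<in>into_B (src \<mu>). \<Sum>\<phi>\<in>into_B (src \<alpha>).
      (if \<phi> = ?p \<xi> then t (cmp \<alpha> (cmp \<mu> \<xi>)) i else 0) * ts (cmp \<nu> \<xi>) l)"
    using \<gamma> by (intro total.kp_eq_sum total.kp_eq_mult_right) (rule ts_mult_t_absorb(1)[OF assms(1,6)]; simp)
  also have "\<dots> = munit i (cmp \<alpha> \<mu>) \<nu> l"
    unfolding munit_def src by (intro sum.cong refl)
      (simp add: if_distrib[of "\<lambda>x. x * _"] finite_into_B[OF assms(1), simplified] pre[simplified] \<gamma>(4) cong: if_cong)
  finally show "munit i \<alpha> (rng \<mu>) j * munit j \<mu> \<nu> l \<approx> munit i (cmp \<alpha> \<mu>) \<nu> l" .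
  have "munit l \<nu> \<mu> j * munit j (rng \<mu>) \<alpha> i =
      (\<Sum>\<xi>\<in>into_B (src \<mu>). \<Sum>\<phi>\<in>into_B (src \<alpha>). t (cmp \<nu> \<xi>) l * ((ts (cmp \<mu> \<xi>) j * t \<phi> j) * ts (cmp \<alpha> \<phi>) i))"
    unfolding munit_def src assms(5)[symmetric] by (simp add: sum_product vert mult.assoc cong: sum.cong)
  also have "\<dots> \<approx> (\<Sum>\<xi>\<in>into_B (src \<mu>). \<Sum>\<phi>\<in>into_B (src \<alpha>).
      t (cmp \<nu> \<xi>) l * (if \<phi> = ?p \<xi> then ts (cmp \<alpha> (cmp \<mu> \<xi>)) i else 0))"
    using \<gamma> by (intro total.kp_eq_sum total.kp_eq_mult_left) (rule ts_mult_t_absorb(2)[OF assms(1,6)]; simp)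
  also have "\<dots> = munit l \<nu> (cmp \<alpha> \<mu>) i"
    unfolding munit_def assms(5)[symmetric] by (intro sum.cong refl)
      (simp add: if_distrib[of "\<lambda>x. _ * x"] finite_into_B[OF assms(1), simplified] pre[simplified] \<gamma>(4) cong: if_cong)
  finally show "munit l \<nu> \<mu> j * munit j (rng \<mu>) \<alpha> i \<approx> munit l \<nu> (cmp \<alpha> \<mu>) i" .
qed

text \<open>
  Matrix multiplication: lifts of equal degree that differ are orthogonal.
\<close>

lemma munit_mult:
  assumes "\<alpha> \<in> mor" "\<mu> \<in> mor" "\<mu>' \<in> mor" "\<nu> \<in> mor" "src \<alpha> = src \<mu>" "src \<mu>' = src \<nu>"
    and "deg \<mu> = deg \<mu>'"
    and "i \<in> fib (rng \<alpha>)" "j \<in> fib (rng \<mu>)" "j' \<in> fib (rng \<mu>')"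
  shows "munit i \<alpha> \<mu> j * munit j' \<mu>' \<nu> l \<approx> (if \<mu> = \<mu>' \<and> j = j' then munit i \<alpha> \<nu> l else 0)"
proof -
  have m: "cmp \<mu> \<phi> \<in> mor" "rng (cmp \<mu> \<phi>) = rng \<mu>" "deg (cmp \<mu> \<phi>) = deg \<mu> + basis_deg b"
    if "\<mu> \<in> mor" "\<phi> \<in> into_B (src \<mu>)" for \<mu> \<phi>
    using that by (auto simp: paths_into_def Cmp_closed Rng_Cmp Deg_Cmp)
  have product: "t (cmp \<alpha> \<phi>) i * (ts (cmp \<mu> \<phi>) j * t (cmp \<mu>' \<xi>) j') * ts (cmp \<nu> \<xi>) l
      \<approx> (if \<phi> = \<xi> \<and> \<mu> = \<mu>' \<and> j = j' then t (cmp \<alpha> \<phi>) i * ts (cmp \<nu> \<phi>) l else 0)"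
    if \<phi>: "\<phi> \<in> into_B (src \<alpha>)" and \<xi>: "\<xi> \<in> into_B (src \<mu>')" for \<phi> \<xi>
  proof -
    have \<phi>m: "\<phi> \<in> into_B (src \<mu>)" using \<phi> assms by simp
    have "cmp \<mu> \<phi> = cmp \<mu>' \<xi> \<longleftrightarrow> \<mu> = \<mu>' \<and> \<phi> = \<xi>"
      using assms(2,3,7) \<phi>m \<xi> factorisation_unique[of \<mu> \<phi> \<mu>' \<xi>] by (auto simp: paths_into_def)
    moreover have "act (cmp \<mu> \<phi>) j = act (cmp \<alpha> \<phi>) i"
      using act_Cmp_sync[of \<mu> j \<phi> "act \<mu> j"] act_Cmp_sync[of \<alpha> i \<phi> "act \<mu> j"] assms \<phi> \<phi>m act_closed[of \<mu> j]
      by (simp add: paths_into_def)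
    moreover have "src (cmp \<mu> \<phi>) = src (cmp \<alpha> \<phi>)"
      using assms \<phi> by (simp add: Src_Cmp paths_into_def)
    ultimately have "ts (cmp \<mu> \<phi>) j * t (cmp \<mu>' \<xi>) j'
      \<approx> (if \<phi> = \<xi> \<and> \<mu> = \<mu>' \<and> j = j' then t (src (cmp \<alpha> \<phi>)) (act (cmp \<alpha> \<phi>) i) else 0)"
      using ts_t[of "cmp \<mu> \<phi>" "cmp \<mu>' \<xi>" j j'] m[OF assms(2) \<phi>m] m[OF assms(3) \<xi>] assms
      by (cases "\<phi> = \<xi> \<and> \<mu> = \<mu>' \<and> j = j'") auto
    then have "t (cmp \<alpha> \<phi>) i * (ts (cmp \<mu> \<phi>) j * t (cmp \<mu>' \<xi>) j') * ts (cmp \<nu> \<xi>) l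
      \<approx> (t (cmp \<alpha> \<phi>) i * (if \<phi> = \<xi> \<and> \<mu> = \<mu>' \<and> j = j' then t (src (cmp \<alpha> \<phi>)) (act (cmp \<alpha> \<phi>) i) else 0) * ts (cmp \<nu> \<xi>) l)"
      by (intro total.kp_eq_mult_left total.kp_eq_mult_right)
    also have "\<dots> \<approx> (if \<phi> = \<xi> \<and> \<mu> = \<mu>' \<and> j = j' then t (cmp \<alpha> \<phi>) i * ts (cmp \<nu> \<phi>) l else 0)"
      using m[OF assms(1) \<phi>] assms by (auto intro!: total.kp_eq_mult_right t_units)
    finally show ?thesis .
  qed
  have "munit i \<alpha> \<mu> j * munit j' \<mu>' \<nu> l =
      (\<Sum>\<phi>\<in>into_B (src \<alpha>). \<Sum>\<xi>\<in>into_B (src \<mu>'). t (cmp \<alpha> \<phi>) i * (ts (cmp \<mu> \<phi>) j * t (cmp \<mu>' \<xi>) j') * ts (cmp \<nu> \<xi>) l)"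
    unfolding munit_def by (simp add: sum_product mult.assoc)
  also have "\<dots> \<approx> (\<Sum>\<phi>\<in>into_B (src \<alpha>). \<Sum>\<xi>\<in>into_B (src \<mu>').
      if \<phi> = \<xi> \<and> \<mu> = \<mu>' \<and> j = j' then t (cmp \<alpha> \<phi>) i * ts (cmp \<nu> \<phi>) l else 0)"
    by (intro total.kp_eq_sum product)
  also have "\<dots> = (if \<mu> = \<mu>' \<and> j = j' then munit i \<alpha> \<nu> l else 0)"
  proof (cases "\<mu> = \<mu>' \<and> j = j'")
    case True
    then show ?thesis
      using assms(5) finite_into_B[OF assms(3)] by (simp add: munit_def)
  qed (auto intro: sum.neutral)
  finally show ?thesis .
qed

text \<open>
  If the lifts have the same source, then the sum is the summation relation at that source.
\<close>

lemma munit_eq_t_ts: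
  assumes "\<alpha> \<in> mor" "\<mu> \<in> mor" "src \<alpha> = src \<mu>" "i \<in> fib (rng \<alpha>)" "j \<in> fib (rng \<mu>)"
    and "act \<alpha> i = act \<mu> j"
  shows "munit i \<alpha> \<mu> j \<approx> t \<alpha> i * ts \<mu> j"
proof -
  have inj: "inj_on (\<lambda>\<phi>. lift \<phi> (act \<alpha> i)) (into_B (src \<alpha>))"
    using assms lift_inject act_closed[of \<alpha> i] by (auto simp: inj_on_def paths_into_def)
  have C: "lift (cmp \<alpha> \<phi>) i = Cmp \<Gamma> (lift \<alpha> i) (lift \<phi> (act \<alpha> i))"
    "lift (cmp \<mu> \<phi>) j = Cmp \<Gamma> (lift \<mu> j) (lift \<phi> (act \<alpha> i))" if "\<phi> \<in> into_B (src \<alpha>)" for \<phi>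
    using that assms Cmp_lift[of \<alpha> \<phi> i] Cmp_lift[of \<mu> \<phi> j] by (simp_all add: paths_into_def)
  have "(\<Sum>\<phi>\<in>paths_into \<Gamma> (Src \<Gamma> (lift \<alpha> i)) (basis_deg b).
      fpath (Cmp \<Gamma> (lift \<alpha> i) \<phi>) * fghost \<Gamma> (Cmp \<Gamma> (lift \<mu> j) \<phi>)) \<approx> t \<alpha> i * ts \<mu> j"
    using assms basis_deg_nonzero by (intro total.kp_eq_sum_paths_out) (simp_all add: lift_Mor Src_lift)
  then show ?thesis
    using assms inj act_closed[of \<alpha> i]
    by (simp add: munit_def Src_lift paths_into_total Src_vert sum.reindex C cong: sum.cong)
qed

lemma munit_t:
  assumes "\<alpha> \<in> mor" "i \<in> fib (rng \<alpha>)"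
  shows "munit i \<alpha> (src \<alpha>) (act \<alpha> i) \<approx> t \<alpha> i"
    and "munit (act \<alpha> i) (src \<alpha>) \<alpha> i \<approx> ts \<alpha> i"
proof -
  have s: "src \<alpha> \<in> mor" "src \<alpha> = src (src \<alpha>)" "act \<alpha> i \<in> fib (rng (src \<alpha>))"
    "act \<alpha> i = act (src \<alpha>) (act \<alpha> i)" "ts (src \<alpha>) (act \<alpha> i) = t (src \<alpha>) (act \<alpha> i)"
    using assms
    by (simp_all add: Src_closed Src_Src Rng_Src act_closed act_vert Src_vert total.fghost_vert lift_vert)
  show "munit i \<alpha> (src \<alpha>) (act \<alpha> i) \<approx> t \<alpha> i"
    by (rule total.kp_eq_trans, rule munit_eq_t_ts[OF assms(1) s(1,2) assms(2) s(3,4)], unfold s(5),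
        rule t_units(2)[OF assms])
  show "munit (act \<alpha> i) (src \<alpha>) \<alpha> i \<approx> ts \<alpha> i"
    by (rule total.kp_eq_trans, rule munit_eq_t_ts[OF s(1) assms(1) s(2)[symmetric] s(3) assms(2) s(4)[symmetric]],
        rule t_units(3)[OF assms])
qed

lemma munit_vert: "v \<in> verts \<Longrightarrow> i \<in> fib v \<Longrightarrow> munit i v v i \<approx> t v i"
  using munit_t(1)[of v i] by (simp add: vert_Mor Rng_of_vert Src_of_vert act_vert)

lemma pt_Rng: "\<alpha> \<in> mor \<Longrightarrow> pt \<in> fib (rng \<alpha>)" and pt_Src: "\<alpha> \<in> mor \<Longrightarrow> pt \<in> fib (src \<alpha>)"
  by (simp_all add: pt_fib Rng_vert Src_vert)

lemma munit_aug:
  assumes "\<alpha> \<in> mor" "\<mu> \<in> mor" "src \<alpha> = src \<mu>" "i \<in> fib (rng \<alpha>)" "j \<in> fib (rng \<mu>)"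
  shows "munit i \<alpha> \<mu> j \<in> kp_aug \<Gamma>"
  unfolding munit_def
proof (rule aug_carrier_sum, rule aug_carrier_closed(6))
  fix \<phi> assume "\<phi> \<in> into_B (src \<alpha>)"
  then have \<phi>: "\<phi> \<in> mor" "src \<alpha> = rng \<phi>" "src \<mu> = rng \<phi>" using assms by (auto simp: paths_into_def)
  then show "t (cmp \<alpha> \<phi>) i \<in> kp_aug \<Gamma>"
    using assms by (intro total.fpath_aug lift_Mor) (simp_all add: Cmp_closed Rng_Cmp)
  from \<phi> show "ts (cmp \<mu> \<phi>) j \<in> kp_carrier \<Gamma>"
    using assms by (intro aug_carrier_closed(1)[OF total.fghost_aug] lift_Mor) (simp_all add: Cmp_closed Rng_Cmp)
qed

section \<open>The homomorphism into the corner\<close>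

text \<open>
  A generator is sent to its lift with index \<open>pt\<close>, corrected by the matrix unit that moves the index
  \<open>act \<alpha> pt\<close> at the source back to \<open>pt\<close>.
\<close>

primrec corner_image :: "'m kp_gen \<Rightarrow> ('n, 'f::field) kp_poly" where
  "corner_image (Path \<alpha>) = munit pt \<alpha> (src \<alpha>) pt"
| "corner_image (Ghost \<alpha>) = munit pt (src \<alpha>) \<alpha> pt"

definition psi :: "('m, 'f::field) kp_poly \<Rightarrow> ('n, 'f) kp_poly" where
  "psi = alg_hom corner_image"

lemma psi_simps:
  "psi (x + y) = psi x + psi y" "psi (x - y) = psi x - psi y" "psi 0 = 0" "psi 1 = 1" "psi (x * y) = psi x * psi y"
  "psi (sum f A) = (\<Sum>a\<in>A. psi (f a))" "psi (scal c x) = scal c (psi x)"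
  by (simp_all add: psi_def alg_hom_linear_simps alg_hom_mult)

lemma psi_path: "psi (fpath \<alpha>) = munit pt \<alpha> (src \<alpha>) pt"
  by (simp add: psi_def fpath_def)

lemma psi_ghost:
  assumes "\<alpha> \<in> mor"
  shows "psi (ghost \<alpha>) = munit pt (src \<alpha>) \<alpha> pt"
proof (cases "deg \<alpha> = 0")
  case True
  then have "\<alpha> \<in> verts" using assms by (simp add: kg_verts_def)
  with True show ?thesis by (simp add: psi_def fghost_def Src_of_vert)
qed (simp add: psi_def fghost_def)

text \<open>
  All relations are instances of the multiplication rules for \<open>munit\<close>, except for the summation relation
  in degree \<open>n\<close>: its image is the one in degree \<open>n + B\<close> at the vertex \<open>lift v pt\<close>.
\<close>

lemma psi_relator:
  fixes r :: "('m, 'f::field) kp_poly"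
  assumes "r \<in> kp_relators \<Lambda>"
  shows "psi r \<approx> 0"
proof -
  note simps = psi_simps psi_path psi_ghost total.kp_eq_diff_zero Src_closed Rng_closed Src_Src Rng_Src Src_Rng Rng_Rng
    Cmp_closed Src_Cmp Rng_Cmp pt_Rng pt_Src Deg_Src Deg_Rng Cmp_Src Cmp_Rng
  from assms show ?thesis
  proof (cases rule: relator_cases)
    case (verts u v)
    then show ?thesis
      using munit_mult[of u "src u" v "src v" pt pt pt pt]
      by (auto simp: simps vert_Mor vert_Deg Src_of_vert Rng_of_vert pt_fib split: if_splits)
  next
    case (paths \<alpha> \<mu>)
    then show ?thesis
      using munit_mult_path(1)[of \<alpha> \<mu> "src \<mu>" pt pt pt] by (simp add: simps)
  next
    case (ghosts \<alpha> \<mu>)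
    then show ?thesis
      using munit_mult_path(2)[of \<alpha> \<mu> "src \<mu>" pt pt pt] by (simp add: simps)
  next
    case (unit1 \<alpha>)
    then show ?thesis
      using munit_mult_path(1)[of "rng \<alpha>" \<alpha> "src \<alpha>" pt pt pt] by (simp add: simps)
  next
    case (unit2 \<alpha>)
    then show ?thesis
      using munit_mult_path(1)[of \<alpha> "src \<alpha>" "src \<alpha>" pt pt pt] by (simp add: simps)
  next
    case (unit3 \<alpha>)
    then show ?thesis
      using munit_mult[of "src \<alpha>" "src \<alpha>" "src \<alpha>" \<alpha> pt pt pt pt] by (simp add: simps)
  next
    case (unit4 \<alpha>)
    then show ?thesis
      using munit_mult_path(2)[of "rng \<alpha>" \<alpha> "src \<alpha>" pt pt pt] by (simp add: simps)
  next
    case (ghost_path \<alpha> \<mu>)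
    then show ?thesis
      using munit_mult[of "src \<alpha>" \<alpha> \<mu> "src \<mu>" pt pt pt pt]
      by (auto simp: simps split: if_splits)
  next
    case (vert_sum v n)
    let ?P = "paths_into \<Lambda> v"
    have "(psi (\<Sum>\<alpha>\<in>?P n. fpath \<alpha> * ghost \<alpha>)) \<approx> (\<Sum>\<alpha>\<in>?P n. munit pt \<alpha> \<alpha> pt)"
      unfolding psi_simps
    proof (rule total.kp_eq_sum)
      fix \<alpha> assume "\<alpha> \<in> ?P n"
      then have "\<alpha> \<in> mor" by (simp add: paths_into_def)
      then show "psi (fpath \<alpha>) * psi (ghost \<alpha>) \<approx> munit pt \<alpha> \<alpha> pt"
        using munit_mult[of \<alpha> "src \<alpha>" "src \<alpha>" \<alpha> pt pt pt pt] by (simp add: simps)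
    qed
    also have "(\<Sum>\<alpha>\<in>?P n. munit pt \<alpha> \<alpha> pt :: ('n, 'f) kp_poly) = (\<Sum>\<gamma>\<in>?P (n + basis_deg b). t \<gamma> pt * ts \<gamma> pt)"
    proof -
      have "(\<Sum>\<alpha>\<in>?P n. munit pt \<alpha> \<alpha> pt :: ('n, 'f) kp_poly) =
          (\<Sum>(\<alpha>, \<phi>)\<in>(SIGMA \<alpha>:?P n. into_B (src \<alpha>)). t (cmp \<alpha> \<phi>) pt * ts (cmp \<alpha> \<phi>) pt)"
        unfolding munit_def using finite_paths_into[OF row_finite vert_sum(2)]
        by (intro sum.Sigma ballI) (auto intro: finite_into_B[simplified] dest: into_B_D(1)[of _ v] simp: paths_into_def[of \<Lambda> v])
      then show ?thesis
        using sum.reindex_bij_betw[OF paths_into_bij[of v n "basis_deg b"], of "\<lambda>\<gamma>. t \<gamma> pt * ts \<gamma> pt :: ('n, 'f) kp_poly"]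
        by (simp add: case_prod_unfold)
    qed
    also have "\<dots> \<approx> t v pt"
      using vert_sum by (intro t_vert_sum) (auto simp: pt_fib vec_eq_iff)
    also have "\<dots> \<approx> psi (fpath v)"
      using vert_sum munit_vert[of v pt, THEN total.kp_eq_sym] by (simp add: psi_path Src_of_vert pt_fib)
    finally show ?thesis
      unfolding vert_sum(1) psi_simps(2) total.kp_eq_diff_zero by (rule total.kp_eq_sym)
  qed
qed

lemma psi_kp_eq:
  assumes "x \<in> kp_carrier \<Lambda>" "y \<in> kp_carrier \<Lambda>" "x \<sim> y"
  shows "psi x \<approx> psi y"
proof -
  have "psi z \<approx> 0" if "z \<in> kp_ideal \<Lambda>" for z
    using that
  proof (induction z rule: kp_ideal_induct)
    case (add x y)
    then show ?case using total.kp_eq_add[of "psi x" 0 "psi y" 0] by (simp add: psi_simps)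
  next
    case (left a x)
    then show ?case using total.kp_eq_mult_left[of "psi x" 0 "psi a"] by (simp add: psi_simps)
  next
    case (right a x)
    then show ?case using total.kp_eq_mult_right[of "psi x" 0 "psi a"] by (simp add: psi_simps)
  qed (simp_all add: psi_simps psi_relator)
  moreover have "x - y \<in> kp_ideal \<Lambda>" using assms by (simp add: kp_eq_iff)
  ultimately show ?thesis using psi_simps(2)[of x y] total.kp_eq_diff_zero by metis
qed

lemma corner_image_aug:
  assumes "g \<in> kp_gens \<Lambda>"
  shows "corner_image g \<in> kp_aug \<Gamma>"
proof -
  obtain \<alpha> where "\<alpha> \<in> mor" "g = Path \<alpha> \<or> g = Ghost \<alpha>"
    using assms by (auto simp: kp_gens_def)
  then show ?thesis
    by (elim disjE; simp) (intro munit_aug; simp add: Src_closed Src_Src Rng_Src pt_Rng pt_Src)+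
qed

lemma psi_carrier: "x \<in> kp_carrier \<Lambda> \<Longrightarrow> psi x \<in> kp_carrier \<Gamma>"
  unfolding psi_def alg_hom_def
proof (erule lin_ext_free_carrier)
  fix w assume "set w \<subseteq> kp_gens \<Lambda>"
  then show "prod_list (map corner_image w) \<in> kp_carrier \<Gamma>"
    by (induction w)
      (auto simp: zero_one_free_carrier intro: free_carrier_closed(2) aug_carrier_closed(1) corner_image_aug)
qed

lemma psi_aug:
  fixes x :: "('m, 'f::field) kp_poly"
  shows "x \<in> kp_aug \<Lambda> \<Longrightarrow> psi x \<in> kp_aug \<Gamma>"
proof (induction x rule: aug_carrier_induct)
  case (mono c w)
  then obtain g v where w: "w = g # v" by (cases w) auto
  have "psi (wmono w :: ('m, 'f) kp_poly) = corner_image g * psi (wmono v)"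
    by (simp add: w wmono_Cons psi_simps) (simp add: psi_def)
  moreover have "(corner_image g :: ('n, 'f) kp_poly) \<in> kp_aug \<Gamma>" "psi (wmono v :: ('m, 'f) kp_poly) \<in> kp_carrier \<Gamma>"
    using mono w by (auto intro: corner_image_aug psi_carrier)
  ultimately show ?case by (simp add: psi_simps aug_carrier_closed)
qed (auto simp: psi_simps aug_carrier_closed)

section \<open>Matrix entries\<close>

definition under :: "'n \<Rightarrow> 'm \<times> 'i" where
  "under \<gamma> = (SOME p. fst p \<in> mor \<and> snd p \<in> fib (rng (fst p)) \<and> \<gamma> = lift (fst p) (snd p))"

lemma under_lift: "\<alpha> \<in> mor \<Longrightarrow> i \<in> fib (rng \<alpha>) \<Longrightarrow> under (lift \<alpha> i) = (\<alpha>, i)"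
  unfolding under_def
proof (rule some_equality)
  fix p assume "fst p \<in> mor \<and> snd p \<in> fib (rng (fst p)) \<and> lift \<alpha> i = lift (fst p) (snd p)"
    and "\<alpha> \<in> mor" "i \<in> fib (rng \<alpha>)"
  then show "p = (\<alpha>, i)"
    using lift_inject[of \<alpha> i "fst p" "snd p"] by (simp add: prod_eq_iff)
qed simp

text \<open>
  The lift of \<alpha> with index \<open>k\<close> is treated as the matrix with the single nonzero entry \<alpha> in row \<open>k\<close> and
  column \<open>act \<alpha> k\<close>, and its ghost as the matrix with the ghost of \<alpha> in the transposed position. A product
  of such matrices has at most one nonzero entry in each row, so its coefficients can be read off
  along the word.
\<close>

fun word_coef :: "'i \<Rightarrow> 'i \<Rightarrow> 'n kp_gen list \<Rightarrow> ('m, 'f::field) kp_poly" where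
  "word_coef i j [] = (if i = j then 1 else 0)"
| "word_coef i j (Path \<gamma> # w) =
    (if snd (under \<gamma>) = i then fpath (fst (under \<gamma>)) * word_coef (act (fst (under \<gamma>)) i) j w else 0)"
| "word_coef i j (Ghost \<gamma> # w) =
    (if act (fst (under \<gamma>)) (snd (under \<gamma>)) = i
     then ghost (fst (under \<gamma>)) * word_coef (snd (under \<gamma>)) j w else 0)"

definition coef :: "'i \<Rightarrow> 'i \<Rightarrow> ('n, 'f::field) kp_poly \<Rightarrow> ('m, 'f) kp_poly" where
  "coef i j = lin_ext (word_coef i j)"

lemma coef_simps:
  "coef i j (x + y) = coef i j x + coef i j y" "coef i j (x - y) = coef i j x - coef i j y"
  "coef i j 0 = 0" "coef i j 1 = (if i = j then 1 else 0)"
  "coef i j (sum f A) = (\<Sum>a\<in>A. coef i j (f a))" "coef i j (scal c x) = scal c (coef i j x)"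
  by (simp_all add: coef_def lin_ext_add lin_ext_diff lin_ext_sum lin_ext_scal lin_ext_one)

lemma word_coef_append_Path:
  "word_coef i j (w @ [Path \<gamma>]) = (if act (fst (under \<gamma>)) (snd (under \<gamma>)) = j
     then word_coef i (snd (under \<gamma>)) w * fpath (fst (under \<gamma>)) else 0)"
  by (induction i j w rule: word_coef.induct) (auto simp: mult.assoc)

lemma word_coef_append_Ghost:
  "word_coef i j (w @ [Ghost \<gamma>]) = (if snd (under \<gamma>) = j
     then word_coef i (act (fst (under \<gamma>)) (snd (under \<gamma>))) w * ghost (fst (under \<gamma>)) else 0)"
  by (induction i j w rule: word_coef.induct) (auto simp: mult.assoc)

lemma coef_t_mult:
  assumes "\<alpha> \<in> mor" "k \<in> fib (rng \<alpha>)"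
  shows "coef i j (t \<alpha> k * x) = (if i = k then fpath \<alpha> * coef (act \<alpha> k) j x else 0)"
    and "coef i j (x * t \<alpha> k) = (if j = act \<alpha> k then coef i k x * fpath \<alpha> else 0)"
proof -
  note [simp] = under_lift[OF assms]
  show "coef i j (t \<alpha> k * x) = (if i = k then fpath \<alpha> * coef (act \<alpha> k) j x else 0)"
    unfolding coef_def fpath_def[of "lift \<alpha> k"]
    using lin_ext_gen_mult[of "word_coef i j" "Path (lift \<alpha> k)" "if i = k then fpath \<alpha> else 0" "word_coef (act \<alpha> k) j" x]
    by auto
  show "coef i j (x * t \<alpha> k) = (if j = act \<alpha> k then coef i k x * fpath \<alpha> else 0)"
    unfolding coef_def fpath_def[of "lift \<alpha> k"]
    using lin_ext_mult_gen[of "word_coef i j" "Path (lift \<alpha> k)" "word_coef i k" "if j = act \<alpha> k then fpath \<alpha> else 0" x]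
    by (auto simp: word_coef_append_Path)
qed

lemma coef_ts_mult:
  assumes "\<alpha> \<in> mor" "k \<in> fib (rng \<alpha>)"
  shows "coef i j (ts \<alpha> k * x) = (if i = act \<alpha> k then ghost \<alpha> * coef k j x else 0)"
    and "coef i j (x * ts \<alpha> k) = (if j = k then coef i (act \<alpha> k) x * ghost \<alpha> else 0)"
proof -
  note [simp] = under_lift[OF assms]
  have vert: "ts \<alpha> k = t \<alpha> k" "ghost \<alpha> = fpath \<alpha>" "act \<alpha> k = k" if "deg \<alpha> = 0"
    using that assms act_vert[of \<alpha> k] Rng_of_vert[of \<alpha>]
    by (auto simp: fghost_def fpath_def Deg_lift kg_verts_def)
  have ghost: "ts \<alpha> k = gen (Ghost (lift \<alpha> k))" if "deg \<alpha> \<noteq> 0"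
    using that assms by (simp add: fghost_def Deg_lift)
  show "coef i j (ts \<alpha> k * x) = (if i = act \<alpha> k then ghost \<alpha> * coef k j x else 0)"
  proof (cases "deg \<alpha> = 0")
    case True
    show ?thesis unfolding vert[OF True] coef_t_mult(1)[OF assms] by (simp add: vert[OF True])
  next
    case False
    show ?thesis
      unfolding coef_def ghost[OF False]
      using lin_ext_gen_mult[of "word_coef i j" "Ghost (lift \<alpha> k)" "if i = act \<alpha> k then ghost \<alpha> else 0" "word_coef k j" x]
      by auto
  qed
  show "coef i j (x * ts \<alpha> k) = (if j = k then coef i (act \<alpha> k) x * ghost \<alpha> else 0)"
  proof (cases "deg \<alpha> = 0")
    case True
    show ?thesis unfolding vert[OF True] coef_t_mult(2)[OF assms] by (simp add: vert[OF True])
  next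
    case False
    show ?thesis
      unfolding coef_def ghost[OF False]
      using lin_ext_mult_gen[of "word_coef i j" "Ghost (lift \<alpha> k)" "word_coef i (act \<alpha> k)" "if j = k then ghost \<alpha> else 0" x]
      by (auto simp: word_coef_append_Ghost)
  qed
qed

lemma coef_t:
  assumes "\<alpha> \<in> mor" "k \<in> fib (rng \<alpha>)"
  shows "coef i j (t \<alpha> k) = (if i = k \<and> j = act \<alpha> k then fpath \<alpha> else 0)"
    and "coef i j (ts \<alpha> k) = (if i = act \<alpha> k \<and> j = k then ghost \<alpha> else 0)"
  using coef_t_mult(1)[OF assms, of i j 1] coef_ts_mult(1)[OF assms, of i j 1]
  by (auto simp: coef_simps)

text \<open>
  In row \<open>i\<close> the sum that defines \<open>munit\<close> becomes the summation relation of \<Lambda> at the source of \<alpha>.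
\<close>

lemma coef_munit_mult:
  assumes "\<alpha> \<in> mor" "\<mu> \<in> mor" "src \<alpha> = src \<mu>" "i \<in> fib (rng \<alpha>)" "j \<in> fib (rng \<mu>)"
  shows "coef p q (munit i \<alpha> \<mu> j * x) \<sim> (if p = i then fpath \<alpha> * ghost \<mu> * coef j q x else 0)"
proof -
  have "coef p q (munit i \<alpha> \<mu> j * x) =
      (if p = i then (\<Sum>\<phi>\<in>into_B (src \<alpha>). fpath (cmp \<alpha> \<phi>) * ghost (cmp \<mu> \<phi>)) * coef j q x else 0)"
  proof -
    have "coef p q (t (cmp \<alpha> \<phi>) i * (ts (cmp \<mu> \<phi>) j * x)) =
        (if p = i then fpath (cmp \<alpha> \<phi>) * (ghost (cmp \<mu> \<phi>) * coef j q x) else 0)"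
      if "\<phi> \<in> into_B (src \<alpha>)" for \<phi>
    proof -
      have "act (cmp \<alpha> \<phi>) i = act (cmp \<mu> \<phi>) j"
        using act_Cmp_sync[of \<mu> j \<phi> "act \<mu> j"] act_Cmp_sync[of \<alpha> i \<phi> "act \<mu> j"] assms that act_closed[of \<mu> j]
        by (simp add: paths_into_def)
      then show ?thesis
        using that assms by (simp add: coef_t_mult coef_ts_mult paths_into_def Cmp_closed Rng_Cmp)
    qed
    then show ?thesis
      by (simp add: munit_def sum_distrib_right coef_simps mult.assoc cong: sum.cong)
  qed
  also have "\<dots> \<sim> (if p = i then fpath \<alpha> * ghost \<mu> * coef j q x else 0)"
    using kp_eq_mult_right[OF kp_eq_sum_paths_out[OF assms(1-3) basis_deg_nonzero]] by auto
  finally show ?thesis .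
qed

text \<open>
  The nonzero entries of the matrices satisfy the relations of \<Lambda>, and the positions fit.
\<close>

lemma coef_relator:
  fixes r :: "('n, 'f::field) kp_poly"
  assumes "r \<in> kp_relators \<Gamma>"
  shows "coef p q r \<sim> 0"
proof -
  note simps = coef_simps coef_t_mult(1) coef_ts_mult(1) coef_t kp_eq_diff_zero Src_closed Rng_closed Src_Src Rng_Src Src_Rng Rng_Rng
    Cmp_closed Src_Cmp Rng_Cmp Deg_Src Deg_Rng Cmp_Src Cmp_Rng act_closed act_vert act_Cmp Src_vert Rng_vert
    Cmp_lift Src_lift Rng_lift Deg_lift lift_eq_iff kp_eq_units kp_eq_path_mult vert_Mor Rng_of_vert
  from assms show ?thesis
  proof (cases rule: total.relator_cases)
    case (verts u v)
    then obtain u' k v' l where *: "u = lift u' k" "v = lift v' l" "u' \<in> verts" "v' \<in> verts" "k \<in> fib u'" "l \<in> fib v'"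
      unfolding kg_verts_total by blast
    then show ?thesis
      using verts(1) kp_eq_vert_mult[OF *(3,4)] by (auto simp: simps split: if_splits)
  next
    case (paths \<alpha> \<mu>)
    from paths(2-) obtain \<alpha>' k \<mu>' where *: "\<alpha> = lift \<alpha>' k" "\<mu> = lift \<mu>' (act \<alpha>' k)" "\<alpha>' \<in> mor" "\<mu>' \<in> mor"
      "k \<in> fib (rng \<alpha>')" "src \<alpha>' = rng \<mu>'" by (rule composable_totalE)
    moreover have "act \<alpha>' k \<in> fib (rng \<mu>')" using * act_closed[of \<alpha>' k] by simp
    ultimately show ?thesis
      using paths(1) by (auto simp: simps)
  next
    case (ghosts \<alpha> \<mu>)
    from ghosts(2-) obtain \<alpha>' k \<mu>' where *: "\<alpha> = lift \<alpha>' k" "\<mu> = lift \<mu>' (act \<alpha>' k)" "\<alpha>' \<in> mor" "\<mu>' \<in> mor"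
      "k \<in> fib (rng \<alpha>')" "src \<alpha>' = rng \<mu>'" by (rule composable_totalE)
    moreover have "act \<alpha>' k \<in> fib (rng \<mu>')" using * act_closed[of \<alpha>' k] by simp
    ultimately show ?thesis
      using ghosts(1) by (auto simp: simps)
  next
    case (unit1 \<alpha>)
    from unit1(2) obtain \<alpha>' k where "\<alpha> = lift \<alpha>' k" "\<alpha>' \<in> mor" "k \<in> fib (rng \<alpha>')"
      by (rule Mor_totalE)
    with unit1(1) show ?thesis by (auto simp: simps)
  next
    case (unit2 \<alpha>)
    from unit2(2) obtain \<alpha>' k where "\<alpha> = lift \<alpha>' k" "\<alpha>' \<in> mor" "k \<in> fib (rng \<alpha>')"
      by (rule Mor_totalE)
    with unit2(1) show ?thesis by (auto simp: simps)
  next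
    case (unit3 \<alpha>)
    from unit3(2) obtain \<alpha>' k where "\<alpha> = lift \<alpha>' k" "\<alpha>' \<in> mor" "k \<in> fib (rng \<alpha>')"
      by (rule Mor_totalE)
    with unit3(1) show ?thesis by (auto simp: simps)
  next
    case (unit4 \<alpha>)
    from unit4(2) obtain \<alpha>' k where "\<alpha> = lift \<alpha>' k" "\<alpha>' \<in> mor" "k \<in> fib (rng \<alpha>')"
      by (rule Mor_totalE)
    with unit4(1) show ?thesis by (auto simp: simps)
  next
    case (ghost_path \<alpha> \<mu>)
    then obtain \<alpha>' k \<mu>' l where *: "\<alpha> = lift \<alpha>' k" "\<mu> = lift \<mu>' l" "\<alpha>' \<in> mor" "\<mu>' \<in> mor"
      "k \<in> fib (rng \<alpha>')" "l \<in> fib (rng \<mu>')"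
      by (elim Mor_totalE)
    then show ?thesis
      using ghost_path(1,4) kp_eq_ghost_path[of \<alpha>' \<mu>'] by (auto simp: simps split: if_splits)
  next
    case (vert_sum v n)
    then obtain u k where *: "v = lift u k" "u \<in> verts" "k \<in> fib u"
      unfolding kg_verts_total by blast
    have "inj_on (\<lambda>\<alpha>. lift \<alpha> k) (paths_into \<Lambda> u n)"
      using * lift_inject by (auto simp: inj_on_def paths_into_def)
    moreover have "(coef p q (t \<alpha> k * ts \<alpha> k) :: ('m, 'f) kp_poly) = (if p = k \<and> q = k then fpath \<alpha> * ghost \<alpha> else 0)"
      if "\<alpha> \<in> paths_into \<Lambda> u n" for \<alpha>
      using that * by (auto simp: simps paths_into_def)
    ultimately have "(coef p q (\<Sum>\<alpha>\<in>paths_into \<Gamma> v n. fpath \<alpha> * fghost \<Gamma> \<alpha>) :: ('m, 'f) kp_poly) =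
        (if p = k \<and> q = k then (\<Sum>\<alpha>\<in>paths_into \<Lambda> u n. fpath \<alpha> * ghost \<alpha>) else 0)"
      using * by (cases "p = k \<and> q = k") (auto simp: paths_into_total sum.reindex coef_simps cong: sum.cong)
    then show ?thesis
      using vert_sum(1,3) * kp_eq_vert_sum[of u n, THEN kp_eq_sym] by (auto simp: simps)
  qed
qed

lemma total_gensE:
  assumes "g \<in> kp_gens \<Gamma>"
  obtains \<alpha> k where "\<alpha> \<in> mor" "k \<in> fib (rng \<alpha>)" "(gen g :: ('n, 'f::field) kp_poly) = t \<alpha> k"
  | \<alpha> k where "\<alpha> \<in> mor" "k \<in> fib (rng \<alpha>)" "(gen g :: ('n, 'f::field) kp_poly) = ts \<alpha> k"
proof -
  from assms consider \<gamma> where "g = Path \<gamma>" "\<gamma> \<in> Mor \<Gamma>" | \<gamma> where "g = Ghost \<gamma>" "\<gamma> \<in> Mor \<Gamma>" "Deg \<Gamma> \<gamma> \<noteq> 0"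
    by (auto simp: kp_gens_def)
  then show thesis
    by cases (auto elim!: Mor_totalE simp: fpath_def fghost_def intro: that)
qed

text \<open>
  What the calculations use about a letter of \<Gamma>: as a matrix it has the single entry \<open>a\<close>, in row \<open>k\<close> and
  column \<open>k'\<close>, and the matrix units that lead from row \<open>pt\<close> intertwine it with the image of \<open>a\<close>.
\<close>

lemma letter_cases:
  assumes "g \<in> kp_gens \<Gamma>"
  obtains u k u' k' and a :: "('m, 'f::field) kp_poly"
  where "u \<in> verts" "k \<in> fib u" "u' \<in> verts" "k' \<in> fib u'" "a \<in> kp_aug \<Lambda>"
    "\<And>i j x. coef i j (gen g * x) = (if i = k then a * coef k' j x else 0)"
    "\<And>i j x. coef i j (x * gen g) = (if j = k' then coef i k x * a else 0)"
    "t u k * gen g \<approx> (gen g :: ('n, 'f) kp_poly)"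
    "munit pt u u k * gen g \<approx> psi a * munit pt u' u' k'"
    "fpath u * a \<sim> a" "a * fpath u' \<sim> a"
proof -
  note simps = Src_closed Rng_closed Src_Src Rng_Src Src_Rng Rng_Rng act_closed Src_vert Rng_vert pt_Rng pt_Src Deg_Src Deg_Rng
  from assms show thesis
  proof (rule total_gensE[where ?'f = 'f])
    fix \<alpha> k
    assume \<alpha>: "\<alpha> \<in> mor" "k \<in> fib (rng \<alpha>)" and g: "(gen g :: ('n, 'f) kp_poly) = t \<alpha> k"
    let ?s = "src \<alpha>" and ?r = "rng \<alpha>"
    have "(munit pt ?r ?r k * t \<alpha> k :: ('n, 'f) kp_poly) \<approx> munit pt ?r ?r k * munit k \<alpha> ?s (act \<alpha> k)"
      by (rule total.kp_eq_mult_left, rule total.kp_eq_sym, rule munit_t(1)[OF \<alpha>])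
    also have "\<dots> \<approx> munit pt \<alpha> ?s (act \<alpha> k)"
      using munit_mult_path(1)[of ?r \<alpha> ?s pt k "act \<alpha> k"] \<alpha> by (simp add: simps Cmp_Rng)
    also have "\<dots> \<approx> psi (fpath \<alpha>) * munit pt ?s ?s (act \<alpha> k)"
      using munit_mult[of \<alpha> ?s ?s ?s pt pt pt "act \<alpha> k", THEN total.kp_eq_sym] \<alpha> by (simp add: simps psi_path)
    finally show thesis
      using \<alpha>
      by (intro that[of ?r k ?s "act \<alpha> k" "fpath \<alpha>"])
        (simp_all add: g simps coef_t_mult fpath_aug kp_eq_units t_units)
  next
    fix \<alpha> k
    assume \<alpha>: "\<alpha> \<in> mor" "k \<in> fib (rng \<alpha>)" and g: "(gen g :: ('n, 'f) kp_poly) = ts \<alpha> k"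
    let ?s = "src \<alpha>" and ?r = "rng \<alpha>"
    have "(munit pt ?s ?s (act \<alpha> k) * ts \<alpha> k :: ('n, 'f) kp_poly) \<approx> munit pt ?s ?s (act \<alpha> k) * munit (act \<alpha> k) ?s \<alpha> k"
      by (rule total.kp_eq_mult_left, rule total.kp_eq_sym, rule munit_t(2)[OF \<alpha>])
    also have "\<dots> \<approx> munit pt ?s \<alpha> k"
      using munit_mult[of ?s ?s ?s \<alpha> pt "act \<alpha> k" "act \<alpha> k" k] \<alpha> by (simp add: simps)
    also have "\<dots> \<approx> psi (ghost \<alpha>) * munit pt ?r ?r k"
      using munit_mult_path(2)[of ?r \<alpha> ?s k pt pt, THEN total.kp_eq_sym] \<alpha> by (simp add: simps psi_ghost Cmp_Rng)
    finally show thesis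
      using \<alpha>
      by (intro that[of ?s "act \<alpha> k" ?r k "ghost \<alpha>"])
        (simp_all add: g simps coef_ts_mult fghost_aug kp_eq_units t_units)
  qed
qed

text \<open>
  The elements whose coefficients are all congruent to zero form an ideal, because a letter has one
  nonzero entry: multiplying by it moves a coefficient to another position and multiplies it by that
  entry.
\<close>

lemma coef_kp_eq:
  fixes x y :: "('n, 'f::field) kp_poly"
  assumes "x \<in> kp_carrier \<Gamma>" "y \<in> kp_carrier \<Gamma>" "x \<approx> y"
  shows "coef i j x \<sim> coef i j y"
proof -
  have left: "\<forall>i j. coef i j (a * z) \<sim> 0"
    if "\<And>i j. coef i j z \<sim> 0" "a \<in> kp_carrier \<Gamma>" for a z :: "('n, 'f) kp_poly"
    using that(2)
  proof (induction a rule: free_carrier_induct)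
    case (add x y)
    then show ?case
      using kp_eq_add[of "coef _ _ (x * z)" 0 "coef _ _ (y * z)" 0] by (simp add: distrib_right coef_simps)
  next
    case (mono c w)
    have "\<forall>i j. coef i j (wmono w * z) \<sim> 0"
      using mono
    proof (induction w)
      case (Cons g w)
      then have "g \<in> kp_gens \<Gamma>" by simp
      then obtain k k' and a :: "('m, 'f) kp_poly" where
        "\<And>i j x. coef i j (gen g * x) = (if i = k then a * coef k' j x else 0)"
        by (rule letter_cases[where ?'f = 'f]) blast
      then show ?case
        using Cons kp_eq_mult_left[of "coef k' _ (wmono w * z)" 0 a] by (simp add: wmono_Cons mult.assoc)
    qed (simp add: wmono_Nil that)
    then show ?case
      using kp_eq_scal[of "coef _ _ (wmono w * z)" 0 c] by (simp add: scal_mult_left coef_simps)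
  qed (simp add: coef_simps)
  have right: "\<forall>i j. coef i j (z * a) \<sim> 0"
    if "\<And>i j. coef i j z \<sim> 0" "a \<in> kp_carrier \<Gamma>" for a z :: "('n, 'f) kp_poly"
    using that(2)
  proof (induction a rule: free_carrier_induct)
    case (add x y)
    then show ?case
      using kp_eq_add[of "coef _ _ (z * x)" 0 "coef _ _ (z * y)" 0] by (simp add: distrib_left coef_simps)
  next
    case (mono c w)
    have "\<forall>i j. coef i j (z * wmono w) \<sim> 0"
      using mono that(1)
    proof (induction w arbitrary: z)
      case (Cons g w)
      then have "g \<in> kp_gens \<Gamma>" by simp
      then obtain k k' and a :: "('m, 'f) kp_poly" where
        "\<And>i j x. coef i j (x * gen g) = (if j = k' then coef i k x * a else 0)"
        by (rule letter_cases[where ?'f = 'f]) blast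
      then have "coef i j (z * gen g) \<sim> 0" for i j
        using kp_eq_mult_right[of "coef i k z" 0 a] Cons.prems(2) by simp
      then show ?case
        using Cons.IH[of "z * gen g"] Cons.prems(1) by (simp add: wmono_Cons mult.assoc)
    qed (simp add: wmono_Nil)
    then show ?case
      using kp_eq_scal[of "coef _ _ (z * wmono w)" 0 c] by (simp add: scal_mult_right coef_simps)
  qed (simp add: coef_simps)
  have "\<forall>i j. coef i j z \<sim> 0" if "z \<in> kp_ideal \<Gamma>" for z :: "('n, 'f) kp_poly"
    using that
  proof (induction z rule: total.kp_ideal_induct)
    case (add x y)
    then show ?case using kp_eq_add[of "coef _ _ x" 0 "coef _ _ y" 0] by (simp add: coef_simps)
  qed (auto simp: coef_simps coef_relator left right)
  moreover have "x - y \<in> kp_ideal \<Gamma>" using assms by (simp add: total.kp_eq_iff)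
  ultimately show ?thesis using coef_simps(2)[of i j x y] kp_eq_diff_zero by metis
qed

lemma coef_carrier:
  fixes x :: "('n, 'f::field) kp_poly"
  shows "x \<in> kp_carrier \<Gamma> \<Longrightarrow> coef i j x \<in> kp_carrier \<Lambda>"
proof (induction x arbitrary: i j rule: free_carrier_induct)
  case (mono c w)
  then have "coef i j (wmono w :: ('n, 'f) kp_poly) \<in> kp_carrier \<Lambda>"
  proof (induction w arbitrary: i)
    case (Cons g w)
    then have "g \<in> kp_gens \<Gamma>" by simp
    then obtain k k' and a :: "('m, 'f) kp_poly" where "a \<in> kp_aug \<Lambda>"
      "\<And>i j x. coef i j (gen g * x) = (if i = k then a * coef k' j x else 0)"
      by (rule letter_cases[where ?'f = 'f]) blast
    moreover from this have "a * coef k' j (wmono w :: ('n, 'f) kp_poly) \<in> kp_carrier \<Lambda>"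
      using Cons by (intro free_carrier_closed(2) aug_carrier_closed(1)[of a]) auto
    ultimately show ?case
      by (simp add: wmono_Cons zero_one_free_carrier)
  qed (auto simp: wmono_Nil coef_simps zero_one_free_carrier)
  then show ?case by (simp add: coef_simps free_carrier_scal)
qed (auto simp: coef_simps zero_one_free_carrier intro: free_carrier_closed)

lemma coef_aug:
  fixes x :: "('n, 'f::field) kp_poly"
  shows "x \<in> kp_aug \<Gamma> \<Longrightarrow> coef i j x \<in> kp_aug \<Lambda>"
proof (induction x rule: aug_carrier_induct)
  case (mono c w)
  then obtain g v where w: "w = g # v" by (cases w) auto
  with mono have "g \<in> kp_gens \<Gamma>" by simp
  then obtain k k' and a :: "('m, 'f) kp_poly" where a: "a \<in> kp_aug \<Lambda>"
    "\<And>i j x. coef i j (gen g * x) = (if i = k then a * coef k' j x else 0)"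
    by (rule letter_cases[where ?'f = 'f]) blast
  have "coef k' j (wmono v :: ('n, 'f) kp_poly) \<in> kp_carrier \<Lambda>"
    using mono w by (intro coef_carrier) auto
  then show ?case
    using a by (simp add: w wmono_Cons coef_simps aug_carrier_closed)
qed (auto simp: coef_simps aug_carrier_closed)

text \<open>
  The image of a generator has in row \<open>pt\<close> a single nonzero coefficient, in column \<open>pt\<close>, which is
  congruent to the generator. So the coefficients of the image of a word multiply up to the word.
\<close>

lemma coef_psi:
  fixes y :: "('m, 'f::field) kp_poly"
  shows "y \<in> kp_carrier \<Lambda> \<Longrightarrow> coef pt pt (psi y) \<sim> y"
proof (induction y rule: free_carrier_induct)
  case (mono c w)
  have "(coef pt pt (psi (wmono w :: ('m, 'f) kp_poly))) \<sim> wmono w"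
    using mono
  proof (induction w)
    case (Cons g w)
    let ?y = "psi (wmono w :: ('m, 'f) kp_poly)"
    have IH: "coef pt pt ?y \<sim> wmono w" using Cons by simp
    have "coef pt pt (corner_image g * ?y) \<sim> gen g * coef pt pt ?y"
    proof (cases g)
      case (Path \<alpha>)
      then have \<alpha>: "\<alpha> \<in> mor" using Cons.prems by (auto simp: kp_gens_def)
      have "coef pt pt (munit pt \<alpha> (src \<alpha>) pt * ?y) \<sim> fpath \<alpha> * ghost (src \<alpha>) * coef pt pt ?y"
        using coef_munit_mult[of \<alpha> "src \<alpha>" pt pt pt pt ?y] \<alpha>
        by (simp add: Src_closed Src_Src Rng_Src pt_Rng pt_Src)
      also have "\<dots> \<sim> fpath \<alpha> * coef pt pt ?y"
        using \<alpha> by (intro kp_eq_mult_right) (simp add: fghost_vert Src_vert kp_eq_units)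
      finally show ?thesis using Path by (simp add: fpath_def)
    next
      case (Ghost \<alpha>)
      then have \<alpha>: "\<alpha> \<in> mor" "deg \<alpha> \<noteq> 0" using Cons.prems by (auto simp: kp_gens_def)
      have "coef pt pt (munit pt (src \<alpha>) \<alpha> pt * ?y) \<sim> fpath (src \<alpha>) * ghost \<alpha> * coef pt pt ?y"
        using coef_munit_mult[of "src \<alpha>" \<alpha> pt pt pt pt ?y] \<alpha>
        by (simp add: Src_closed Src_Src Rng_Src pt_Rng pt_Src)
      also have "\<dots> \<sim> ghost \<alpha> * coef pt pt ?y"
        using \<alpha> by (intro kp_eq_mult_right kp_eq_units)
      finally show ?thesis using Ghost \<alpha> by (simp add: fghost_def)
    qed
    also have "\<dots> \<sim> gen g * wmono w"
      by (rule kp_eq_mult_left, rule IH)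
    finally show ?case by (simp add: wmono_Cons psi_simps) (simp add: psi_def)
  qed (simp add: wmono_Nil psi_simps coef_simps)
  then show ?case by (simp add: psi_simps coef_simps kp_eq_scal)
qed (auto simp: psi_simps coef_simps intro: kp_eq_add)

lemma psi_vert: "v \<in> verts \<Longrightarrow> psi (fpath v) = munit pt v v pt"
  by (simp add: psi_path Src_of_vert)

lemma munit_verts_mult:
  assumes "u \<in> verts" "v \<in> verts" "i \<in> fib u" "j \<in> fib u" "j' \<in> fib v"
  shows "munit i u u j * munit j' v v l \<approx> (if u = v \<and> j = j' then munit i u u l else 0)"
  using munit_mult[of u u v v i j j' l] assms
  by (auto simp: vert_Mor Src_of_vert Rng_of_vert vert_Deg)

text \<open>
  Move the matrix unit on the left through the word letter by letter; each letter turns into the image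
  of its entry. A letter that does not fit the row kills both sides.
\<close>

lemma compress_word:
  fixes w :: "'n kp_gen list"
  assumes "set w \<subseteq> kp_gens \<Gamma>" "v \<in> verts" "i \<in> fib v" "v' \<in> verts" "j \<in> fib v'"
  shows "(munit pt v v i * (wmono w :: ('n, 'f::field) kp_poly) * t v' j)
    \<approx> (psi (fpath v * coef i j (wmono w :: ('n, 'f) kp_poly) * fpath v') * munit pt v' v' j)"
  using assms
proof (induction w arbitrary: v i)
  case Nil
  have "munit pt v v i * t v' j \<approx> munit pt v v i * munit j v' v' j"
    using Nil by (intro total.kp_eq_mult_left total.kp_eq_sym[OF munit_vert])
  also have "\<dots> \<approx> (if v = v' \<and> i = j then munit pt v v j else 0)"
    using Nil by (intro munit_verts_mult) (auto simp: pt_fib)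
  finally have l: "munit pt v v i * t v' j \<approx> (if v = v' \<and> i = j then munit pt v v j else 0)" .
  have "psi (fpath v) * psi (fpath v') * munit pt v' v' j \<approx> psi (fpath v) * munit pt v' v' j"
    unfolding mult.assoc psi_vert[OF Nil(4)]
    using munit_verts_mult[of v' v' pt pt pt j] Nil by (intro total.kp_eq_mult_left) (simp add: pt_fib)
  also have "\<dots> \<approx> (if v = v' \<and> pt = pt then munit pt v v j else 0)"
    unfolding psi_vert[OF Nil(2)] using Nil by (intro munit_verts_mult) (auto simp: pt_fib)
  finally have r: "psi (fpath v) * psi (fpath v') * munit pt v' v' j \<approx> (if v = v' then munit pt v v j else 0)"
    by simp
  show ?case
  proof (cases "i = j")
    case True
    with l have "munit pt v v i * t v' j \<approx> (if v = v' then munit pt v v j else 0)" by simp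
    from total.kp_eq_trans[OF this total.kp_eq_sym[OF r]] show ?thesis
      using True by (simp add: wmono_Nil coef_simps psi_simps)
  next
    case False
    with l show ?thesis by (simp add: wmono_Nil coef_simps psi_simps)
  qed
next
  case (Cons g w)
  let ?w = "wmono w :: ('n, 'f) kp_poly"
  from Cons.prems have "g \<in> kp_gens \<Gamma>" by simp
  then obtain u k u' k' and a :: "('m, 'f) kp_poly" where
    u: "u \<in> verts" "k \<in> fib u" "u' \<in> verts" "k' \<in> fib u'" and a: "a \<in> kp_aug \<Lambda>"
    and th: "\<And>i j x. coef i j (gen g * x) = (if i = k then a * coef k' j x else 0)"
    and g: "t u k * gen g \<approx> (gen g :: ('n, 'f) kp_poly)"
    "munit pt u u k * gen g \<approx> psi a * munit pt u' u' k'"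
    and ua: "fpath u * a \<sim> a" "a * fpath u' \<sim> a"
    by (rule letter_cases[where ?'f = 'f]) blast
  have car: "a \<in> kp_carrier \<Lambda>" "fpath u * a \<in> kp_carrier \<Lambda>" "a * fpath u' \<in> kp_carrier \<Lambda>"
    using aug_carrier_closed(1)[OF a] u by (auto intro: free_carrier_closed(2) fpath_carrier vert_Mor)
  have pua: "psi (fpath u) * psi a \<approx> psi a" "psi a * psi (fpath u') \<approx> psi a"
    using psi_kp_eq[OF car(2,1) ua(1)] psi_kp_eq[OF car(3,1) ua(2)] by (simp_all add: psi_simps)
  show ?case
  proof (cases "v = u \<and> i = k")
    case True
    have "munit pt v v i * wmono (g # w) * t v' j \<approx> munit pt u u k * gen g * (?w * t v' j)"
      using True by (simp add: wmono_Cons mult.assoc)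
    also have "\<dots> \<approx> psi a * munit pt u' u' k' * (?w * t v' j)"
      by (intro total.kp_eq_mult_right g)
    also have "\<dots> = psi a * (munit pt u' u' k' * ?w * t v' j)"
      by (simp add: mult.assoc)
    also have "\<dots> \<approx> psi a * (psi (fpath u' * coef k' j ?w * fpath v') * munit pt v' v' j)"
      using Cons u by (intro total.kp_eq_mult_left Cons.IH) auto
    also have "\<dots> = (psi a * psi (fpath u')) * (psi (coef k' j ?w * fpath v') * munit pt v' v' j)"
      by (simp add: psi_simps mult.assoc)
    also have "\<dots> \<approx> psi a * (psi (coef k' j ?w * fpath v') * munit pt v' v' j)"
      by (intro total.kp_eq_mult_right pua)
    also have "\<dots> \<approx> (psi (fpath u) * psi a) * (psi (coef k' j ?w * fpath v') * munit pt v' v' j)"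
      by (intro total.kp_eq_mult_right total.kp_eq_sym[OF pua(1)])
    also have "\<dots> = psi (fpath v * coef i j (wmono (g # w) :: ('n, 'f) kp_poly) * fpath v') * munit pt v' v' j"
      using True by (simp add: wmono_Cons th psi_simps mult.assoc)
    finally show ?thesis .
  next
    case False
    have "munit pt v v i * t u k \<approx> munit pt v v i * munit k u u k"
      using u by (intro total.kp_eq_mult_left total.kp_eq_sym[OF munit_vert])
    also have "\<dots> \<approx> 0"
      using munit_verts_mult[of v u pt i k k] False Cons.prems u by (auto simp: pt_fib)
    finally have 0: "munit pt v v i * t u k \<approx> 0" .
    have "munit pt v v i * wmono (g # w) * t v' j \<approx> munit pt v v i * gen g * (?w * t v' j)"
      by (simp add: wmono_Cons mult.assoc)
    also have "\<dots> \<approx> munit pt v v i * (t u k * gen g) * (?w * t v' j)"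
      by (intro total.kp_eq_mult_right total.kp_eq_mult_left total.kp_eq_sym[OF g(1)])
    also have "\<dots> = (munit pt v v i * t u k) * (gen g * (?w * t v' j))"
      by (simp add: mult.assoc)
    also have "\<dots> \<approx> 0 * (gen g * (?w * t v' j))"
      by (intro total.kp_eq_mult_right 0)
    finally have l: "(munit pt v v i * (wmono (g # w) :: ('n, 'f) kp_poly) * t v' j) \<approx> 0" by simp
    have "(psi (fpath v * coef i j (wmono (g # w) :: ('n, 'f) kp_poly) * fpath v') * munit pt v' v' j) \<approx> 0"
    proof (cases "i = k")
      case True
      let ?z = "psi (coef k' j ?w * fpath v') * munit pt v' v' j"
      have "psi (fpath v * coef i j (wmono (g # w) :: ('n, 'f) kp_poly) * fpath v') * munit pt v' v' j =
          psi (fpath v) * psi a * ?z"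
        using True by (simp add: wmono_Cons th psi_simps mult.assoc)
      also have "\<dots> \<approx> psi (fpath v) * (psi (fpath u) * psi a) * ?z"
        by (intro total.kp_eq_mult_right total.kp_eq_mult_left total.kp_eq_sym[OF pua(1)])
      also have "\<dots> = (munit pt v v pt * munit pt u u pt) * (psi a * ?z)"
        using Cons.prems u by (simp add: psi_vert mult.assoc)
      also have "\<dots> \<approx> 0 * (psi a * ?z)"
        using munit_verts_mult[of v u pt pt pt pt] False True Cons.prems u
        by (intro total.kp_eq_mult_right) (auto simp: pt_fib)
      finally show ?thesis by simp
    qed (simp add: wmono_Cons th psi_simps)
    then show ?thesis by (rule total.kp_eq_trans[OF l total.kp_eq_sym])
  qed
qed

text \<open>
  For \<open>i = j = pt\<close> the matrix units are vertices.
\<close>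

lemma compress:
  fixes x :: "('n, 'f::field) kp_poly"
  assumes "x \<in> kp_carrier \<Gamma>" and v: "v \<in> verts" "v' \<in> verts"
  shows "t v pt * x * t v' pt \<approx> psi (fpath v * coef pt pt x * fpath v')"
  using assms(1)
proof (induction x rule: free_carrier_induct)
  case (add x y)
  then show ?case
    using total.kp_eq_add by (fastforce simp: distrib_left distrib_right coef_simps psi_simps)
next
  case (mono c w)
  let ?w = "wmono w :: ('n, 'f) kp_poly"
  have "t v pt * ?w * t v' pt \<approx> munit pt v v pt * ?w * t v' pt"
    using v by (intro total.kp_eq_mult_right total.kp_eq_sym[OF munit_vert] pt_fib)
  also have "\<dots> \<approx> psi (fpath v * coef pt pt ?w * fpath v') * munit pt v' v' pt"
    using v mono by (intro compress_word pt_fib)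
  also have "\<dots> = psi (fpath v * coef pt pt ?w) * (munit pt v' v' pt * munit pt v' v' pt)"
    using v by (simp add: psi_simps psi_vert mult.assoc)
  also have "\<dots> \<approx> psi (fpath v * coef pt pt ?w) * munit pt v' v' pt"
    using munit_verts_mult[of v' v' pt pt pt pt] v by (intro total.kp_eq_mult_left) (simp add: pt_fib)
  also have "\<dots> = psi (fpath v * coef pt pt ?w * fpath v')"
    using v by (simp add: psi_simps psi_vert)
  finally show ?case
    by (simp add: scal_mult_left scal_mult_right coef_simps psi_simps total.kp_eq_scal)
qed (simp add: coef_simps psi_simps)

definition base_verts :: "'n set" where
  "base_verts = {lift v pt | v. v \<in> verts}"

lemma base_verts_subset: "base_verts \<subseteq> kg_verts \<Gamma>"
  using lift_vert pt_fib by (auto simp: base_verts_def)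

text \<open>
  The set \<open>V'\<close> is enlarged by the base vertices over \<open>V\<close>, and \<open>V\<close> by the vertices under the base vertices
  in \<open>V'\<close>, so that the base vertices in \<open>V'\<close> are exactly those over \<open>V\<close>.
\<close>

lemma compatible_local_units:
  fixes x :: "('n, 'f::field) kp_poly" and y :: "('m, 'f) kp_poly"
  assumes "x \<in> kp_aug \<Gamma>" "y \<in> kp_aug \<Lambda>"
  obtains V V' where "finite V" "V \<subseteq> verts" "finite V'" "V' \<subseteq> kg_verts \<Gamma>"
    "(\<Sum>u\<in>V' \<inter> base_verts. fpath u) = (\<Sum>v\<in>V. (t v pt :: ('n, 'f) kp_poly))"
    "((\<Sum>u\<in>V'. fpath u) * x) \<approx> x" "(x * (\<Sum>u\<in>V'. fpath u)) \<approx> x"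
    "((\<Sum>v\<in>V. fpath v) * y) \<sim> y" "(y * (\<Sum>v\<in>V. fpath v)) \<sim> y"
proof -
  obtain V1 where V1: "finite V1" "V1 \<subseteq> kg_verts \<Gamma>" "\<And>V'. finite V' \<Longrightarrow> V1 \<subseteq> V' \<Longrightarrow> V' \<subseteq> kg_verts \<Gamma> \<Longrightarrow>
      ((\<Sum>v\<in>V'. fpath v) * x) \<approx> x \<and> (x * (\<Sum>v\<in>V'. fpath v)) \<approx> x"
    using total.local_units[OF assms(1)] by blast
  obtain V2 where V2: "finite V2" "V2 \<subseteq> verts" "\<And>V'. finite V' \<Longrightarrow> V2 \<subseteq> V' \<Longrightarrow> V' \<subseteq> verts \<Longrightarrow>
      ((\<Sum>v\<in>V'. fpath v) * y) \<sim> y \<and> (y * (\<Sum>v\<in>V'. fpath v)) \<sim> y"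
    using local_units[OF assms(2)] by blast
  have inj: "inj_on (\<lambda>v. lift v pt) (verts)"
    by (auto simp: inj_on_def lift_eq_iff vert_Mor Rng_of_vert pt_fib)
  define V where "V = V2 \<union> {v \<in> verts. lift v pt \<in> V1}"
  define V' where "V' = V1 \<union> (\<lambda>v. lift v pt) ` V"
  have "finite {v \<in> verts. lift v pt \<in> V1}"
    using finite_vimage_IntI[OF V1(1) inj] by (rule finite_subset[rotated]) auto
  then have V: "finite V" "V \<subseteq> verts" "V2 \<subseteq> V" using V2 by (auto simp: V_def)
  then have V': "finite V'" "V' \<subseteq> kg_verts \<Gamma>" "V1 \<subseteq> V'"
    using V1 lift_vert pt_fib by (auto simp: V'_def subset_iff)
  have "V' \<inter> base_verts = (\<lambda>v. lift v pt) ` V"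
    using V by (auto simp: V'_def V_def base_verts_def)
  then have "(\<Sum>u\<in>V' \<inter> base_verts. fpath u) = (\<Sum>v\<in>V. (t v pt :: ('n, 'f) kp_poly))"
    using inj_on_subset[OF inj V(2)] by (simp add: sum.reindex)
  then show thesis
    using that[OF V(1,2) V'(1,2)] V1(3)[OF V'(1,3,2)] V2(3)[OF V(1,3,2)] by blast
qed

text \<open>
  Only finitely many base vertices contribute, and \<open>compress\<close> applies to each pair of them. The images of
  the vertices under them add up to a unit for the coefficient.
\<close>

lemma corner_formula:
  fixes x :: "('n, 'f::field) kp_poly"
  assumes x: "x \<in> kp_aug \<Gamma>"
  shows "PX_left \<Gamma> base_verts (PX_right \<Gamma> base_verts (kp_class \<Gamma> x)) = kp_class \<Gamma> (psi (coef pt pt x))"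
proof -
  let ?y = "coef pt pt x"
  have y: "?y \<in> kp_aug \<Lambda>" by (rule coef_aug[OF x])
  obtain V V' where V: "finite V" "V \<subseteq> verts" "finite V'" "V' \<subseteq> kg_verts \<Gamma>"
    and sum_V: "(\<Sum>u\<in>V' \<inter> base_verts. fpath u) = (\<Sum>v\<in>V. (t v pt :: ('n, 'f) kp_poly))"
    and units: "((\<Sum>u\<in>V'. fpath u) * x) \<approx> x" "(x * (\<Sum>u\<in>V'. fpath u)) \<approx> x"
    "((\<Sum>v\<in>V. fpath v) * ?y) \<sim> ?y" "(?y * (\<Sum>v\<in>V. fpath v)) \<sim> ?y"
    using compatible_local_units[OF x y] .
  define P :: "('n, 'f) kp_poly" where "P = (\<Sum>v\<in>V. t v pt)"
  have P: "P \<in> kp_carrier \<Gamma>"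
    unfolding P_def using V by (intro free_carrier_sum fpath_carrier total.vert_Mor lift_vert pt_fib) auto
  have xP: "x * P \<in> kp_aug \<Gamma>" using x P by (rule aug_carrier_closed)
  have "PX_right \<Gamma> base_verts (kp_class \<Gamma> x) = kp_class \<Gamma> (x * P)"
    unfolding P_def sum_V[symmetric] by (rule total.PX_class(2)[OF x base_verts_subset V(3,4) units(2)])
  moreover have "((\<Sum>u\<in>V'. fpath u) * (x * P)) \<approx> x * P"
    using total.kp_eq_mult_right[OF units(1), of P] by (simp add: mult.assoc)
  then have "PX_left \<Gamma> base_verts (kp_class \<Gamma> (x * P)) = kp_class \<Gamma> (P * (x * P))"
    unfolding P_def[symmetric] sum_V[folded P_def, symmetric]
    by (intro total.PX_class(1)[OF _ base_verts_subset V(3,4)]) (simp_all add: sum_V xP flip: P_def)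
  moreover have "kp_class \<Gamma> (P * (x * P)) = kp_class \<Gamma> (psi ?y)"
  proof (subst total.kp_class_eq_iff)
    show "P * (x * P) \<in> kp_carrier \<Gamma>" by (rule free_carrier_closed(2)[OF P aug_carrier_closed(1)[OF xP]])
    show "psi ?y \<in> kp_carrier \<Gamma>" using y by (intro psi_carrier aug_carrier_closed(1))
    let ?e = "\<Sum>v\<in>V. fpath v :: ('m, 'f) kp_poly"
    have e: "?e \<in> kp_carrier \<Lambda>" using V by (intro free_carrier_sum fpath_carrier vert_Mor) auto
    have "P * (x * P) = (\<Sum>v\<in>V. \<Sum>v'\<in>V. t v pt * x * t v' pt)"
      by (simp add: P_def sum_distrib_left sum_distrib_right mult.assoc) (rule sum.swap)
    also have "\<dots> \<approx> (\<Sum>v\<in>V. \<Sum>v'\<in>V. psi (fpath v * ?y * fpath v'))"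
      using V x by (intro total.kp_eq_sum compress aug_carrier_closed(1)) auto
    also have "\<dots> = psi (?e * ?y * ?e)"
      by (simp add: psi_simps sum_distrib_left sum_distrib_right mult.assoc) (rule sum.swap)
    also have "\<dots> \<approx> psi ?y"
    proof (rule psi_kp_eq)
      show "?e * ?y * ?e \<in> kp_carrier \<Lambda>" "?y \<in> kp_carrier \<Lambda>"
        using e y by (auto intro: free_carrier_closed(2) aug_carrier_closed(1))
      show "?e * ?y * ?e \<sim> ?y"
        using kp_eq_trans[OF kp_eq_mult_right[OF units(3)] units(4)] .
    qed
    finally show "P * (x * P) \<approx> psi ?y" .
  qed
  ultimately show ?thesis by simp
qed

text \<open>
  Diagonal elements commute with sums of vertices, so that compression from the left alone is
  compression from both sides.
\<close>

lemma PX_left_diagonal: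
  fixes x :: "('n, 'f::field) kp_poly"
  assumes "x \<in> free.span {fpath \<gamma> * fghost \<Gamma> \<gamma> | \<gamma>. \<gamma> \<in> Mor \<Gamma>}" and x: "x \<in> kp_aug \<Gamma>"
  shows "PX_left \<Gamma> base_verts (kp_class \<Gamma> x) = PX_left \<Gamma> base_verts (PX_right \<Gamma> base_verts (kp_class \<Gamma> x))"
proof -
  obtain V V' where V: "finite V" "V \<subseteq> verts" "finite V'" "V' \<subseteq> kg_verts \<Gamma>"
    and units: "((\<Sum>u\<in>V'. fpath u) * x) \<approx> x" "(x * (\<Sum>u\<in>V'. fpath u)) \<approx> x"
    using compatible_local_units[OF x coef_aug[OF x]] .
  define P :: "('n, 'f) kp_poly" where "P = (\<Sum>u\<in>V' \<inter> base_verts. fpath u)"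
  have P: "P \<in> kp_carrier \<Gamma>"
    unfolding P_def using V by (intro free_carrier_sum fpath_carrier total.vert_Mor) auto
  have xP: "x * P \<in> kp_aug \<Gamma>" using x P by (rule aug_carrier_closed)
  have commute: "P * x \<approx> x * P"
    using assms(1)
  proof (induction x rule: free.span_induct_alt)
    case (step c z y)
    then obtain \<gamma> where z: "z = fpath \<gamma> * fghost \<Gamma> \<gamma>" "\<gamma> \<in> Mor \<Gamma>" by blast
    have "P * z \<approx> z * P"
      unfolding P_def z(1) sum_distrib_left sum_distrib_right using V z(2)
      by (intro total.kp_eq_sum total.kp_eq_vert_diagonal) auto
    then show ?case
      using step by (simp add: distrib_left distrib_right scal_mult_left scal_mult_right total.kp_eq_add total.kp_eq_scal)
  qed simp
  have idem: "P * P \<approx> P"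
    unfolding P_def using V by (intro total.kp_eq_vert_sum_idem) auto
  have "PX_left \<Gamma> base_verts (kp_class \<Gamma> x) = kp_class \<Gamma> (P * x)"
    unfolding P_def by (rule total.PX_class(1)[OF x base_verts_subset V(3,4) units(1)])
  also have "\<dots> = kp_class \<Gamma> (P * (x * P))"
  proof (subst total.kp_class_eq_iff)
    show "P * x \<in> kp_carrier \<Gamma>" "P * (x * P) \<in> kp_carrier \<Gamma>"
      using P x xP by (auto intro: free_carrier_closed(2) aug_carrier_closed(1))
    have "P * (x * P) \<approx> P * (P * x)"
      by (rule total.kp_eq_mult_left, rule total.kp_eq_sym, rule commute)
    also have "\<dots> \<approx> P * x"
      using total.kp_eq_mult_right[OF idem, of x] by (simp add: mult.assoc)
    finally show "P * x \<approx> P * (x * P)" by (rule total.kp_eq_sym)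
  qed
  also have "\<dots> = PX_left \<Gamma> base_verts (kp_class \<Gamma> (x * P))"
  proof -
    have "((\<Sum>u\<in>V'. fpath u) * (x * P)) \<approx> x * P"
      using total.kp_eq_mult_right[OF units(1), of P] by (simp add: mult.assoc)
    from total.PX_class(1)[OF xP base_verts_subset V(3,4) this] show ?thesis by (simp add: P_def)
  qed
  also have "kp_class \<Gamma> (x * P) = PX_right \<Gamma> base_verts (kp_class \<Gamma> x)"
    unfolding P_def by (rule total.PX_class(2)[OF x base_verts_subset V(3,4) units(2), symmetric])
  finally show ?thesis .
qed

section \<open>The isomorphism onto the corner\<close>

text \<open>
  The choice of the representative is immaterial by \<open>psi_kp_eq\<close>.
\<close>

definition corner_iso :: "('m, 'f::field) kp_poly set \<Rightarrow> ('n, 'f) kp_poly set" where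
  "corner_iso a = kp_class \<Gamma> (psi (SOME x. x \<in> kp_aug \<Lambda> \<and> cls x = a))"

lemma corner_iso_class:
  fixes x :: "('m, 'f::field) kp_poly"
  assumes "x \<in> kp_aug \<Lambda>"
  shows "corner_iso (cls x) = kp_class \<Gamma> (psi x)"
proof -
  define x' where "x' = (SOME x'. x' \<in> kp_aug \<Lambda> \<and> cls x' = cls x)"
  have x': "x' \<in> kp_aug \<Lambda> \<and> cls x' = cls x"
    unfolding x'_def by (rule someI[of _ x]) (use assms in auto)
  then have "psi x' \<approx> psi x"
    using assms kp_class_eq_iff[of x' x] by (intro psi_kp_eq) (auto intro: aug_carrier_closed(1))
  then show ?thesis
    using x' assms unfolding corner_iso_def x'_def[symmetric]
    by (subst total.kp_class_eq_iff) (auto intro: aug_carrier_closed(1) psi_aug)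
qed

lemma corner_formula_iso:
  fixes x :: "('n, 'f::field) kp_poly"
  assumes "x \<in> kp_aug \<Gamma>"
  shows "PX_left \<Gamma> base_verts (PX_right \<Gamma> base_verts (kp_class \<Gamma> x)) = corner_iso (cls (coef pt pt x))"
  by (simp add: assms corner_formula corner_iso_class coef_aug)

lemma coef_psi_class:
  fixes y :: "('m, 'f::field) kp_poly"
  assumes "y \<in> kp_aug \<Lambda>"
  shows "cls (coef pt pt (psi y)) = cls y"
  using assms coef_psi[of y]
  by (subst kp_class_eq_iff) (auto intro: aug_carrier_closed(1) psi_aug coef_aug)

lemma corner_carrier:
  "carrier (KP_corner \<Gamma> base_verts :: ('f::field, ('n, 'f) kp_poly set) module) =
   corner_iso ` carrier (KP \<Lambda>)"
proof (intro equalityI subsetI)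
  fix a :: "('n, 'f) kp_poly set"
  assume "a \<in> carrier (KP_corner \<Gamma> base_verts)"
  then obtain x where "x \<in> kp_aug \<Gamma>" "a = PX_left \<Gamma> base_verts (PX_right \<Gamma> base_verts (kp_class \<Gamma> x))"
    by (auto simp: KP_corner_def corner_set_def total.KP_carrier)
  then show "a \<in> corner_iso ` carrier (KP \<Lambda>)"
    by (auto simp: corner_formula_iso KP_carrier coef_aug)
next
  fix a :: "('n, 'f) kp_poly set"
  assume "a \<in> corner_iso ` carrier (KP \<Lambda>)"
  then obtain y :: "('m, 'f) kp_poly" where y: "y \<in> kp_aug \<Lambda>" "a = corner_iso (cls y)"
    by (auto simp: KP_carrier)
  then have "a = PX_left \<Gamma> base_verts (PX_right \<Gamma> base_verts (kp_class \<Gamma> (psi y)))"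
    by (simp add: corner_formula_iso psi_aug coef_psi_class)
  then show "a \<in> carrier (KP_corner \<Gamma> base_verts)"
    using y by (auto simp: KP_corner_def corner_set_def total.KP_carrier psi_aug)
qed

lemma corner_iso_alg_iso:
  "corner_iso \<in> alg_iso (KP \<Lambda> :: ('f::field, _) module) (KP_corner \<Gamma> base_verts)"
proof -
  let ?A = "KP \<Lambda> :: ('f, ('m, 'f) kp_poly set) module"
  have inj: "inj_on corner_iso (carrier ?A)"
  proof (rule inj_onI)
    fix a a' assume "a \<in> carrier ?A" "a' \<in> carrier ?A" and eq: "corner_iso a = corner_iso a'"
    then obtain x y :: "('m, 'f) kp_poly" where xy: "x \<in> kp_aug \<Lambda>" "a = cls x" "y \<in> kp_aug \<Lambda>" "a' = cls y"
      by (auto simp: KP_carrier)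
    note psi_xy = aug_carrier_closed(1)[OF psi_aug[OF xy(1)]] aug_carrier_closed(1)[OF psi_aug[OF xy(3)]]
    have "psi x \<approx> psi y"
      using eq xy by (simp add: corner_iso_class total.kp_class_eq_iff[OF psi_xy])
    then have "coef pt pt (psi x) \<sim> coef pt pt (psi y)"
      by (rule coef_kp_eq[OF psi_xy])
    then have "cls (coef pt pt (psi x)) = cls (coef pt pt (psi y))"
      by (subst kp_class_eq_iff) (auto intro: coef_carrier psi_xy)
    then show "a = a'" using xy by (simp add: coef_psi_class)
  qed
  have bij: "bij_betw corner_iso (carrier ?A) (carrier (KP_corner \<Gamma> base_verts))"
    using inj by (simp add: bij_betw_def corner_carrier)
  have closed: "corner_iso a \<in> carrier (KP_corner \<Gamma> base_verts)" if "a \<in> carrier ?A" for a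
    using that by (simp add: corner_carrier)
  have ops: "corner_iso (a \<otimes>\<^bsub>?A\<^esub> a') = corner_iso a \<otimes>\<^bsub>KP \<Gamma>\<^esub> corner_iso a'"
    "corner_iso (a \<oplus>\<^bsub>?A\<^esub> a') = corner_iso a \<oplus>\<^bsub>KP \<Gamma>\<^esub> corner_iso a'"
    "corner_iso (c \<odot>\<^bsub>?A\<^esub> a) = c \<odot>\<^bsub>KP \<Gamma>\<^esub> corner_iso a"
    if "a \<in> carrier ?A" "a' \<in> carrier ?A" for a a' c
  proof -
    from that obtain x y :: "('m, 'f) kp_poly" where xy: "x \<in> kp_aug \<Lambda>" "a = cls x" "y \<in> kp_aug \<Lambda>" "a' = cls y"
      by (auto simp: KP_carrier)
    then have xy_car: "x \<in> kp_carrier \<Lambda>" "y \<in> kp_carrier \<Lambda>" by (auto intro: aug_carrier_closed(1))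
    then have psi_xy: "psi x \<in> kp_carrier \<Gamma>" "psi y \<in> kp_carrier \<Gamma>" by (auto intro: psi_carrier)
    have "x * y \<in> kp_aug \<Lambda>" "x + y \<in> kp_aug \<Lambda>" "scal c x \<in> kp_aug \<Lambda>"
      using xy xy_car by (auto intro: aug_carrier_closed)
    then show "corner_iso (a \<otimes>\<^bsub>?A\<^esub> a') = corner_iso a \<otimes>\<^bsub>KP \<Gamma>\<^esub> corner_iso a'"
      "corner_iso (a \<oplus>\<^bsub>?A\<^esub> a') = corner_iso a \<oplus>\<^bsub>KP \<Gamma>\<^esub> corner_iso a'"
      "corner_iso (c \<odot>\<^bsub>?A\<^esub> a) = c \<odot>\<^bsub>KP \<Gamma>\<^esub> corner_iso a"
      using xy xy_car psi_xy
      by (simp_all add: KP_ops[OF xy_car] KP_ops(3)[OF xy_car(1,1)] total.KP_ops[OF psi_xy] total.KP_ops(3)[OF psi_xy(1,1)]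
          corner_iso_class psi_simps)
  qed
  show ?thesis
    unfolding alg_iso_def iso_def hom_def using bij closed ops
    by (auto simp: KP_corner_def)
qed

text \<open>
  On both sides the element is \<open>psi\<close> of an element of \<Lambda>: of a member of the span of \<open>S\<close> on the left, and of
  the coefficient of a member of the span of \<open>S'\<close> on the right.
\<close>

lemma corner_iso_span:
  fixes S :: "('m, 'f::field) kp_poly set" and S' :: "('n, 'f) kp_poly set"
  assumes S: "S \<subseteq> kp_aug \<Lambda>" and S': "S' \<subseteq> kp_aug \<Gamma>"
    and fwd: "\<And>s. s \<in> S' \<Longrightarrow> \<exists>y\<in>free.span S. coef pt pt s \<sim> y"
    and bwd: "\<And>s. s \<in> S \<Longrightarrow> \<exists>x\<in>free.span S'. coef pt pt x \<sim> s"
  shows "corner_iso ` alg_span (KP \<Lambda>) (cls ` S) =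
    corner_set \<Gamma> base_verts (alg_span (KP \<Gamma>) (kp_class \<Gamma> ` S'))"
proof -
  have aug: "free.span S \<subseteq> kp_aug \<Lambda>" "free.span S' \<subseteq> kp_aug \<Gamma>"
    using S S' by (intro free.span_minimal; simp add: free.subspace_def aug_carrier_closed)+
  have car: "S \<subseteq> kp_carrier \<Lambda>" "S' \<subseteq> kp_carrier \<Gamma>"
    using S S' by (auto intro: aug_carrier_closed(1))
  have class_eq: "cls (coef pt pt x) = cls y"
    if "x \<in> free.span S'" "y \<in> free.span S" "coef pt pt x \<sim> y" for x y
    using that aug by (subst kp_class_eq_iff) (auto intro: aug_carrier_closed(1) coef_aug)
  have "corner_set \<Gamma> base_verts (kp_class \<Gamma> ` free.span S') =
      (\<lambda>x. corner_iso (cls (coef pt pt x))) ` free.span S'"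
    unfolding corner_set_def image_image using aug by (intro image_cong refl) (auto simp: corner_formula_iso)
  also have "\<dots> = (\<lambda>y. corner_iso (cls y)) ` free.span S"
  proof (intro equalityI subsetI)
    fix a assume "a \<in> (\<lambda>x. corner_iso (cls (coef pt pt x))) ` free.span S'"
    then obtain x where x: "x \<in> free.span S'" "a = corner_iso (cls (coef pt pt x))" by blast
    then obtain y where "y \<in> free.span S" "coef pt pt x \<sim> y"
      using span_related[of "\<lambda>x y. coef pt pt x \<sim> y" S' S x] fwd
      by (auto simp: coef_simps kp_eq_add kp_eq_scal)
    then show "a \<in> (\<lambda>y. corner_iso (cls y)) ` free.span S"
      using class_eq[OF x(1)] x(2) by auto
  next
    fix a assume "a \<in> (\<lambda>y. corner_iso (cls y)) ` free.span S"
    then obtain y where y: "y \<in> free.span S" "a = corner_iso (cls y)" by blast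
    then obtain x where x: "x \<in> free.span S'" "coef pt pt x \<sim> y"
      using span_related[of "\<lambda>y x. coef pt pt x \<sim> y" S S' y] bwd
      by (auto simp: coef_simps kp_eq_add kp_eq_scal)
    then show "a \<in> (\<lambda>x. corner_iso (cls (coef pt pt x))) ` free.span S'"
      using class_eq[OF x(1) y(1) x(2)] y(2) by (intro image_eqI[of _ _ x]) auto
  qed
  finally show ?thesis
    by (simp add: alg_span_KP(1)[OF car(1)] total.alg_span_KP(1)[OF car(2)] image_image)
qed

text \<open>
  The coefficient of a spanning element for \<Gamma> is zero or the element for \<Lambda> below it. For the converse,
  the lifts of \<alpha> and \<mu> with index \<open>pt\<close> need not have the same source, but after extending both by
  the paths of degree \<open>B\<close> they do.
\<close>

lemma corner_iso_component:
  "corner_iso ` kp_component \<Lambda> n =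
   corner_set \<Gamma> base_verts (kp_component \<Gamma> n :: ('n, 'f::field) kp_poly set set)"
  unfolding kp_component_class total.kp_component_class
proof (rule corner_iso_span)
  let ?S = "{fpath \<alpha> * ghost \<mu> :: ('m, 'f) kp_poly | \<alpha> \<mu>.
     \<alpha> \<in> mor \<and> \<mu> \<in> mor \<and> int_deg (deg \<alpha>) - int_deg (deg \<mu>) = n}"
  let ?S' = "{fpath \<alpha> * fghost \<Gamma> \<mu> :: ('n, 'f) kp_poly | \<alpha> \<mu>.
     \<alpha> \<in> Mor \<Gamma> \<and> \<mu> \<in> Mor \<Gamma> \<and> int_deg (Deg \<Gamma> \<alpha>) - int_deg (Deg \<Gamma> \<mu>) = n}"
  show "?S \<subseteq> kp_aug \<Lambda>" "?S' \<subseteq> kp_aug \<Gamma>"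
    by (auto intro!: aug_carrier_closed(6) fpath_aug fghost_carrier total.fpath_aug)
  {
    fix s assume "s \<in> ?S'"
    then obtain \<gamma> \<delta> where s: "s = fpath \<gamma> * fghost \<Gamma> \<delta>" and gd: "\<gamma> \<in> Mor \<Gamma>" "\<delta> \<in> Mor \<Gamma>"
      "int_deg (Deg \<Gamma> \<gamma>) - int_deg (Deg \<Gamma> \<delta>) = n" by blast
    from gd(1,2) obtain \<alpha> i \<mu> j where *: "\<gamma> = lift \<alpha> i" "\<alpha> \<in> mor" "i \<in> fib (rng \<alpha>)"
      "\<delta> = lift \<mu> j" "\<mu> \<in> mor" "j \<in> fib (rng \<mu>)" by (elim Mor_totalE)
    then have "fpath \<alpha> * ghost \<mu> \<in> free.span ?S" using gd by (intro free.span_base) (auto simp: Deg_lift)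
    moreover have "coef pt pt s = fpath \<alpha> * ghost \<mu> \<or> coef pt pt s = 0"
      using * s by (auto simp: coef_t_mult coef_t)
    ultimately have "coef pt pt s \<in> free.span ?S"
      by (elim disjE) (simp_all only: free.span_zero)
    then show "\<exists>y\<in>free.span ?S. coef pt pt s \<sim> y"
      by (rule bexI[rotated]) (rule kp_eq_refl)
  next
    fix s assume "s \<in> ?S"
    then obtain \<alpha> \<mu> where s: "s = fpath \<alpha> * ghost \<mu>" and am: "\<alpha> \<in> mor" "\<mu> \<in> mor"
      "int_deg (deg \<alpha>) - int_deg (deg \<mu>) = n" by blast
    show "\<exists>x\<in>free.span ?S'. coef pt pt x \<sim> s"
    proof (cases "src \<alpha> = src \<mu>")
      case True
      have "t (cmp \<alpha> \<phi>) pt * ts (cmp \<mu> \<phi>) pt \<in> ?S'" if "\<phi> \<in> into_B (src \<alpha>)" for \<phi>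
      proof -
        have "int_deg (deg \<alpha> + deg \<phi>) - int_deg (deg \<mu> + deg \<phi>) = n"
          using am(3) by (simp add: int_deg_def vec_eq_iff)
        moreover have C: "cmp \<alpha> \<phi> \<in> mor" "cmp \<mu> \<phi> \<in> mor"
          "deg (cmp \<alpha> \<phi>) = deg \<alpha> + deg \<phi>" "deg (cmp \<mu> \<phi>) = deg \<mu> + deg \<phi>"
          using that am True by (simp_all add: paths_into_def Cmp_closed Deg_Cmp)
        moreover have "lift (cmp \<alpha> \<phi>) pt \<in> Mor \<Gamma>" "lift (cmp \<mu> \<phi>) pt \<in> Mor \<Gamma>"
          "Deg \<Gamma> (lift (cmp \<alpha> \<phi>) pt) = deg (cmp \<alpha> \<phi>)"
          "Deg \<Gamma> (lift (cmp \<mu> \<phi>) pt) = deg (cmp \<mu> \<phi>)"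
          using C(1,2) by (simp_all add: lift_Mor Deg_lift pt_Rng)
        ultimately show ?thesis
          by (intro CollectI exI[of _ "lift (cmp \<alpha> \<phi>) pt"] exI[of _ "lift (cmp \<mu> \<phi>) pt"]) simp
      qed
      then have "munit pt \<alpha> \<mu> pt \<in> free.span ?S'"
        unfolding munit_def by (intro free.span_sum free.span_base)
      moreover have "coef pt pt (munit pt \<alpha> \<mu> pt) \<sim> s"
        using coef_munit_mult[of \<alpha> \<mu> pt pt pt pt 1] am True s by (simp add: coef_simps pt_Rng)
      ultimately show ?thesis by blast
    next
      case False
      then show ?thesis
        using kp_eq_sym[OF kp_eq_path_ghost_zero[OF am(1,2)]] s
        by (intro bexI[of _ 0]) (auto simp: coef_simps free.span_zero)
    qed
  }
qed

lemma corner_iso_diagonal: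
  "corner_iso ` kp_diagonal \<Lambda> =
   PX_left \<Gamma> base_verts ` (kp_diagonal \<Gamma> :: ('n, 'f::field) kp_poly set set)"
proof -
  let ?S = "{fpath \<alpha> * ghost \<alpha> :: ('m, 'f) kp_poly | \<alpha>. \<alpha> \<in> mor}"
  let ?S' = "{fpath \<alpha> * fghost \<Gamma> \<alpha> :: ('n, 'f) kp_poly | \<alpha>. \<alpha> \<in> Mor \<Gamma>}"
  have S: "?S \<subseteq> kp_aug \<Lambda>" "?S' \<subseteq> kp_aug \<Gamma>"
    by (auto intro!: aug_carrier_closed(6) fpath_aug fghost_carrier total.fpath_aug)
  have "corner_iso ` kp_diagonal \<Lambda> =
      corner_set \<Gamma> base_verts (kp_diagonal \<Gamma> :: ('n, 'f) kp_poly set set)"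
    unfolding kp_diagonal_class total.kp_diagonal_class
  proof (rule corner_iso_span[OF S])
    fix s assume "s \<in> ?S'"
    then obtain \<alpha> i where *: "s = t \<alpha> i * ts \<alpha> i" "\<alpha> \<in> mor" "i \<in> fib (rng \<alpha>)"
      by (auto elim!: Mor_totalE)
    then have "fpath \<alpha> * ghost \<alpha> \<in> free.span ?S" by (intro free.span_base) blast
    moreover have "coef pt pt s = fpath \<alpha> * ghost \<alpha> \<or> coef pt pt s = 0"
      using * by (auto simp: coef_t_mult coef_t)
    ultimately have "coef pt pt s \<in> free.span ?S"
      by (elim disjE) (simp_all only: free.span_zero)
    then show "\<exists>y\<in>free.span ?S. coef pt pt s \<sim> y"
      by (rule bexI[rotated]) (rule kp_eq_refl)
  next
    fix s assume "s \<in> ?S"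
    then obtain \<alpha> where s: "s = fpath \<alpha> * ghost \<alpha>" "\<alpha> \<in> mor" by blast
    then have "coef pt pt (t \<alpha> pt * ts \<alpha> pt) = s" by (simp add: coef_t_mult coef_t pt_Rng)
    moreover have "t \<alpha> pt * ts \<alpha> pt \<in> ?S'" using lift_Mor[OF s(2) pt_Rng[OF s(2)]] by blast
    ultimately show "\<exists>x\<in>free.span ?S'. coef pt pt x \<sim> s"
      by (intro bexI[of _ "t \<alpha> pt * ts \<alpha> pt"] free.span_base) simp_all
  qed
  also have "\<dots> = PX_left \<Gamma> base_verts ` kp_diagonal \<Gamma>"
    unfolding corner_set_def
  proof (rule image_cong[OF refl])
    fix a :: "('n, 'f) kp_poly set" assume "a \<in> kp_diagonal \<Gamma>"
    moreover have car: "?S' \<subseteq> kp_carrier \<Gamma>" using S(2) by (auto intro: aug_carrier_closed(1))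
    moreover have "free.span ?S' \<subseteq> kp_aug \<Gamma>"
      using S(2) by (intro free.span_minimal) (simp_all add: free.subspace_def aug_carrier_closed)
    ultimately obtain x where "a = kp_class \<Gamma> x" "x \<in> free.span ?S'" "x \<in> kp_aug \<Gamma>"
      unfolding total.kp_diagonal_class total.alg_span_KP(1)[OF car] by blast
    then show "PX_left \<Gamma> base_verts (PX_right \<Gamma> base_verts a) = PX_left \<Gamma> base_verts a"
      using PX_left_diagonal[of x] by simp
  qed
  finally show ?thesis .
qed

theorem corner_isomorphism:
  "\<exists>\<psi>\<in>alg_iso (KP \<Lambda> :: ('f::field, _) module) (KP_corner \<Gamma> {lift v pt | v. v \<in> verts}).
     (\<forall>n. \<psi> ` kp_component \<Lambda> n = corner_set \<Gamma> {lift v pt | v. v \<in> verts} (kp_component \<Gamma> n)) \<and>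
     \<psi> ` kp_diagonal \<Lambda> = PX_left \<Gamma> {lift v pt | v. v \<in> verts} ` kp_diagonal \<Gamma>"
  using corner_iso_alg_iso corner_iso_component corner_iso_diagonal
  unfolding base_verts_def[symmetric] by blast

end

section \<open>Transport of parts along edges\<close>

text \<open>
  A set with \<open>n\<close> elements has no room for two in one of \<open>n\<close> nonempty parts.
\<close>

lemma card_partition_singletons:
  assumes "disjoint_family_on A {1..n :: nat}" "\<forall>i\<in>{1..n}. A i \<noteq> {}"
    and fin: "finite (\<Union>i\<in>{1..n}. A i)" and card: "card (\<Union>i\<in>{1..n}. A i) = n"
    and "i \<in> {1..n}" "x \<in> A i" "y \<in> A i"
  shows "x = y"
proof -
  have finA: "finite (A j)" if "j \<in> {1..n}" for j
    using that by (intro finite_subset[OF _ fin]) blast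
  have "(\<Sum>j\<in>{1..n}. card (A j)) = (\<Sum>j\<in>{1..n}. 1)"
    using card_UN_disjoint[of "{1..n}" A] assms(1) finA card by (simp add: disjoint_family_on_def)
  moreover have "1 \<le> card (A j)" if "j \<in> {1..n}" for j
    using that assms(2) finA[OF that] by (simp add: card_gt_0_iff Suc_le_eq)
  ultimately have "card (A i) = 1"
    using assms(5) sum_mono_inv[of "\<lambda>_. 1" "{1..n}" "\<lambda>j. card (A j)" i] by force
  then show ?thesis
    using assms(6,7) by (auto simp: card_1_singleton_iff)
qed

context k_graph
begin

lemma kg_edges_iff: "e \<in> kg_edges \<Lambda> \<longleftrightarrow> e \<in> mor \<and> (\<exists>c. deg e = basis_deg c)"
proof -
  have "(\<Sum>i\<in>UNIV. n $ i) = 1 \<longleftrightarrow> (\<exists>c. n = basis_deg c)" for n :: "nat ^ 'k"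
  proof -
    have "(\<Sum>i\<in>UNIV. n $ i) = 1 \<longleftrightarrow> (\<exists>c. n $ c = 1 \<and> (\<forall>i. c \<noteq> i \<longrightarrow> n $ i = 0))"
      by (subst sum_eq_1_iff) auto
    also have "\<dots> \<longleftrightarrow> (\<exists>c. n = basis_deg c)"
      unfolding vec_eq_iff axis_def by (intro ex_cong1) auto
    finally show ?thesis .
  qed
  then show ?thesis by (simp add: kg_edges_def)
qed

lemma suffix_of_Cmp_left:
  assumes "\<alpha> \<in> mor" "\<gamma> \<in> mor" "src \<alpha> = rng \<gamma>" "deg \<gamma> = m + n"
  shows "suffix_of \<Lambda> n (cmp \<alpha> \<gamma>) = suffix_of \<Lambda> n \<gamma>"
proof -
  from assms(2,4) obtain \<mu> \<nu> where f: "\<mu> \<in> mor" "\<nu> \<in> mor" "src \<mu> = rng \<nu>" "\<gamma> = cmp \<mu> \<nu>" "deg \<nu> = n"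
    by (rule factorise)
  then have "src \<alpha> = rng \<mu>" using assms(3) by (simp add: Rng_Cmp)
  then show ?thesis
    using f assms(1) suffix_of_Cmp[of \<mu> \<nu>] suffix_of_Cmp[of "cmp \<alpha> \<mu>" \<nu>]
    by (simp add: Cmp_assoc[symmetric] Cmp_closed Src_Cmp)
qed

lemma suffix_of_self: "\<alpha> \<in> mor \<Longrightarrow> suffix_of \<Lambda> (deg \<alpha>) \<alpha> = \<alpha>"
  using suffix_of_Cmp[of "rng \<alpha>" \<alpha>] by (simp add: Rng_closed Src_Rng Cmp_Rng)

primrec edge_path :: "'m \<Rightarrow> 'm list \<Rightarrow> 'm \<Rightarrow> bool" where
  "edge_path x [] y \<longleftrightarrow> x \<in> verts \<and> x = y"
| "edge_path x (e # es) y \<longleftrightarrow> e \<in> kg_edges \<Lambda> \<and> rng e = x \<and> edge_path (src e) es y"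

abbreviation compose :: "'m list \<Rightarrow> 'm \<Rightarrow> 'm" where
  "compose es y \<equiv> foldr (cmp) es y"

lemma edge_Mor: "e \<in> kg_edges \<Lambda> \<Longrightarrow> e \<in> mor"
  by (simp add: kg_edges_def)

lemma edge_path_compose:
  assumes "edge_path x es y"
  shows "compose es y \<in> mor \<and> rng (compose es y) = x \<and> src (compose es y) = y \<and>
    deg (compose es y) = (\<Sum>e\<leftarrow>es. deg e) \<and> x \<in> verts"
  using assms
proof (induction es arbitrary: x)
  case Nil
  then show ?case by (auto simp: vert_Mor Rng_of_vert Src_of_vert vert_Deg)
next
  case (Cons e es)
  then have e: "e \<in> mor" "rng e = x" "edge_path (src e) es y" by (auto simp: edge_Mor)
  from Cons.IH[OF e(3)] e show ?case
    by (auto simp: Cmp_closed Rng_Cmp Src_Cmp Deg_Cmp Rng_vert)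
qed

lemma compose_append:
  "edge_path x es y \<Longrightarrow> edge_path y es' z \<Longrightarrow> compose (es @ es') z = cmp (compose es y) (compose es' z)"
proof (induction es arbitrary: x)
  case Nil
  then show ?case using edge_path_compose[of y es' z] Cmp_Rng[of "compose es' z"] by simp
next
  case (Cons e es)
  then have e: "e \<in> mor" "rng e = x" "edge_path (src e) es y" by (auto simp: edge_Mor)
  with Cons show ?case
    using edge_path_compose[OF e(3)] edge_path_compose[OF Cons.prems(2)]
    by (simp add: Cmp_assoc)
qed

lemma edge_path_exists:
  "\<alpha> \<in> mor \<Longrightarrow> \<exists>es. edge_path (rng \<alpha>) es (src \<alpha>) \<and> compose es (src \<alpha>) = \<alpha>"
proof (induction "deg \<alpha>" arbitrary: \<alpha> rule: degree_induct)
  case zero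
  then have "\<alpha> \<in> verts" by (simp add: kg_verts_def)
  then show ?case by (intro exI[of _ "[]"]) (simp add: Rng_of_vert Src_of_vert)
next
  case (step n i)
  from step(3) step(2)[symmetric] obtain \<mu> \<nu> where f: "\<mu> \<in> mor" "\<nu> \<in> mor" "src \<mu> = rng \<nu>" "\<alpha> = cmp \<mu> \<nu>"
    "deg \<mu> = basis_deg i" "deg \<nu> = n" by (rule factorise)
  obtain es where "edge_path (rng \<nu>) es (src \<nu>)" "compose es (src \<nu>) = \<nu>"
    using step(1)[OF f(6)[symmetric] f(2)] by blast
  then show ?case
    using f by (intro exI[of _ "\<mu> # es"]) (auto simp: kg_edges_iff Rng_Cmp Src_Cmp)
qed

text \<open>
  Among edges of a single degree there are no commuting squares: the first edge of the path is its
  factor of degree \<open>d\<close>.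
\<close>

lemma edge_path_unique:
  assumes "edge_path x es y" "edge_path x es' y" "compose es y = compose es' y"
    and "\<And>e. e \<in> set es \<union> set es' \<Longrightarrow> deg e = d" "d \<noteq> 0"
  shows "es = es'"
  using assms(1-4)
proof (induction es arbitrary: x es')
  case Nil
  have "(\<Sum>e\<leftarrow>es'. deg e) = 0"
    using edge_path_compose[OF Nil(1)] edge_path_compose[OF Nil(2)] Nil(3) by simp
  then show ?case
    using Nil(4) assms(5) by (cases es') (auto simp: vec_eq_iff)
next
  case (Cons e es)
  have "(\<Sum>e\<leftarrow>es'. deg e) = deg e + (\<Sum>e\<leftarrow>es. deg e)"
    using edge_path_compose[OF Cons.prems(1)] edge_path_compose[OF Cons.prems(2)] Cons.prems(3) by simp
  then obtain e' fs where es': "es' = e' # fs"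
    using Cons.prems(4)[of e] assms(5) by (cases es') (auto simp: vec_eq_iff)
  have "e = e' \<and> compose es y = compose fs y"
    using Cons.prems edge_path_compose[of "src e" es y] edge_path_compose[of "src e'" fs y]
    by (intro factorisation_unique) (auto simp: es' edge_Mor)
  with Cons show ?case by (auto simp: es')
qed

end

locale limar = k_graph \<Lambda>
  for \<Lambda> :: "('m, 'k::finite) kgraph" +
  fixes b :: 'k and w :: 'm and \<E> :: "'m \<Rightarrow> nat \<Rightarrow> 'm set"
  assumes limar_data: "limar_data \<Lambda> b w \<E>"
    and sink_free: "CARD('k) \<ge> 3 \<longrightarrow> sink_free \<Lambda> b"
begin

abbreviation fib :: "'m \<Rightarrow> nat set" where
  "fib v \<equiv> {1..split_num \<Lambda> b w v}"

abbreviation out :: "'m \<Rightarrow> 'm set" where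
  "out \<equiv> edges_out \<Lambda> b"

abbreviation pidx :: "'m \<Rightarrow> nat" where
  "pidx \<equiv> part_index \<Lambda> b w \<E>"

abbreviation last_B :: "'m \<Rightarrow> 'm" where
  "last_B \<equiv> suffix_of \<Lambda> (basis_deg b)"

lemma out_iff: "e \<in> out v \<longleftrightarrow> e \<in> mor \<and> deg e = basis_deg b \<and> src e = v"
  by (auto simp: edges_out_def kg_edges_iff)

lemma split_verts_out:
  assumes "v \<in> split_verts \<Lambda> b w"
  shows "v \<in> verts" "finite (out v)" "2 \<le> card (out v)"
proof -
  show fin: "finite (out v)" using assms limar_data by (auto simp: limar_data_def)
  have "v \<in> verts \<and> at_least_two (out v)"
    using assms limar_data by (cases rule: split_verts.cases) (auto simp: limar_data_def edge_Mor Rng_vert)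
  then show "v \<in> verts" "2 \<le> card (out v)" using fin by (auto simp: at_least_two_def)
qed

lemma one_fib: "1 \<in> fib v"
  using split_verts_out(3)[of v] by (auto simp: split_num_def)

lemma fib_not_split: "v \<notin> split_verts \<Lambda> b w \<Longrightarrow> fib v = {1}"
  by (auto simp: split_num_def)

lemma parts:
  assumes "v \<in> verts" "out v \<noteq> {}"
  shows "(\<Union>i\<in>fib v. \<E> v i) = out v" "disjoint_family_on (\<E> v) (fib v)" "\<forall>i\<in>fib v. \<E> v i \<noteq> {}"
  using assms limar_data by (auto simp: limar_data_def)

lemma pidx_eq:
  assumes "c \<in> mor" "deg c = basis_deg b" "j \<in> fib (src c)" "c \<in> \<E> (src c) j"
  shows "pidx c = j"
proof -
  have v: "src c \<in> verts" "out (src c) \<noteq> {}"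
    using assms by (auto simp: Src_vert out_iff)
  show ?thesis
    unfolding part_index_def using parts(2)[OF v] assms(3,4)
    by (intro the_equality) (simp, metis disjoint_family_on_def disjoint_iff)
qed

lemma pidx:
  assumes "c \<in> mor" "deg c = basis_deg b"
  shows "pidx c \<in> fib (src c)" "c \<in> \<E> (src c) (pidx c)"
proof -
  have "src c \<in> verts" "c \<in> out (src c)"
    using assms by (auto simp: Src_vert out_iff)
  then obtain j where j: "j \<in> fib (src c)" "c \<in> \<E> (src c) j"
    using parts(1)[of "src c"] by blast
  then show "pidx c \<in> fib (src c)" "c \<in> \<E> (src c) (pidx c)"
    using pidx_eq[OF assms j] by simp_all
qed

lemma part_subset: "v \<in> verts \<Longrightarrow> out v \<noteq> {} \<Longrightarrow> i \<in> fib v \<Longrightarrow> f \<in> \<E> v i \<Longrightarrow> f \<in> out v"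
  using parts(1) by blast

text \<open>
  A split vertex has as many parts as edges of degree \<open>B\<close>.
\<close>

lemma split_part_singleton:
  assumes "v \<in> split_verts \<Lambda> b w" "i \<in> fib v" "f \<in> \<E> v i" "f' \<in> \<E> v i"
  shows "f = f'"
proof -
  note v = split_verts_out[OF assms(1)]
  then have ne: "out v \<noteq> {}" by auto
  have n: "split_num \<Lambda> b w v = card (out v)" using assms(1) by (simp add: split_num_def)
  show ?thesis
  proof (rule card_partition_singletons[OF parts(2,3)[OF v(1) ne] _ _ assms(2-4)])
    show "finite (\<Union>i\<in>fib v. \<E> v i)" "card (\<Union>i\<in>fib v. \<E> v i) = split_num \<Lambda> b w v"
      unfolding parts(1)[OF v(1) ne] by (rule v(2), rule n[symmetric])
  qed
qed

text \<open>
  The edge \<open>c\<close> of the square is a suffix of the composite, which makes it accessible to unique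
  factorisation for longer paths.
\<close>

lemma commuting_square:
  assumes "e \<in> kg_edges \<Lambda>" "f \<in> out (rng e)"
  obtains a c where "a \<in> mor" "c \<in> mor" "deg a = deg e" "deg c = basis_deg b" "src a = rng c"
    "cmp f e = cmp a c" "src c = src e" "commuted_edge \<Lambda> b f e = c" "last_B (cmp f e) = c"
proof -
  have e: "e \<in> mor" and f: "f \<in> mor" "deg f = basis_deg b" "src f = rng e"
    using assms by (auto simp: edge_Mor out_iff)
  have fe: "cmp f e \<in> mor" "deg (cmp f e) = deg e + basis_deg b" "src (cmp f e) = src e"
    using e f by (simp_all add: Cmp_closed Deg_Cmp Src_Cmp add.commute)
  from fe(1,2) obtain a c where ac: "a \<in> mor" "c \<in> mor" "src a = rng c" "cmp f e = cmp a c"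
    "deg a = deg e" "deg c = basis_deg b" by (rule factorise)
  have edges: "a \<in> kg_edges \<Lambda>" "c \<in> kg_edges \<Lambda>"
    using ac assms(1) by (auto simp: kg_edges_iff)
  have "commuted_edge \<Lambda> b f e = c"
    unfolding commuted_edge_def
  proof (rule the_equality)
    show "c \<in> kg_edges \<Lambda> \<and> deg c = basis_deg b \<and>
      (\<exists>a\<in>kg_edges \<Lambda>. deg a = deg e \<and> src a = rng c \<and> cmp f e = cmp a c)"
      using ac edges by blast
  next
    fix c' assume "c' \<in> kg_edges \<Lambda> \<and> deg c' = basis_deg b \<and>
      (\<exists>a\<in>kg_edges \<Lambda>. deg a = deg e \<and> src a = rng c' \<and> cmp f e = cmp a c')"
    then obtain a' where "a' \<in> mor" "c' \<in> mor" "deg a' = deg e" "src a' = rng c'" "cmp f e = cmp a' c'"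
      using edge_Mor by blast
    then show "c' = c"
      using ac factorisation_unique[of a' c' a c] by simp
  qed
  moreover have "last_B (cmp f e) = c"
    using suffix_of_Cmp[of a c] ac by simp
  moreover have "src c = src e"
    using fe(3) ac by (simp add: Src_Cmp)
  ultimately show thesis using that ac by blast
qed

definition transport_edge :: "'m \<Rightarrow> nat \<Rightarrow> nat" where
  "transport_edge e i = snd (dsrc (split_digraph \<Lambda> b w \<E>) (e, i))"

lemma transport_edge_B: "deg e = basis_deg b \<Longrightarrow> transport_edge e i = pidx e"
  by (simp add: transport_edge_def split_digraph_def)

text \<open>
  The result does not depend on the edge \<open>f\<close> of the part. If a part has two edges, then its vertex is not
  split although it emits two edges of degree \<open>B\<close>. So the source of \<open>e\<close> is not split either, as otherwise
  \<open>e\<close> would have propagated the splitting, and 1 is the only index there.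
\<close>

lemma transport_edge_A:
  assumes e: "e \<in> kg_edges \<Lambda>" "deg e \<noteq> basis_deg b" and i: "i \<in> fib (rng e)"
    and f: "f \<in> out (rng e)" "f \<in> \<E> (rng e) i"
  shows "transport_edge e i = pidx (last_B (cmp f e))"
proof -
  have r: "rng e \<in> verts" "out (rng e) \<noteq> {}" using e f by (auto simp: Rng_vert edge_Mor)
  define f' where "f' = (SOME f. f \<in> \<E> (rng e) i)"
  have f': "f' \<in> \<E> (rng e) i" unfolding f'_def using f(2) by (rule someI)
  then have f'_out: "f' \<in> out (rng e)" using part_subset[OF r i] by blast
  from commuting_square[OF e(1) f'_out] obtain c' where c': "c' \<in> mor" "deg c' = basis_deg b" "src c' = src e"
    "commuted_edge \<Lambda> b f' e = c'" "last_B (cmp f' e) = c'" by metis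
  from commuting_square[OF e(1) f(1)] obtain c where c: "c \<in> mor" "deg c = basis_deg b" "src c = src e"
    "last_B (cmp f e) = c" by metis
  have "transport_edge e i = pidx c'"
    using e r c'(4) by (simp add: transport_edge_def split_digraph_def f'_def)
  also have "\<dots> = pidx c"
  proof (cases "f = f'")
    case True
    then show ?thesis using c c' by simp
  next
    case False
    have "rng e \<notin> split_verts \<Lambda> b w"
      using split_part_singleton[OF _ i f(2) f'] False by blast
    moreover have "at_least_two (out (rng e))"
    proof (cases "finite (out (rng e))")
      case True
      then have "card {f, f'} \<le> card (out (rng e))"
        using f f'_out by (intro card_mono) auto
      then show ?thesis using False by (simp add: at_least_two_def)
    qed (simp add: at_least_two_def)
    ultimately have "src e \<notin> split_verts \<Lambda> b w"
      using split_verts.step e by metis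
    then have one: "fib (src e) = {1}" by (rule fib_not_split)
    have "pidx c' \<in> {1}" "pidx c \<in> {1}"
      using pidx(1)[OF c'(1,2), unfolded c'(3) one] pidx(1)[OF c(1,2), unfolded c(3) one] .
    then show ?thesis by (metis singletonD)
  qed
  finally show ?thesis using c by simp
qed

lemma transport_edge_closed:
  assumes e: "e \<in> kg_edges \<Lambda>" and i: "i \<in> fib (rng e)"
  shows "transport_edge e i \<in> fib (src e)"
proof (cases "deg e = basis_deg b")
  case True
  then show ?thesis using pidx(1)[of e] e by (simp add: transport_edge_B edge_Mor)
next
  case A: False
  show ?thesis
  proof (cases "out (rng e) = {}")
    case True
    then show ?thesis using A one_fib by (simp add: transport_edge_def split_digraph_def)
  next
    case False
    have r: "rng e \<in> verts" using e by (simp add: Rng_vert edge_Mor)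
    then obtain f where f: "f \<in> \<E> (rng e) i" "f \<in> out (rng e)"
      using parts(3)[OF r False] part_subset[OF r False i] i by blast
    from commuting_square[OF e f(2)] obtain c where "c \<in> mor" "deg c = basis_deg b" "src c = src e"
      "last_B (cmp f e) = c" by metis
    then show ?thesis using transport_edge_A[OF e A i f(2,1)] pidx(1)[of c] by simp
  qed
qed

primrec transport :: "'m list \<Rightarrow> nat \<Rightarrow> nat" where
  "transport [] i = i"
| "transport (e # es) i = transport es (transport_edge e i)"

lemma transport_closed: "edge_path x es y \<Longrightarrow> i \<in> fib x \<Longrightarrow> transport es i \<in> fib y"
proof (induction es arbitrary: x i)
  case (Cons e es)
  then show ?case using transport_edge_closed[of e i] by auto
qed simp

text \<open>
  Push \<open>f\<close> through the path edge by edge. An edge of degree \<open>B\<close> takes over the role of \<open>f\<close>. For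
  another edge \<open>e\<close>, the square \<open>fe = ac\<close> gives an edge \<open>c\<close> of degree \<open>B\<close> that continues, and it lies
  in the part whose index \<open>e\<close> transports to. The last edge of degree \<open>B\<close> in the composite is not
  affected by what is split off on the left.
\<close>

lemma transport_after_B_edge:
  assumes "edge_path x es y" "f \<in> out x" "f \<in> \<E> x i" "i \<in> fib x"
  shows "transport es i = pidx (last_B (cmp f (compose es y)))"
  using assms
proof (induction es arbitrary: x f i)
  case Nil
  then have f: "f \<in> mor" "deg f = basis_deg b" "src f = x" "x = y" by (auto simp: out_iff)
  then have "cmp f y = f" using Cmp_Src[of f] by simp
  then show ?case
    using Nil f pidx_eq[of f i] suffix_of_self[of f] by simp
next
  case (Cons e es)
  let ?\<mu> = "compose es y"
  have e: "e \<in> kg_edges \<Lambda>" "e \<in> mor" "rng e = x" "edge_path (src e) es y"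
    using Cons.prems by (auto simp: edge_Mor)
  have \<mu>: "?\<mu> \<in> mor" "rng ?\<mu> = src e" using edge_path_compose[OF e(4)] by auto
  have f: "f \<in> mor" "deg f = basis_deg b" "src f = rng e" using Cons.prems e by (auto simp: out_iff)
  show ?case
  proof (cases "deg e = basis_deg b")
    case True
    have "transport es (pidx e) = pidx (last_B (cmp e ?\<mu>))"
      using pidx[of e] True e by (intro Cons.IH) (auto simp: out_iff)
    moreover have "last_B (cmp f (cmp e ?\<mu>)) = last_B (cmp e ?\<mu>)"
      using e \<mu> f True by (intro suffix_of_Cmp_left[of _ _ "deg ?\<mu>"]) (simp_all add: Cmp_closed Rng_Cmp Deg_Cmp add.commute)
    ultimately show ?thesis by (simp add: transport_edge_B[OF True])
  next
    case False
    from commuting_square[of e f] Cons.prems e obtain a c where ac: "a \<in> mor" "c \<in> mor" "deg c = basis_deg b"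
      "src a = rng c" "cmp f e = cmp a c" "src c = src e" "last_B (cmp f e) = c" by metis
    have "transport_edge e i = pidx c"
      using transport_edge_A[of e i f] Cons.prems e False ac by simp
    moreover have "transport es (pidx c) = pidx (last_B (cmp c ?\<mu>))"
      using pidx[of c] ac e by (intro Cons.IH) (auto simp: out_iff)
    moreover have "last_B (cmp f (cmp e ?\<mu>)) = last_B (cmp c ?\<mu>)"
    proof -
      have "cmp f (cmp e ?\<mu>) = cmp a (cmp c ?\<mu>)"
        using ac e \<mu> f by (simp add: Cmp_assoc[symmetric])
      moreover have "last_B (cmp a (cmp c ?\<mu>)) = last_B (cmp c ?\<mu>)"
        using ac \<mu> by (intro suffix_of_Cmp_left[of _ _ "deg ?\<mu>"]) (simp_all add: Cmp_closed Rng_Cmp Deg_Cmp add.commute)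
      ultimately show ?thesis by simp
    qed
    ultimately show ?thesis by simp
  qed
qed

lemma degree_split_B: "n $ b \<noteq> 0 \<Longrightarrow> \<exists>m. n = m + (basis_deg b :: nat ^ 'k)"
  by (intro exI[of _ "n - basis_deg b"]) (auto simp: vec_eq_iff axis_def)

text \<open>
  An edge \<open>f\<close> in the part with index \<open>i\<close> may be put in front without changing the last edge of degree \<open>B\<close>.
  If there is no such \<open>f\<close>, then walk along the path to the first vertex where there is one, or to the
  first edge of degree \<open>B\<close>.
\<close>

lemma transport_through_B:
  assumes "edge_path x es y" "i \<in> fib x" "deg (compose es y) $ b \<noteq> 0"
  shows "transport es i = pidx (last_B (compose es y))"
  using assms
proof (induction es arbitrary: x i)
  case Nil
  then show ?case by (auto simp: vert_Deg)
next
  case (Cons e es)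
  let ?\<mu> = "compose es y"
  have e: "e \<in> kg_edges \<Lambda>" "e \<in> mor" "rng e = x" "edge_path (src e) es y"
    using Cons.prems by (auto simp: edge_Mor)
  have \<mu>: "?\<mu> \<in> mor" "rng ?\<mu> = src e" using edge_path_compose[OF e(4)] by auto
  have x: "x \<in> verts" using e by (auto simp: Rng_vert)
  show ?case
  proof (cases "out x = {}")
    case False
    then obtain f where f: "f \<in> \<E> x i" "f \<in> out x"
      using parts(3)[OF x False] part_subset[OF x False Cons.prems(2)] Cons.prems(2) by blast
    obtain m where "deg (compose (e # es) y) = m + basis_deg b"
      using degree_split_B Cons.prems(3) by blast
    then have "last_B (cmp f (compose (e # es) y)) = last_B (compose (e # es) y)"
      using edge_path_compose[OF Cons.prems(1)] f(2)
      by (intro suffix_of_Cmp_left[of f _ m]) (auto simp: out_iff simp del: foldr.simps)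
    then show ?thesis
      using transport_after_B_edge[OF Cons.prems(1) f(2,1) Cons.prems(2)] by simp
  next
    case sink: True
    show ?thesis
    proof (cases "deg e = basis_deg b")
      case True
      then show ?thesis
        using transport_after_B_edge[of "src e" es y e "pidx e"] pidx[of e] e
        by (simp add: out_iff transport_edge_B)
    next
      case False
      then obtain c where "deg e = basis_deg c" "c \<noteq> b" using e by (auto simp: kg_edges_iff)
      then have "deg ?\<mu> $ b \<noteq> 0"
        using Cons.prems(3) e \<mu> by (simp add: Deg_Cmp axis_def)
      moreover from this obtain m where "deg ?\<mu> = m + basis_deg b" using degree_split_B by blast
      then have "last_B (cmp e ?\<mu>) = last_B ?\<mu>"
        using e \<mu> by (intro suffix_of_Cmp_left) auto
      ultimately show ?thesis
        using Cons.IH[OF e(4), of "transport_edge e i"] transport_edge_closed[of e i] e Cons.prems(2) by simp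
    qed
  qed
qed

text \<open>
  Three cases: some edge of degree \<open>B\<close> leaves the range; or the composite involves the degree \<open>B\<close>; or
  neither holds. In the last case there is a sink of degree \<open>B\<close>, so there are at most two colours,
  and the edges of the path have the one that is not \<open>B\<close>.
\<close>

lemma transport_cong:
  assumes p: "edge_path x es y" "edge_path x es' y" "compose es y = compose es' y" and i: "i \<in> fib x"
  shows "transport es i = transport es' i"
proof -
  have x: "x \<in> verts" using edge_path_compose[OF p(1)] by blast
  consider "out x \<noteq> {}" | "deg (compose es y) $ b \<noteq> 0" | "out x = {}" "deg (compose es y) $ b = 0"
    by blast
  then show ?thesis
  proof cases
    case 1
    then obtain f where f: "f \<in> \<E> x i" "f \<in> out x"
      using parts(3)[OF x 1] part_subset[OF x 1 i] i by blast
    then show ?thesis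
      using transport_after_B_edge[OF p(1) f(2,1) i] transport_after_B_edge[OF p(2) f(2,1) i] p(3) by simp
  next
    case 2
    then show ?thesis
      using transport_through_B[OF p(1) i] transport_through_B[OF p(2) i] p(3) by simp
  next
    case 3
    have "\<not> sink_free \<Lambda> b" using 3 x by (auto simp: sink_free_def)
    then have card: "CARD('k) < 3" using sink_free by linarith
    have one_colour: "c = c'" if "c \<noteq> b" "c' \<noteq> b" for c c' :: 'k
    proof (rule ccontr)
      assume "c \<noteq> c'"
      then have "card {b, c, c'} = 3" using that by simp
      moreover have "card {b, c, c'} \<le> CARD('k)" by (intro card_mono) auto
      ultimately show False using card by simp
    qed
    have "\<exists>c. deg e = basis_deg c \<and> c \<noteq> b" if "e \<in> set fs" "edge_path x fs y" "deg (compose fs y) $ b = 0" for e fs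
    proof -
      have "edge_path x fs y \<Longrightarrow> e \<in> set fs \<Longrightarrow> e \<in> kg_edges \<Lambda>" for x
        by (induction fs arbitrary: x) auto
      then have "e \<in> kg_edges \<Lambda>" using that by blast
      then obtain c where c: "deg e = basis_deg c" unfolding kg_edges_iff by blast
      have "(\<Sum>e\<leftarrow>fs. deg e) $ b = (\<Sum>e\<leftarrow>fs. deg e $ b)" by (induction fs) auto
      then have "deg e $ b = 0"
        using edge_path_compose[OF that(2)] that(1,3) by auto
      then show ?thesis using c by (auto simp: axis_def)
    qed
    then have colours: "\<exists>c. deg e = basis_deg c \<and> c \<noteq> b" if "e \<in> set es \<union> set es'" for e
      using that p 3 by auto
    have "es = es'"
    proof (cases "set es \<union> set es' = {}")
      case False
      then obtain e0 where "e0 \<in> set es \<union> set es'" by (meson all_not_in_conv)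
      then obtain c where c: "deg e0 = basis_deg c" "c \<noteq> b" using colours by blast
      then have "deg e = basis_deg c" if "e \<in> set es \<union> set es'" for e
        using colours[OF that] one_colour by blast
      then show ?thesis
        by (intro edge_path_unique[OF p]) (auto simp: axis_eq_0_iff)
    qed simp
    then show ?thesis by simp
  qed
qed

section \<open>The LiMaR-split as a synchronised fibration\<close>

text \<open>
  By \<open>transport_cong\<close> any factorisation into edges gives the same value.
\<close>

definition act :: "'m \<Rightarrow> nat \<Rightarrow> nat" where
  "act \<alpha> i = transport (SOME es. edge_path (rng \<alpha>) es (src \<alpha>) \<and> compose es (src \<alpha>) = \<alpha>) i"

lemma act_compose:
  assumes "edge_path x es y" "i \<in> fib x"
  shows "act (compose es y) i = transport es i"
proof -
  let ?\<alpha> = "compose es y"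
  have \<alpha>: "rng ?\<alpha> = x" "src ?\<alpha> = y" using edge_path_compose[OF assms(1)] by auto
  define es' where "es' = (SOME es. edge_path (rng ?\<alpha>) es (src ?\<alpha>) \<and> compose es (src ?\<alpha>) = ?\<alpha>)"
  have "edge_path (rng ?\<alpha>) es' (src ?\<alpha>) \<and> compose es' (src ?\<alpha>) = ?\<alpha>"
    unfolding es'_def by (rule someI[of _ es]) (use assms \<alpha> in simp)
  then have "transport es' i = transport es i"
    using \<alpha> assms by (intro transport_cong[of x es' y es]) simp_all
  then show ?thesis by (simp add: act_def es'_def)
qed

abbreviation G :: "('m \<times> nat, 'm \<times> nat) rs_digraph" where
  "G \<equiv> split_digraph \<Lambda> b w \<E>"

lemma G_simps:
  "(v, i) \<in> dverts G \<longleftrightarrow> v \<in> verts \<and> i \<in> fib v"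
  "(e, i) \<in> dedges G \<longleftrightarrow> e \<in> kg_edges \<Lambda> \<and> i \<in> fib (rng e)"
  "drng G (e, i) = (rng e, i)"
  "dsrc G (e, i) = (src e, transport_edge e i)"
  by (simp_all add: split_digraph_def transport_edge_def)

lemma is_path_G:
  "is_path G (x, i) fs (y, j) \<Longrightarrow> edge_path x (map fst fs) y \<and> i \<in> fib x \<and> j = transport (map fst fs) i"
proof (induction fs arbitrary: x i)
  case (Cons f fs)
  obtain e l where f: "f = (e, l)" by (cases f)
  with Cons.prems have "e \<in> kg_edges \<Lambda>" "i \<in> fib (rng e)" "l = i" "rng e = x"
    "is_path G (src e, transport_edge e i) fs (y, j)"
    by (auto simp: G_simps)
  with Cons.IH f show ?case by auto
qed (auto simp: G_simps)

lemma is_path_G_exists: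
  "edge_path x es y \<Longrightarrow> i \<in> fib x \<Longrightarrow> \<exists>fs. map fst fs = es \<and> is_path G (x, i) fs (y, transport es i)"
proof (induction es arbitrary: x i)
  case Nil
  then show ?case by (intro exI[of _ "[]"]) (auto simp: G_simps)
next
  case (Cons e es)
  then have e: "e \<in> kg_edges \<Lambda>" "rng e = x" "edge_path (src e) es y" by auto
  with Cons obtain fs where "map fst fs = es"
    "is_path G (src e, transport_edge e i) fs (y, transport es (transport_edge e i))"
    using transport_edge_closed[of e i] by blast
  then show ?case
    using e Cons.prems by (intro exI[of _ "(e, i) # fs"]) (simp add: G_simps)
qed

text \<open>
  An equivalence class of paths of the split digraph: the source is left out of the condition as it is
  determined by the range and the composite.
\<close>

definition lift :: "'m \<Rightarrow> nat \<Rightarrow> ('m \<times> nat, 'm \<times> nat) path set" where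
  "lift \<alpha> i = {p \<in> paths G. composite \<Lambda> (par p) = \<alpha> \<and> path_rng p = (rng \<alpha>, i)}"

lemma path_in_lift:
  assumes "((x, i), fs, (y, j)) \<in> paths G"
  defines "\<alpha> \<equiv> compose (map fst fs) y"
  shows "\<alpha> \<in> mor" "i \<in> fib (rng \<alpha>)" "((x, i), fs, (y, j)) \<in> lift \<alpha> i"
    "src \<alpha> = y" "j = act \<alpha> i" "path_deg \<Lambda> ((x, i), fs, (y, j)) = deg \<alpha>"
proof -
  have p: "edge_path x (map fst fs) y" "i \<in> fib x" "j = transport (map fst fs) i"
    using is_path_G[of x i fs y j] assms(1) by (auto simp: paths_def)
  show "\<alpha> \<in> mor" "i \<in> fib (rng \<alpha>)" "src \<alpha> = y" "j = act \<alpha> i"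
    using edge_path_compose[OF p(1)] p act_compose[OF p(1,2)] by (auto simp: \<alpha>_def)
  show "((x, i), fs, (y, j)) \<in> lift \<alpha> i"
    using assms(1) edge_path_compose[OF p(1)] by (auto simp: lift_def par_def composite_def path_rng_def \<alpha>_def)
  show "path_deg \<Lambda> ((x, i), fs, (y, j)) = deg \<alpha>"
    using edge_path_compose[OF p(1)] by (simp add: path_deg_def \<alpha>_def comp_def)
qed

lemma path_in_lift':
  assumes "p \<in> paths G"
  shows "\<exists>\<alpha> i. \<alpha> \<in> mor \<and> i \<in> fib (rng \<alpha>) \<and> p \<in> lift \<alpha> i"
  using assms path_in_lift(1-3) by (cases p) (metis prod.collapse)

lemma lift_mem:
  assumes "p \<in> lift \<alpha> i"
  shows "p \<in> paths G" "path_src p = (src \<alpha>, act \<alpha> i)" "path_rng p = (rng \<alpha>, i)" "path_deg \<Lambda> p = deg \<alpha>"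
    "composite \<Lambda> (par p) = \<alpha>"
proof -
  obtain x i' fs y j where p: "p = ((x, i'), fs, (y, j))" by (metis prod.collapse)
  show mem: "p \<in> paths G" "path_rng p = (rng \<alpha>, i)" "composite \<Lambda> (par p) = \<alpha>"
    using assms by (auto simp: lift_def)
  then have "compose (map fst fs) y = \<alpha>" "i' = i" by (auto simp: p composite_def par_def path_rng_def)
  then show "path_src p = (src \<alpha>, act \<alpha> i)" "path_deg \<Lambda> p = deg \<alpha>"
    using path_in_lift(4-6)[OF mem(1)[unfolded p]] by (simp_all add: p path_src_def)
qed

lemma lift_nonempty:
  assumes "\<alpha> \<in> mor" "i \<in> fib (rng \<alpha>)"
  shows "\<exists>p. p \<in> lift \<alpha> i"
proof -
  obtain es where es: "edge_path (rng \<alpha>) es (src \<alpha>)" "compose es (src \<alpha>) = \<alpha>"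
    using edge_path_exists[OF assms(1)] by blast
  then obtain fs where fs: "map fst fs = es" "is_path G (rng \<alpha>, i) fs (src \<alpha>, transport es i)"
    using is_path_G_exists assms(2) by blast
  then have "((rng \<alpha>, i), fs, (src \<alpha>, transport es i)) \<in> lift \<alpha> i"
    using es by (simp add: lift_def paths_def par_def composite_def path_rng_def)
  then show ?thesis by blast
qed

lemma limar_class:
  assumes "p \<in> lift \<alpha> i"
  shows "limar_equiv \<Lambda> b w \<E> `` {p} = lift \<alpha> i"
proof (intro equalityI subsetI)
  fix q assume "q \<in> limar_equiv \<Lambda> b w \<E> `` {p}"
  then show "q \<in> lift \<alpha> i" using assms by (auto simp: limar_equiv_def lift_def)
next
  fix q assume "q \<in> lift \<alpha> i"
  then show "q \<in> limar_equiv \<Lambda> b w \<E> `` {p}"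
    using lift_mem[of q \<alpha> i] lift_mem[OF assms] by (simp add: limar_equiv_def)
qed

lemma vertex_path_lift: "v \<in> verts \<Longrightarrow> i \<in> fib v \<Longrightarrow> vertex_path (v, i) \<in> lift v i"
  by (simp add: vertex_path_def lift_def paths_def G_simps composite_def par_def path_rng_def Rng_of_vert)

lemma limar_vertex_lift: "v \<in> verts \<Longrightarrow> i \<in> fib v \<Longrightarrow> limar_vertex \<Lambda> b w \<E> v i = lift v i"
  unfolding limar_vertex_def by (intro limar_class vertex_path_lift)

lemma is_path_append: "is_path H x fs y \<Longrightarrow> is_path H y fs' z \<Longrightarrow> is_path H x (fs @ fs') z"
  by (induction fs arbitrary: x) auto

lemma path_concat_lift:
  assumes "p \<in> lift \<alpha> i" "q \<in> lift \<mu> (act \<alpha> i)" "src \<alpha> = rng \<mu>"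
  shows "path_concat p q \<in> lift (cmp \<alpha> \<mu>) i" and "act (cmp \<alpha> \<mu>) i = act \<mu> (act \<alpha> i)"
proof -
  note mp = lift_mem[OF assms(1)] and mq = lift_mem[OF assms(2)]
  obtain fs gs where p: "p = ((rng \<alpha>, i), fs, (src \<alpha>, act \<alpha> i))"
    and q: "q = ((rng \<mu>, act \<alpha> i), gs, (src \<mu>, act \<mu> (act \<alpha> i)))"
    using mp(2,3) mq(2,3) by (cases p; cases q) (auto simp: path_rng_def path_src_def)
  have ip: "is_path G (rng \<alpha>, i) fs (src \<alpha>, act \<alpha> i)"
    and iq: "is_path G (src \<alpha>, act \<alpha> i) gs (src \<mu>, act \<mu> (act \<alpha> i))"
    using mp(1) mq(1) assms(3) by (simp_all add: p q paths_def)
  have "path_concat p q = ((rng \<alpha>, i), fs @ gs, (src \<mu>, act \<mu> (act \<alpha> i)))"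
    by (simp add: path_concat_def p q)
  moreover have "\<dots> \<in> paths G" using is_path_append[OF ip iq] by (simp add: paths_def)
  moreover have "compose (map fst (fs @ gs)) (src \<mu>) = cmp \<alpha> \<mu>"
    using compose_append[of "rng \<alpha>" "map fst fs" "src \<alpha>" "map fst gs" "src \<mu>"] is_path_G[OF ip] is_path_G[OF iq]
      mp(5) mq(5) by (simp add: p q composite_def par_def)
  ultimately show "path_concat p q \<in> lift (cmp \<alpha> \<mu>) i" "act (cmp \<alpha> \<mu>) i = act \<mu> (act \<alpha> i)"
    using path_in_lift(3,5)[of "rng \<alpha>" i "fs @ gs" "src \<mu>" "act \<mu> (act \<alpha> i)"] by simp_all
qed

lemma limar_fibration:
  assumes "row_finite \<Lambda>"
  shows "synchronised_fibration \<Lambda> (limar_split \<Lambda> b w \<E>) fib act lift b 1"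
proof
  let ?\<Gamma> = "limar_split \<Lambda> b w \<E>"
  show act_closed: "act \<alpha> i \<in> fib (src \<alpha>)" if "\<alpha> \<in> mor" "i \<in> fib (rng \<alpha>)" for \<alpha> i
    using edge_path_exists[OF that(1)] act_compose transport_closed that(2) by metis
  show "act v i = i" if "v \<in> verts" "i \<in> fib v" for v i
    using act_compose[of v "[]" v i] that by simp
  show "act (cmp \<alpha> \<mu>) i = act \<mu> (act \<alpha> i)"
    if "\<alpha> \<in> mor" "\<mu> \<in> mor" "src \<alpha> = rng \<mu>" "i \<in> fib (rng \<alpha>)" for \<alpha> \<mu> i
    using lift_nonempty[of \<alpha> i] lift_nonempty[of \<mu> "act \<alpha> i"] act_closed[of \<alpha> i] that path_concat_lift(2)
    by metis
  show "Mor ?\<Gamma> = {lift \<alpha> i | \<alpha> i. \<alpha> \<in> mor \<and> i \<in> fib (rng \<alpha>)}"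
  proof (intro equalityI subsetI)
    fix C assume "C \<in> Mor ?\<Gamma>"
    then obtain p where "p \<in> paths G" "C = limar_equiv \<Lambda> b w \<E> `` {p}"
      by (auto simp: limar_split_def Let_def quotient_def)
    then show "C \<in> {lift \<alpha> i | \<alpha> i. \<alpha> \<in> mor \<and> i \<in> fib (rng \<alpha>)}"
      using path_in_lift'[of p] limar_class by blast
  next
    fix C assume "C \<in> {lift \<alpha> i | \<alpha> i. \<alpha> \<in> mor \<and> i \<in> fib (rng \<alpha>)}"
    then obtain \<alpha> i p where "C = lift \<alpha> i" "p \<in> lift \<alpha> i" using lift_nonempty by blast
    then show "C \<in> Mor ?\<Gamma>"
      using limar_class[of p \<alpha> i] lift_mem(1)[of p \<alpha> i] by (auto simp: limar_split_def Let_def quotient_def)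
  qed
  show "\<alpha> = \<mu> \<and> i = j"
    if mor: "\<alpha> \<in> mor" "i \<in> fib (rng \<alpha>)" and eq: "lift \<alpha> i = lift \<mu> j" for \<alpha> \<mu> i j
  proof -
    obtain p where p: "p \<in> lift \<alpha> i" using lift_nonempty[OF mor] by blast
    with eq have p': "p \<in> lift \<mu> j" by blast
    have "\<alpha> = \<mu>" by (rule trans[OF sym[OF lift_mem(5)[OF p]] lift_mem(5)[OF p']])
    moreover have "i = j" using trans[OF sym[OF lift_mem(3)[OF p]] lift_mem(3)[OF p']] by (rule Pair_inject)
    ultimately show ?thesis by blast
  qed
  fix \<alpha> i assume \<alpha>: "\<alpha> \<in> mor" "i \<in> fib (rng \<alpha>)"
  obtain p where p: "p \<in> lift \<alpha> i" using lift_nonempty[OF \<alpha>] by blast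
  have "path_deg \<Lambda> ` lift \<alpha> i = {deg \<alpha>}"
  proof (intro equalityI subsetI)
    fix d assume "d \<in> path_deg \<Lambda> ` lift \<alpha> i"
    then show "d \<in> {deg \<alpha>}" using lift_mem(4) by blast
  next
    fix d assume "d \<in> {deg \<alpha>}"
    then show "d \<in> path_deg \<Lambda> ` lift \<alpha> i" using lift_mem(4)[OF p] p by (intro image_eqI[of _ _ p]) auto
  qed
  then show "Deg ?\<Gamma> (lift \<alpha> i) = deg \<alpha>"
    by (simp add: limar_split_def Let_def)
  have "(\<Union>p\<in>lift \<alpha> i. limar_equiv \<Lambda> b w \<E> `` {vertex_path (path_rng p)}) = (\<Union>p\<in>lift \<alpha> i. lift (rng \<alpha>) i)"
    using \<alpha> by (intro SUP_cong refl) (simp add: lift_mem(3) limar_class vertex_path_lift Rng_vert)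
  then show "Rng ?\<Gamma> (lift \<alpha> i) = lift (rng \<alpha>) i"
    using p by (auto simp: limar_split_def Let_def)
  have "(\<Union>p\<in>lift \<alpha> i. limar_equiv \<Lambda> b w \<E> `` {vertex_path (path_src p)}) = (\<Union>p\<in>lift \<alpha> i. lift (src \<alpha>) (act \<alpha> i))"
    using \<alpha> act_closed[OF \<alpha>]
    by (intro SUP_cong refl) (simp add: lift_mem(2) limar_class vertex_path_lift Src_vert)
  then show "Src ?\<Gamma> (lift \<alpha> i) = lift (src \<alpha>) (act \<alpha> i)"
    using p by (auto simp: limar_split_def Let_def)
  fix \<mu> assume \<mu>: "\<mu> \<in> mor" "src \<alpha> = rng \<mu>"
  obtain q where q: "q \<in> lift \<mu> (act \<alpha> i)"
    using lift_nonempty[OF \<mu>(1)] act_closed[OF \<alpha>] \<mu>(2) by metis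
  have "(\<Union>p\<in>lift \<alpha> i. \<Union>q\<in>lift \<mu> (act \<alpha> i). limar_equiv \<Lambda> b w \<E> `` {path_concat p q}) =
      (\<Union>p\<in>lift \<alpha> i. \<Union>q\<in>lift \<mu> (act \<alpha> i). lift (cmp \<alpha> \<mu>) i)"
    using \<mu> by (intro SUP_cong refl) (simp add: limar_class[OF path_concat_lift(1)])
  then show "Cmp ?\<Gamma> (lift \<alpha> i) (lift \<mu> (act \<alpha> i)) = lift (cmp \<alpha> \<mu>) i"
    using p q by (auto simp: limar_split_def Let_def)
next
  show "row_finite \<Lambda>" by fact
  show "act \<alpha> i = act \<alpha> j"
    if "\<alpha> \<in> mor" "deg \<alpha> = basis_deg b" "i \<in> fib (rng \<alpha>)" "j \<in> fib (rng \<alpha>)" for \<alpha> i j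
  proof -
    have "edge_path (rng \<alpha>) [\<alpha>] (src \<alpha>)" "compose [\<alpha>] (src \<alpha>) = \<alpha>"
      using that by (auto simp: kg_edges_iff Src_vert Cmp_Src)
    then show ?thesis
      using act_compose[of "rng \<alpha>" "[\<alpha>]" "src \<alpha>"] that transport_edge_B[of \<alpha>] by simp
  qed
  show "1 \<in> fib v" if "v \<in> verts" for v by (rule one_fib)
qed

end

theorem theorem4p9:
  fixes \<Lambda> :: "('m, 'k::finite) kgraph"
    and b :: 'k
    and w :: 'm
    and \<E> :: "'m \<Rightarrow> nat \<Rightarrow> 'm set"
  assumes "k_graph \<Lambda>"
    and "row_finite \<Lambda>"
    and "source_free \<Lambda>"
    and "CARD('k) \<ge> 3 \<longrightarrow> sink_free \<Lambda> b"
    and "limar_data \<Lambda> b w \<E>"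
  shows "let \<Gamma> = limar_split \<Lambda> b w \<E>;
             X = {limar_vertex \<Lambda> b w \<E> v 1 | v. v \<in> kg_verts \<Lambda>}
         in \<exists>\<psi> \<in> alg_iso (KP \<Lambda> :: ('f::field, _) module) (KP_corner \<Gamma> X).
              (\<forall>n. \<psi> ` kp_component \<Lambda> n = corner_set \<Gamma> X (kp_component \<Gamma> n)) \<and>
              \<psi> ` kp_diagonal \<Lambda> = PX_left \<Gamma> X ` kp_diagonal \<Gamma>"
proof -
  interpret limar \<Lambda> b w \<E>
    using assms by (simp add: limar_def limar_axioms_def)
  interpret F: synchronised_fibration \<Lambda> "limar_split \<Lambda> b w \<E>" fib act lift b 1
    by (rule limar_fibration) fact
  have "{limar_vertex \<Lambda> b w \<E> v 1 | v. v \<in> kg_verts \<Lambda>} = {lift v 1 | v. v \<in> kg_verts \<Lambda>}"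
    using limar_vertex_lift one_fib by (intro Collect_cong) metis
  then show ?thesis
    unfolding Let_def using F.corner_isomorphism[where ?'f = 'f] by simp
qed

end
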